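(* Let $n\ge1$ and let $p,a,b$ be real numbers with $\frac12\le p\le2$, $a\ge0$, $b\ge0$ and $a+b\ge1$. Let $K$ and $L$ be smooth uniformly h-convex bounded domains in $\mathbb{H}^{n+1}$. Let $a\cdot K+_p b\cdot L$ be the h-convex bounded domain with horospherical support function $\frac1p\log\left(ae^{pu_K}+be^{pu_L}\right)$. Then the light-cone pointwise sum $a\cdot K\,\widetilde{+}_p\, b\cdot L$ satisfies $$a\cdot K\,\widetilde{+}_p\, b\cdot L=a\cdot K+_p b\cdot L .$$ Consequently, the ball-wise pointwise sum of $K$ and $L$ (the set $\mathcal{U}_p(a,K,b,L)$ defined in the context) also equals $a\cdot K+_pb\cdot L$.
   Context: Minkowski space $\mathbb{R}^{n+1,1}$ is $\mathbb{R}^{n+2}$ with $\langle X,Y\rangle=\sum_{i=0}^n x_iy_i-x_{n+1}y_{n+1}$; write $X=(x,x_{n+1})$, $x\in\mathbb{R}^{n+1}$. $\mathbb{H}^{n+1}=\{X:\langle X,X\rangle=-1,\ x_{n+1}>0\}$ with geodesic distance $d$, and $\mathbb{S}^n\subset\mathbb{R}^{n+1}$ is the unit sphere. Closed horo-balls: $\overline{B}_z(s)=\{X\in\mathbb{H}^{n+1}:\log(-\langle X,(z,1)\rangle)\le s\}$, $z\in\mathbb{S}^n$. An h-convex bounded domain is a nonempty bounded intersection of closed horo-balls. A smooth bounded domain (compact, connected, nonempty interior, smooth boundary) is uniformly h-convex if for some $\delta>0$ all principal curvatures of its boundary (outward normal) exceed $1+\delta$. Horospherical support function: $u_\Omega(z)=\sup_{X\in\Omega}\log(-\langle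 X,(z,1)\rangle)$. For $p,a,b,K,L$ as in the claim there is exactly one h-convex bounded domain with horospherical support function $\frac1p\log(ae^{pu_K}+be^{pu_L})$. Let $q$ be the Hölder conjugate of $p$, $\frac1p+\frac1q=1$ (negative when $0<p<1$). Light-cone pointwise sum. For $X,Y,W\in\mathbb{H}^{n+1}$ and $t\in[0,1]$, say $(p,t,a,X,b,Y,W)$ is admissible if the vector $T-W=(\tau,\tau_{n+1})$ satisfies $\tau_{n+1}\ge|\tau|$, where $T=(1-t)^{1/q}a^{1/p}X+t^{1/q}b^{1/p}Y$ if $p\neq1$, and $T=aX+bY$ if $p=1$. For sets $K,L\subset\mathbb{H}^{n+1}$, $$a\cdot K\,\widetilde{+}_p\,b\cdot L=\begin{cases}\displaystyle\bigcup_{X\in K,Y\in L}\ \bigcup_{t\in[0,1]}\{W\in\mathbb{H}^{n+1}:(p,t,a,X,b,Y,W)\text{ admissible}\},&p\ge1,\\[2mm]\displaystyle\bigcup_{X\in K,Y\in L}\ \bigcap_{t}\{W\in\mathbb{H}^{n+1}:(p,t,a,X,b,Y,W)\text{ admissible}\},&0<p<1.\end{cases}$$ When $0<p<1$ the intersection is over $t\in(0,1)$ (at $t\in\{0,1\}$ a coefficient is infinite and no condition is imposed). Ball-wise pointwise sum. For $p\ne1$ put $$R(p,t;a,X,b,Y)=\left((1-t)^{2/q}a^{2/p}+t^{2/q}b^{2/p}+2(1-t)^{1/q}t^{1/q}a^{1/p}b^{1/p}\cosh d(X,Y)\right)^{1/2},$$ and let $P(p,t;a,X,b,Y)$ be the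 point on the geodesic segment $\overline{XY}$ whose distance to $X$ satisfies $\cosh d(P,X)=\dfrac{(1-t)^{1/q}a^{1/p}+t^{1/q}b^{1/p}\cosh d(X,Y)}{R}$. Let $B(p,t;a,X,b,Y)$ be the closed geodesic ball of center $P$ and radius $\log R$ if $R\ge1$, and the empty set if $R<1$. Similarly let $R(a,X,b,Y)=(a^2+b^2+2ab\cosh d(X,Y))^{1/2}$, let $P(a,X,b,Y)\in\overline{XY}$ satisfy $\cosh d(P,X)=\dfrac{a+b\cosh d(X,Y)}{R}$, and let $B(a,X,b,Y)$ be the closed geodesic ball of center $P$ and radius $\log R$ if $R\ge1$, empty if $R<1$. Then $\mathcal{U}_p(a,K,b,L)$ is $\bigcup_{X\in K,Y\in L}\bigcup_{t\in[0,1]}B(p,t;a,X,b,Y)$ for $p>1$, $\bigcup_{X\in K,Y\in L}B(a,X,b,Y)$ for $p=1$, and $\bigcup_{X\in K,Y\in L}\bigcap_{t}B(p,t;a,X,b,Y)$ for $0<p<1$ (again $t\in(0,1)$ in the intersection). *)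

theory Defs
  imports "HOL-Analysis.Analysis"
begin

section \<open>The hyperboloid model\<close>

text \<open>Minkowski space is \<open>real ^ 'm \<times> real\<close> with \<open>CARD('m) = n + 1\<close>; the last coordinate
  is the second component of the pair.\<close>

type_synonym 'm minkowski = "(real ^ 'm) \<times> real"

definition mink :: "'m::finite minkowski \<Rightarrow> 'm minkowski \<Rightarrow> real" where
  "mink X Y = fst X \<bullet> fst Y - snd X * snd Y"

definition hyp :: "'m::finite minkowski set" where
  "hyp = {X. mink X X = -1 \<and> snd X > 0}"

text \<open>On \<^const>\<open>hyp\<close> one has \<open>- mink X Y \<ge> 1\<close>, and the geodesic distance is determined by
  \<open>cosh d = - mink X Y\<close>.\<close>

definition hdist :: "'m::finite minkowski \<Rightarrow> 'm minkowski \<Rightarrow> real" where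
  "hdist X Y = arcosh (- mink X Y)"

definition hsegment :: "'m::finite minkowski \<Rightarrow> 'm minkowski \<Rightarrow> 'm minkowski set" where
  "hsegment X Y = {Z \<in> hyp. hdist X Z + hdist Z Y = hdist X Y}"

definition hcball :: "'m::finite minkowski \<Rightarrow> real \<Rightarrow> 'm minkowski set" where
  "hcball P r = {Z \<in> hyp. hdist P Z \<le> r}"

definition closed_horoball :: "real ^ 'm \<Rightarrow> real \<Rightarrow> 'm::finite minkowski set" where
  "closed_horoball z s = {X \<in> hyp. ln (- mink X (z, 1)) \<le> s}"

definition h_convex_bounded_domain :: "'m::finite minkowski set \<Rightarrow> bool" where
  "h_convex_bounded_domain \<Omega> \<longleftrightarrow>
     \<Omega> \<noteq> {} \<and>
     (\<exists>r. \<forall>X\<in>\<Omega>. \<forall>Y\<in>\<Omega>. hdist X Y \<le> r) \<and>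
     (\<exists>F. F \<subseteq> sphere 0 1 \<times> UNIV \<and> \<Omega> = hyp \<inter> (\<Inter>(z, s)\<in>F. closed_horoball z s))"

definition horo_support :: "'m::finite minkowski set \<Rightarrow> real ^ 'm \<Rightarrow> real" where
  "horo_support \<Omega> z = (SUP X\<in>\<Omega>. ln (- mink X (z, 1)))"


section \<open>Smooth domains and principal curvatures\<close>

primrec Ck_on :: "nat \<Rightarrow> 'a::real_normed_vector set \<Rightarrow> ('a \<Rightarrow> 'b::real_normed_vector) \<Rightarrow> bool" where
  "Ck_on 0 S f \<longleftrightarrow> continuous_on S f"
| "Ck_on (Suc k) S f \<longleftrightarrow>
     (\<forall>x\<in>S. f differentiable (at x)) \<and> (\<forall>v. Ck_on k S (\<lambda>x. frechet_derivative f (at x) v))"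

text \<open>Only used on open sets.\<close>

definition smooth_on :: "'a::real_normed_vector set \<Rightarrow> ('a \<Rightarrow> 'b::real_normed_vector) \<Rightarrow> bool" where
  "smooth_on S f \<longleftrightarrow> (\<forall>k. Ck_on k S f)"

definition hboundary :: "'m::finite minkowski set \<Rightarrow> 'm minkowski set" where
  "hboundary \<Omega> = (top_of_set hyp) frontier_of \<Omega>"

text \<open>A local defining function of \<open>\<Omega>\<close> on an open subset \<open>U\<close> of Minkowski space: \<open>\<Omega>\<close> is locally the
  sublevel set of \<open>\<rho>\<close>, whose differential does not vanish on the tangent spaces
  \<open>{v. mink Y v = 0}\<close> of \<^const>\<open>hyp\<close> at the boundary points.\<close>

definition defining_function ::
    "'m::finite minkowski set \<Rightarrow> 'm minkowski set \<Rightarrow> ('m minkowski \<Rightarrow> real) \<Rightarrow> bool" where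
  "defining_function \<Omega> U \<rho> \<longleftrightarrow>
     open U \<and> smooth_on U \<rho> \<and> \<Omega> \<inter> U = {Y \<in> hyp \<inter> U. \<rho> Y \<le> 0} \<and>
     (\<forall>Y \<in> hyp \<inter> U. \<rho> Y = 0 \<longrightarrow> (\<exists>v. mink Y v = 0 \<and> frechet_derivative \<rho> (at Y) v \<noteq> 0))"

definition smooth_bounded_domain :: "'m::finite minkowski set \<Rightarrow> bool" where
  "smooth_bounded_domain \<Omega> \<longleftrightarrow>
     \<Omega> \<subseteq> hyp \<and> compact \<Omega> \<and> connected \<Omega> \<and> (top_of_set hyp) interior_of \<Omega> \<noteq> {} \<and>
     (\<forall>X \<in> hboundary \<Omega>. \<exists>U \<rho>. X \<in> U \<and> defining_function \<Omega> U \<rho>)"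

text \<open>\<open>N\<close> is the normalised gradient, within \<^const>\<open>hyp\<close>, of a defining function at \<open>Y\<close>.\<close>

definition outward_unit_normal :: "'m::finite minkowski set \<Rightarrow> 'm minkowski \<Rightarrow> 'm minkowski \<Rightarrow> bool" where
  "outward_unit_normal \<Omega> Y N \<longleftrightarrow>
     mink Y N = 0 \<and> mink N N = 1 \<and>
     (\<exists>U \<rho>. Y \<in> U \<and> defining_function \<Omega> U \<rho> \<and>
        (\<exists>c>0. \<forall>v. mink Y v = 0 \<longrightarrow> frechet_derivative \<rho> (at Y) v = c * mink N v))"

text \<open>Principal curvatures are the eigenvalues of the shape operator \<open>v \<mapsto> \<nabla>\<^sub>v N\<close> on the tangent space
  of the boundary, so that geodesic spheres of radius \<open>r\<close> have principal curvatures \<open>coth r\<close>.  For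
  tangent \<open>v\<close> the flat derivative of \<open>N\<close> along \<open>v\<close> differs from \<open>\<nabla>\<^sub>v N\<close> by \<open>mink v N *\<^sub>R X = 0\<close>.
  It depends only on the values of \<open>N\<close> on the boundary, hence not on the chosen extension \<open>N\<close>.\<close>

definition principal_curvature :: "'m::finite minkowski set \<Rightarrow> 'm minkowski \<Rightarrow> real \<Rightarrow> bool" where
  "principal_curvature \<Omega> X \<kappa> \<longleftrightarrow>
     (\<exists>U N. open U \<and> X \<in> U \<and> smooth_on U N \<and>
        (\<forall>Y \<in> hboundary \<Omega> \<inter> U. outward_unit_normal \<Omega> Y (N Y)) \<and>
        (\<exists>v. v \<noteq> 0 \<and> mink X v = 0 \<and> mink (N X) v = 0 \<and>
             frechet_derivative N (at X) v = \<kappa> *\<^sub>R v))"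

definition uniformly_h_convex :: "'m::finite minkowski set \<Rightarrow> bool" where
  "uniformly_h_convex \<Omega> \<longleftrightarrow>
     (\<exists>\<delta>>0. \<forall>X \<in> hboundary \<Omega>. \<forall>\<kappa>. principal_curvature \<Omega> X \<kappa> \<longrightarrow> \<kappa> > 1 + \<delta>)"


section \<open>The three p-sums\<close>

definition h_p_sum ::
    "real \<Rightarrow> real \<Rightarrow> 'm::finite minkowski set \<Rightarrow> real \<Rightarrow> 'm minkowski set \<Rightarrow> 'm minkowski set" where
  "h_p_sum p a K b L = (THE \<Omega>. h_convex_bounded_domain \<Omega> \<and>
     (\<forall>z \<in> sphere 0 1. horo_support \<Omega> z =
        (1 / p) * ln (a * exp (p * horo_support K z) + b * exp (p * horo_support L z))))"

text \<open>The solution \<open>q\<close> of \<open>1 / p + 1 / q = 1\<close>; used for \<open>p \<noteq> 1\<close> only.\<close>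

definition hoelder_conj :: "real \<Rightarrow> real" where
  "hoelder_conj p = p / (p - 1)"

definition lc_vector ::
    "real \<Rightarrow> real \<Rightarrow> real \<Rightarrow> 'm::finite minkowski \<Rightarrow> real \<Rightarrow> 'm minkowski \<Rightarrow> 'm minkowski" where
  "lc_vector p t a X b Y =
     (if p = 1 then a *\<^sub>R X + b *\<^sub>R Y
      else ((1 - t) powr (1 / hoelder_conj p) * a powr (1 / p)) *\<^sub>R X
         + (t powr (1 / hoelder_conj p) * b powr (1 / p)) *\<^sub>R Y)"

definition lc_admissible ::
    "real \<Rightarrow> real \<Rightarrow> real \<Rightarrow> 'm::finite minkowski \<Rightarrow> real \<Rightarrow> 'm minkowski \<Rightarrow> 'm minkowski \<Rightarrow> bool" where
  "lc_admissible p t a X b Y W \<longleftrightarrow>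
     snd (lc_vector p t a X b Y - W) \<ge> norm (fst (lc_vector p t a X b Y - W))"

definition light_cone_sum ::
    "real \<Rightarrow> real \<Rightarrow> 'm::finite minkowski set \<Rightarrow> real \<Rightarrow> 'm minkowski set \<Rightarrow> 'm minkowski set" where
  "light_cone_sum p a K b L =
     (if p \<ge> 1
      then \<Union>X\<in>K. \<Union>Y\<in>L. \<Union>t\<in>{0..1}. {W \<in> hyp. lc_admissible p t a X b Y W}
      else \<Union>X\<in>K. \<Union>Y\<in>L. \<Inter>t\<in>{0<..<1}. {W \<in> hyp. lc_admissible p t a X b Y W})"

definition bw_radius ::
    "real \<Rightarrow> real \<Rightarrow> real \<Rightarrow> 'm::finite minkowski \<Rightarrow> real \<Rightarrow> 'm minkowski \<Rightarrow> real" where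
  "bw_radius p t a X b Y = sqrt
     ((1 - t) powr (2 / hoelder_conj p) * a powr (2 / p) + t powr (2 / hoelder_conj p) * b powr (2 / p)
      + 2 * (1 - t) powr (1 / hoelder_conj p) * t powr (1 / hoelder_conj p)
          * a powr (1 / p) * b powr (1 / p) * cosh (hdist X Y))"

definition bw_center ::
    "real \<Rightarrow> real \<Rightarrow> real \<Rightarrow> 'm::finite minkowski \<Rightarrow> real \<Rightarrow> 'm minkowski \<Rightarrow> 'm minkowski" where
  "bw_center p t a X b Y = (THE P. P \<in> hsegment X Y \<and> cosh (hdist P X) =
     ((1 - t) powr (1 / hoelder_conj p) * a powr (1 / p)
      + t powr (1 / hoelder_conj p) * b powr (1 / p) * cosh (hdist X Y)) / bw_radius p t a X b Y)"

definition bw_ball ::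
    "real \<Rightarrow> real \<Rightarrow> real \<Rightarrow> 'm::finite minkowski \<Rightarrow> real \<Rightarrow> 'm minkowski \<Rightarrow> 'm minkowski set" where
  "bw_ball p t a X b Y =
     (if bw_radius p t a X b Y \<ge> 1
      then hcball (bw_center p t a X b Y) (ln (bw_radius p t a X b Y)) else {})"

definition bw_radius1 :: "real \<Rightarrow> 'm::finite minkowski \<Rightarrow> real \<Rightarrow> 'm minkowski \<Rightarrow> real" where
  "bw_radius1 a X b Y = sqrt (a\<^sup>2 + b\<^sup>2 + 2 * a * b * cosh (hdist X Y))"

definition bw_center1 :: "real \<Rightarrow> 'm::finite minkowski \<Rightarrow> real \<Rightarrow> 'm minkowski \<Rightarrow> 'm minkowski" where
  "bw_center1 a X b Y = (THE P. P \<in> hsegment X Y \<and>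
     cosh (hdist P X) = (a + b * cosh (hdist X Y)) / bw_radius1 a X b Y)"

definition bw_ball1 :: "real \<Rightarrow> 'm::finite minkowski \<Rightarrow> real \<Rightarrow> 'm minkowski \<Rightarrow> 'm minkowski set" where
  "bw_ball1 a X b Y =
     (if bw_radius1 a X b Y \<ge> 1
      then hcball (bw_center1 a X b Y) (ln (bw_radius1 a X b Y)) else {})"

definition ball_wise_sum ::
    "real \<Rightarrow> real \<Rightarrow> 'm::finite minkowski set \<Rightarrow> real \<Rightarrow> 'm minkowski set \<Rightarrow> 'm minkowski set" where
  "ball_wise_sum p a K b L =
     (if p > 1 then \<Union>X\<in>K. \<Union>Y\<in>L. \<Union>t\<in>{0..1}. bw_ball p t a X b Y
      else if p = 1 then \<Union>X\<in>K. \<Union>Y\<in>L. bw_ball1 a X b Y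
      else \<Union>X\<in>K. \<Union>Y\<in>L. \<Inter>t\<in>{0<..<1}. bw_ball p t a X b Y)"

end

theory Submission
  imports Defs
begin

text \<open>Write \<open>lc X z = - mink X (z, 1)\<close>.  The p-sum consists of the \<open>W\<close> such that for every unit \<open>z\<close> some
  \<open>X \<in> K\<close> and \<open>Y \<in> L\<close> satisfy \<open>lc W z \<le> h z\<close>, where
  \<open>h z = (a * lc X z powr p + b * lc Y z powr p) powr (1 / p)\<close>; the light-cone sum asks for one pair \<open>(X, Y)\<close>
  that serves all \<open>z\<close>.  Such a pair is found by maximising \<open>min (h z / lc W z)\<close> over \<open>K \<times> L\<close>.  If this minimum
  were below \<open>1\<close>, it would be attained in a single direction (here \<open>1 / 2 \<le> p \<le> 2\<close> enters, through comparison
  of power means with those of exponents \<open>1 / 2\<close> and \<open>2\<close>), and h-convexity would allow one to move \<open>X\<close> or \<open>Y\<close>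
  and to increase it.

  That a uniformly h-convex smooth domain is an intersection of horo-balls is a local-to-global statement:
  dividing out a null direction maps \<open>hyp\<close> onto a half space, principal curvatures above \<open>1\<close> make the image
  of the domain locally strictly convex, hence convex by a Tietze-Nakajima argument, and convexity in all these
  charts yields the supporting horospheres.\<close>

section \<open>Minkowski space\<close>

text \<open>Choosing one pair for all \<open>z\<close> instead of a pair for each \<open>z\<close>
  is a minimax exchange without convexity in \<open>(X, Y)\<close>; rigidity of contact replaces
  convexity. Suppose \<open>c * lc W\<close> touches the mean of a pair from below at
  \<open>v\<close>, and let \<open>T\<close> be the vector whose \<open>lc\<close> is tangent to the
  mean there. Once \<open>N = T - c W\<close> is known to lie in the closed future cone,
  \<open>lc N v = 0\<close> makes it a multiple \<open>l\<close> of the null vector of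
  \<open>v\<close>, and \<open>l\<close> can be read off from \<open>mink T T\<close>. For
  \<open>p >= 1\<close> the mean lies above its tangent, and \<open>p <= 2\<close> gives
  \<open>mink T T <= -1\<close>, so that \<open>N\<close> cannot vanish when \<open>c < 1\<close>.
  For \<open>p <= 1\<close> the mean lies below its tangent; comparison with exponent 1/2 turns the
  deficit into a variance of square roots, which the same \<open>l\<close> controls. In both cases
  \<open>a + b >= 1\<close> enters as the lower bound 1 for the mean at \<open>(1, 1)\<close>. That
  \<open>N\<close> is in the cone is immediate for \<open>p <= 1\<close>. For \<open>p > 1\<close>
  it follows from the first order condition at a minimum, which requires a convex set of directions;
  hence the whole ball instead of the sphere.\<close>

definition nullv :: "real ^ 'm \<Rightarrow> 'm::finite minkowski" where
  "nullv z = (z, 1)"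

definition lc :: "'m::finite minkowski \<Rightarrow> real ^ 'm \<Rightarrow> real" where
  "lc X v = snd X - fst X \<bullet> v"

lemma mink_nullv: "mink X (nullv z) = - lc X z" "mink (nullv z) X = - lc X z"
  by (simp_all add: mink_def lc_def nullv_def inner_commute)

lemma mink_commute: "mink X Y = mink Y X"
  by (simp add: mink_def inner_commute mult.commute)

lemma mink_add_left: "mink (X + Y) Z = mink X Z + mink Y Z"
  and mink_add_right: "mink Z (X + Y) = mink Z X + mink Z Y"
  and mink_diff_left: "mink (X - Y) Z = mink X Z - mink Y Z"
  and mink_diff_right: "mink Z (X - Y) = mink Z X - mink Z Y"
  and mink_scaleR_left: "mink (c *\<^sub>R X) Z = c * mink X Z"
  and mink_scaleR_right: "mink Z (c *\<^sub>R X) = c * mink Z X"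
  and mink_minus_left: "mink (- X) Z = - mink X Z"
  and mink_minus_right: "mink Z (- X) = - mink Z X"
  and mink_zero_left: "mink 0 Z = 0"
  and mink_zero_right: "mink Z 0 = 0"
  by (simp_all add: mink_def inner_add_left inner_add_right inner_diff_left inner_diff_right algebra_simps)

lemmas mink_simps = mink_add_left mink_add_right mink_diff_left mink_diff_right
  mink_scaleR_left mink_scaleR_right mink_minus_left mink_minus_right mink_zero_left mink_zero_right

lemma mink_nullv_self:
  assumes "z \<in> sphere 0 1"
  shows "mink (nullv z) (nullv z) = 0"
  using assms by (simp add: mink_def nullv_def dot_square_norm)

lemma lc_add: "lc (X + Y) v = lc X v + lc Y v"
  and lc_diff: "lc (X - Y) v = lc X v - lc Y v"
  and lc_scaleR: "lc (c *\<^sub>R X) v = c * lc X v"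
  by (simp_all add: lc_def inner_add_left inner_diff_left algebra_simps)

lemma lc_nullv: "lc (nullv z) v = 1 - z \<bullet> v"
  by (simp add: lc_def nullv_def)

lemma mink_le_norm: "mink X X = (norm (fst X))\<^sup>2 - (snd X)\<^sup>2"
  by (simp add: mink_def dot_square_norm power2_eq_square)

lemma continuous_on_mink [continuous_intros]:
  "continuous_on S f \<Longrightarrow> continuous_on S g \<Longrightarrow> continuous_on S (\<lambda>x. mink (f x) (g x))"
  unfolding mink_def by (intro continuous_intros)

lemma continuous_on_lc [continuous_intros]:
  "continuous_on S f \<Longrightarrow> continuous_on S g \<Longrightarrow> continuous_on S (\<lambda>x. lc (f x) (g x))"
  unfolding lc_def by (intro continuous_intros)

lemma hypD: "X \<in> hyp \<Longrightarrow> mink X X = -1" "X \<in> hyp \<Longrightarrow> snd X > 0"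
  by (auto simp: hyp_def)

lemma norm_less_snd:
  assumes "mink X X < 0" "snd X > 0"
  shows "norm (fst X) < snd X"
proof (rule power2_less_imp_less)
  show "(norm (fst X))\<^sup>2 < (snd X)\<^sup>2" using assms(1) unfolding mink_le_norm by simp
  show "0 \<le> snd X" using assms(2) by simp
qed

lemma hyp_norm_less: "X \<in> hyp \<Longrightarrow> norm (fst X) < snd X"
  by (simp add: norm_less_snd hypD)

lemma inner_le_snd:
  assumes "norm (fst X) \<le> snd X" "norm v \<le> 1"
  shows "0 \<le> lc X v"
proof -
  have "fst X \<bullet> v \<le> norm (fst X) * norm v" by (rule norm_cauchy_schwarz)
  also have "\<dots> \<le> norm (fst X) * 1" using assms by (intro mult_left_mono) auto
  finally show ?thesis using assms by (simp add: lc_def)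
qed

lemma lc_pos:
  assumes "X \<in> hyp" "norm v \<le> 1"
  shows "0 < lc X v"
proof -
  have "fst X \<bullet> v \<le> norm (fst X) * norm v" by (rule norm_cauchy_schwarz)
  also have "\<dots> \<le> norm (fst X) * 1" using assms by (intro mult_left_mono) auto
  finally show ?thesis using hyp_norm_less[OF assms(1)] by (simp add: lc_def)
qed

text \<open>The closed future cone is self-dual with null extreme rays, so null directions suffice
  as tests; the decisive one is the direction of \<open>fst T\<close>. Admissibility thereby becomes
  an inequality between functions on the sphere.\<close>

lemma cone_iff_lc:
  fixes T :: "'m::finite minkowski"
  shows "norm (fst T) \<le> snd T \<longleftrightarrow> (\<forall>z\<in>sphere 0 1. 0 \<le> lc T z)" (is "?L \<longleftrightarrow> ?R")
proof
  assume ?L then show ?R by (simp add: inner_le_snd)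
next
  assume R: ?R
  show ?L
  proof (cases "fst T = 0")
    case True
    obtain z :: "real^'m" where "norm z = 1" using vector_choose_size[of 1] by auto
    then show ?thesis using R True by (auto simp: lc_def)
  next
    case False
    define z where "z = sgn (fst T)"
    have "z \<in> sphere 0 1" using False by (simp add: z_def norm_sgn)
    moreover have "fst T \<bullet> z = norm (fst T)"
      using False by (simp add: z_def sgn_div_norm dot_square_norm power2_eq_square)
    ultimately show ?thesis using R by (force simp: lc_def)
  qed
qed

text \<open>Equality case of Cauchy-Schwarz: a nonzero future causal vector is orthogonal to
  \<open>(v, 1)\<close> only if \<open>(v, 1)\<close> is null and proportional to it. This forces
  contact directions onto the sphere.\<close>

lemma cone_lc_zero:
  assumes "norm (fst N) \<le> snd N" "N \<noteq> 0" "norm v \<le> 1" "lc N v = 0"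
  shows "N = snd N *\<^sub>R nullv v" "snd N > 0" "norm v = 1"
proof -
  have "fst N \<bullet> v \<le> norm (fst N) * norm v" by (rule norm_cauchy_schwarz)
  moreover have le: "norm (fst N) * norm v \<le> norm (fst N)"
    using assms mult_left_mono[of "norm v" 1 "norm (fst N)"] by auto
  moreover have "fst N \<bullet> v = snd N" using assms by (simp add: lc_def)
  ultimately have eq: "norm (fst N) = snd N" "fst N \<bullet> v = norm (fst N) * norm v" using assms by auto
  show pos: "snd N > 0"
  proof (rule ccontr)
    assume "\<not> snd N > 0"
    then have "norm (fst N) = 0" "snd N = 0" using eq(1) norm_ge_zero[of "fst N"] by linarith+
    then show False using assms(2) by (simp add: prod_eq_iff)
  qed
  have "norm (fst N) * norm v = norm (fst N)" using eq \<open>fst N \<bullet> v = snd N\<close> by simp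
  then show nv: "norm v = 1" using pos eq by auto
  have "norm (fst N) *\<^sub>R v = norm v *\<^sub>R fst N"
    using eq(2) norm_cauchy_schwarz_eq[of "fst N" v] by simp
  then show "N = snd N *\<^sub>R nullv v" using nv eq by (simp add: prod_eq_iff nullv_def)
qed

text \<open>The form is positive semidefinite on the orthogonal complement of a causal vector; the
  bounds for \<open>lc\<close> below rest on this.\<close>

lemma mink_nonneg_orthogonal:
  assumes "norm v \<le> 1" "mink Q (nullv v) = 0"
  shows "0 \<le> mink Q Q"
proof -
  have "snd Q = fst Q \<bullet> v" using assms by (simp add: mink_def nullv_def)
  then have "\<bar>snd Q\<bar> \<le> norm (fst Q) * norm v" by (simp add: Cauchy_Schwarz_ineq2)
  also have "\<dots> \<le> norm (fst Q)" using assms mult_left_mono[of "norm v" 1 "norm (fst Q)"] by auto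
  finally have "(snd Q)\<^sup>2 \<le> (norm (fst Q))\<^sup>2" by (metis abs_le_square_iff abs_norm_cancel)
  then show ?thesis by (simp add: mink_le_norm)
qed

lemma mink_pos_tangent:
  assumes "mink X X < 0" "mink X v = 0" "v \<noteq> 0"
  shows "0 < mink v v"
proof -
  have X: "(norm (fst X))\<^sup>2 < (snd X)\<^sup>2" using assms by (simp add: mink_le_norm)
  have eq: "fst X \<bullet> fst v = snd X * snd v" using assms by (simp add: mink_def)
  have "(snd X * snd v)\<^sup>2 \<le> (norm (fst X) * norm (fst v))\<^sup>2"
    unfolding eq[symmetric] by (metis Cauchy_Schwarz_ineq2 abs_ge_zero power2_abs power_mono)
  then have le: "(snd X)\<^sup>2 * (snd v)\<^sup>2 \<le> (norm (fst X))\<^sup>2 * (norm (fst v))\<^sup>2"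
    by (simp add: power_mult_distrib)
  have "fst v \<noteq> 0"
  proof
    assume "fst v = 0"
    then have "(snd X)\<^sup>2 * (snd v)\<^sup>2 \<le> 0" using le by simp
    moreover have "0 < (snd X)\<^sup>2" using X zero_le_power2[of "norm (fst X)"] by linarith
    ultimately have "snd v = 0" by (simp add: mult_le_0_iff)
    then show False using assms(3) \<open>fst v = 0\<close> by (simp add: prod_eq_iff)
  qed
  then have "(norm (fst X))\<^sup>2 * (norm (fst v))\<^sup>2 < (snd X)\<^sup>2 * (norm (fst v))\<^sup>2"
    using X by simp
  with le have "(snd X)\<^sup>2 * (snd v)\<^sup>2 < (snd X)\<^sup>2 * (norm (fst v))\<^sup>2" by linarith
  then have "(snd v)\<^sup>2 < (norm (fst v))\<^sup>2" by (simp add: mult_less_cancel_left)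
  then show ?thesis by (simp add: mink_le_norm)
qed

section \<open>Points of the hyperboloid and their distances\<close>

lemma minus_mink_ge_one:
  assumes "X \<in> hyp" "Y \<in> hyp"
  shows "1 \<le> - mink X Y"
proof -
  define k where "k = - mink X Y"
  have "mink X (Y - k *\<^sub>R X) = 0" using hypD[OF assms(1)] by (simp add: mink_simps k_def)
  then have "0 \<le> mink (Y - k *\<^sub>R X) (Y - k *\<^sub>R X)"
    using mink_pos_tangent[of X "Y - k *\<^sub>R X"] hypD[OF assms(1)]
    by (cases "Y - k *\<^sub>R X = 0") (auto simp: mink_simps)
  also have "\<dots> = k\<^sup>2 - 1"
    using hypD[OF assms(1)] hypD[OF assms(2)] mink_commute[of X Y]
    by (simp add: mink_simps k_def power2_eq_square algebra_simps)
  finally have "1 \<le> k\<^sup>2" by simp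
  moreover have "0 < k"
  proof -
    have "fst X \<bullet> fst Y \<le> norm (fst X) * norm (fst Y)" by (rule norm_cauchy_schwarz)
    also have "\<dots> < snd X * snd Y"
      using hyp_norm_less[OF assms(1)] hyp_norm_less[OF assms(2)] by (intro mult_strict_mono') auto
    finally show ?thesis by (simp add: k_def mink_def)
  qed
  ultimately show ?thesis unfolding k_def[symmetric] using power2_le_imp_le[of 1 k] by simp
qed

lemma hyp_eqI:
  assumes "X \<in> hyp" "Y \<in> hyp" "mink X Y = -1"
  shows "X = Y"
proof (rule ccontr)
  assume "X \<noteq> Y"
  then have "0 < mink (Y - X) (Y - X)"
    using assms hypD[OF assms(1)] by (intro mink_pos_tangent[of X]) (auto simp: mink_simps)
  then show False using assms hypD[OF assms(1)] hypD[OF assms(2)] mink_commute[of X Y]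
    by (simp add: mink_simps)
qed

lemma cosh_hdist:
  assumes "X \<in> hyp" "Y \<in> hyp"
  shows "cosh (hdist X Y) = - mink X Y" "0 \<le> hdist X Y"
  using minus_mink_ge_one[OF assms] by (auto simp: hdist_def cosh_arcosh_real)

lemma hdist_commute: "hdist X Y = hdist Y X"
  by (simp add: hdist_def mink_commute)

text \<open>Subtracting a multiple of a null vector changes \<open>mink V V\<close> linearly, and
  \<open>l\<close> is the multiple at which it reaches -1. The move keeps \<open>lc\<close> in
  direction \<open>z\<close> and, as \<open>l >= 0\<close>, raises it in no other direction of the
  ball.\<close>

lemma hyp_from_above:
  assumes "mink V V \<le> -1" "snd V > 0" "z \<in> sphere 0 1"
  defines "l \<equiv> (- mink V V - 1) / (2 * lc V z)"
  shows "V - l *\<^sub>R nullv z \<in> hyp" "0 \<le> l" "lc V z > 0"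
proof -
  have nV: "norm (fst V) < snd V"
    using assms(1,2) by (simp add: norm_less_snd)
  have "fst V \<bullet> z \<le> norm (fst V)" using norm_cauchy_schwarz[of "fst V" z] assms(3) by simp
  then show pos: "lc V z > 0" using nV by (simp add: lc_def)
  show "0 \<le> l" using assms(1) pos by (simp add: l_def)
  let ?W = "V - l *\<^sub>R nullv z"
  have "mink ?W ?W = mink V V + 2 * (l * lc V z)"
    using mink_nullv_self[OF assms(3)]
    by (simp only: mink_simps mink_nullv(2)[of z V] mink_nullv(1)[of V]) simp
  also have "l * lc V z = (- mink V V - 1) / 2" using pos by (simp add: l_def)
  finally have W: "mink ?W ?W = -1" by (simp add: field_simps)
  have "lc ?W z > 0" using pos assms(3)
    by (simp add: lc_diff lc_scaleR lc_nullv dot_square_norm)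
  moreover have "lc ?W z \<le> snd ?W + norm (fst ?W)"
    using Cauchy_Schwarz_ineq2[of "fst ?W" z] assms(3) by (simp add: lc_def)
  moreover have "norm (fst ?W) < \<bar>snd ?W\<bar>"
  proof (rule power2_less_imp_less)
    show "(norm (fst ?W))\<^sup>2 < \<bar>snd ?W\<bar>\<^sup>2" using W unfolding mink_le_norm power2_abs by linarith
  qed simp
  ultimately have "snd ?W > 0" by linarith
  then show "?W \<in> hyp" using W by (simp add: hyp_def)
qed

lemma mink_comb:
  assumes "X \<in> hyp" "Y \<in> hyp"
  shows "mink (s *\<^sub>R X + r *\<^sub>R Y) (s *\<^sub>R X + r *\<^sub>R Y) = - (s\<^sup>2 + r\<^sup>2 + 2 * s * r * (- mink X Y))"
  using hypD[OF assms(1)] hypD[OF assms(2)] mink_commute[of X Y]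
  by (simp add: mink_simps power2_eq_square algebra_simps)

text \<open>The combination \<open>lc Y v\<close> times \<open>X\<close> minus \<open>lc X v\<close>
  times \<open>Y\<close> is orthogonal to \<open>(v, 1)\<close>, so its square is
  nonnegative.\<close>

lemma lc_ratio_bound:
  assumes "X \<in> hyp" "Y \<in> hyp" "norm v \<le> 1"
  shows "lc X v / lc Y v + lc Y v / lc X v \<le> 2 * (- mink X Y)"
proof -
  define x y where "x = lc X v" and "y = lc Y v"
  have xy: "x > 0" "y > 0" using assms by (simp_all add: lc_pos x_def y_def)
  have "0 \<le> mink (y *\<^sub>R X + (-x) *\<^sub>R Y) (y *\<^sub>R X + (-x) *\<^sub>R Y)"
  proof (rule mink_nonneg_orthogonal[OF assms(3)])
    have "lc (y *\<^sub>R X + (-x) *\<^sub>R Y) v = 0" by (simp add: lc_add lc_diff lc_scaleR x_def y_def del: scaleR_minus_left)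
    then show "mink (y *\<^sub>R X + (-x) *\<^sub>R Y) (nullv v) = 0" by (simp add: mink_nullv)
  qed
  then have "x\<^sup>2 + y\<^sup>2 \<le> 2 * x * y * (- mink X Y)"
    unfolding mink_comb[OF assms(1,2)] by (simp add: algebra_simps)
  then have "(x\<^sup>2 + y\<^sup>2) / (x * y) \<le> 2 * (- mink X Y)"
    using xy by (simp add: divide_le_eq algebra_simps)
  moreover have "x / y + y / x = (x\<^sup>2 + y\<^sup>2) / (x * y)"
    using xy by (simp add: field_simps power2_eq_square)
  ultimately show ?thesis by (simp add: x_def y_def)
qed

text \<open>For distinct directions, removing from \<open>V\<close> its component in the plane of
  the two null vectors leaves some \<open>Q\<close> with \<open>mink Q Q >= 0\<close>; the claim is
  this inequality multiplied by \<open>1 - z \<bullet> z'\<close>.\<close>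

lemma mink_two_null_bound:
  assumes "z \<in> sphere 0 1" "z' \<in> sphere 0 1"
  shows "0 \<le> (1 - z \<bullet> z') * mink V V + 2 * lc V z * lc V z'"
proof -
  define e where "e = 1 - z \<bullet> z'"
  have e: "e = - mink (nullv z) (nullv z')" by (simp add: e_def mink_def nullv_def)
  have nn: "mink (nullv z) (nullv z) = 0" "mink (nullv z') (nullv z') = 0"
    using assms mink_nullv_self by blast+
  have "e \<ge> 0" using norm_cauchy_schwarz[of z z'] assms by (simp add: e_def)
  then consider "e = 0" | "e > 0" by linarith
  then show ?thesis
  proof cases
    case 1
    then have "z \<bullet> z' = norm z * norm z'" using assms by (simp add: e_def)
    then have "z = z'" using assms by (simp add: norm_cauchy_schwarz_eq)
    then show ?thesis using 1 by (simp add: e_def)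
  next
    case 2
    define Q where "Q = V - (lc V z' / e) *\<^sub>R nullv z - (lc V z / e) *\<^sub>R nullv z'"
    have c: "mink (nullv z') (nullv z) = - e" "mink (nullv z) (nullv z') = - e"
      using e mink_commute by (metis minus_minus)+
    have m: "mink V (nullv z) = - lc V z" "mink V (nullv z') = - lc V z'"
      "mink (nullv z) V = - lc V z" "mink (nullv z') V = - lc V z'"
      by (simp_all add: mink_nullv)
    have "mink Q (nullv z) = 0" using 2 nn by (simp add: Q_def mink_simps c m)
    then have "0 \<le> mink Q Q" using mink_nonneg_orthogonal[of z Q] assms by simp
    also have "mink Q Q = mink V V + 2 * lc V z * lc V z' / e"
      using 2 nn by (simp add: Q_def mink_simps c m field_simps)
    finally have "0 \<le> e * (mink V V + 2 * lc V z * lc V z' / e)" using 2 by simp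
    then show ?thesis using 2 by (simp add: e_def[symmetric] distrib_left)
  qed
qed

lemma lc_two_null_bound:
  assumes "X \<in> hyp" "Y \<in> hyp" "z \<in> sphere 0 1" "z' \<in> sphere 0 1"
  shows "(sqrt (lc X z' * lc Y z) - sqrt (lc Y z' * lc X z))\<^sup>2 \<le> (1 - z \<bullet> z') * (- mink X Y - 1)"
proof -
  define x0 y0 x y where "x0 = lc X z" and "y0 = lc Y z" and "x = lc X z'" and "y = lc Y z'"
  have pos: "x0 > 0" "y0 > 0" "x > 0" "y > 0"
    using assms by (simp_all add: lc_pos x0_def y0_def x_def y_def)
  define P Q where "P = sqrt (x * x0)" and "Q = sqrt (y * y0)"
  have PQ: "P > 0" "Q > 0" "P\<^sup>2 = x * x0" "Q\<^sup>2 = y * y0" using pos by (auto simp: P_def Q_def)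
  \<comment> \<open>Among all \<open>s\<close>, \<open>r\<close> with \<open>s * r = 1\<close> this
    choice minimises \<open>s^2 * P^2 + r^2 * Q^2\<close>; it turns the product of the two values of
    \<open>lc V\<close> into minus a perfect square.\<close>
  define s r where "s = sqrt (Q / P)" and "r = sqrt (P / Q)"
  have sr: "s > 0" "r > 0" "s\<^sup>2 = Q / P" "r\<^sup>2 = P / Q" "s * r = 1"
    using PQ by (auto simp: s_def r_def real_sqrt_mult[symmetric])
  define V where "V = s *\<^sub>R X + (- r) *\<^sub>R Y"
  have "0 \<le> (1 - z \<bullet> z') * mink V V + 2 * lc V z * lc V z'"
    by (rule mink_two_null_bound[OF assms(3,4)])
  moreover have "mink V V = 2 * (- mink X Y) - (s\<^sup>2 + r\<^sup>2)"
    unfolding V_def mink_comb[OF assms(1,2)] using sr(5) by (simp add: algebra_simps)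
  moreover have "lc V z * lc V z' = - (sqrt (x * y0) - sqrt (y * x0))\<^sup>2"
  proof -
    have "lc V z * lc V z' = (s * x0 - r * y0) * (s * x - r * y)"
      by (simp add: V_def lc_add lc_diff lc_scaleR x0_def y0_def x_def y_def del: scaleR_minus_left)
    also have "\<dots> = s\<^sup>2 * P\<^sup>2 + r\<^sup>2 * Q\<^sup>2 - (s * r) * (x * y0 + y * x0)"
      unfolding PQ by (simp add: algebra_simps power2_eq_square)
    also have "\<dots> = 2 * (P * Q) - (x * y0 + y * x0)"
      using sr PQ(1,2) by (simp add: power2_eq_square)
    also have "P * Q = sqrt (x * y0) * sqrt (y * x0)"
      by (simp add: P_def Q_def real_sqrt_mult[symmetric] ac_simps)
    finally show ?thesis using pos by (simp add: power2_diff algebra_simps)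
  qed
  moreover have "s\<^sup>2 + r\<^sup>2 \<ge> 2"
  proof -
    have "0 \<le> (s - r)\<^sup>2" by simp
    also have "\<dots> = s\<^sup>2 + r\<^sup>2 - 2 * (s * r)" by (simp add: power2_diff)
    finally show ?thesis using sr(5) by simp
  qed
  moreover have "1 - z \<bullet> z' \<ge> 0" using norm_cauchy_schwarz[of z z'] assms(3,4) by simp
  ultimately have "2 * (sqrt (x * y0) - sqrt (y * x0))\<^sup>2 \<le> (1 - z \<bullet> z') * (2 * (- mink X Y) - (s\<^sup>2 + r\<^sup>2))"
    "(1 - z \<bullet> z') * (2 * (- mink X Y) - (s\<^sup>2 + r\<^sup>2)) \<le> (1 - z \<bullet> z') * (2 * (- mink X Y - 1))"
    by (simp_all add: mult_left_mono)
  then have "2 * (sqrt (x * y0) - sqrt (y * x0))\<^sup>2 \<le> (1 - z \<bullet> z') * (2 * (- mink X Y - 1))"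
    by linarith
  also have "\<dots> = 2 * ((1 - z \<bullet> z') * (- mink X Y - 1))" by (rule mult.left_commute)
  finally show ?thesis by (simp only: x0_def y0_def x_def y_def mult_le_cancel_left_pos zero_less_numeral)
qed

section \<open>Power means\<close>

definition pmean :: "real \<Rightarrow> real \<Rightarrow> real \<Rightarrow> real \<Rightarrow> real \<Rightarrow> real" where
  "pmean p a b x y = (a * x powr p + b * y powr p) powr (1 / p)"

definition twt :: "real \<Rightarrow> real \<Rightarrow> real \<Rightarrow> real \<Rightarrow> real" where
  "twt p a x h = a * (x / h) powr (p - 1)"

lemma pmean_commute: "pmean p a b x y = pmean p b a y x"
  by (simp add: pmean_def add.commute)

lemma pmean_arg_pos:
  fixes a b x y p :: real
  assumes "a \<ge> 0" "b \<ge> 0" "a + b > 0" "x > 0" "y > 0"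
  shows "0 < a * x powr p + b * y powr p"
proof (cases "a > 0")
  case True then show ?thesis using assms by (intro add_pos_nonneg) auto
next
  case False then show ?thesis using assms by (intro add_nonneg_pos) auto
qed

lemma pmean_pos:
  assumes "a \<ge> 0" "b \<ge> 0" "a + b > 0" "x > 0" "y > 0"
  shows "0 < pmean p a b x y"
  using pmean_arg_pos[OF assms, of p] by (simp add: pmean_def)

lemma pmean_mono:
  assumes "a \<ge> 0" "b \<ge> 0" "0 < p" "0 < x" "0 < y" "x \<le> x'" "y \<le> y'"
  shows "pmean p a b x y \<le> pmean p a b x' y'"
  unfolding pmean_def using assms
  by (intro powr_mono2 add_mono mult_left_mono add_nonneg_nonneg) auto

lemma pmean_strict_mono_left:
  assumes "a > 0" "b \<ge> 0" "0 < p" "0 < x" "0 < y" "x < x'"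
  shows "pmean p a b x y < pmean p a b x' y"
  unfolding pmean_def using assms
  by (intro powr_less_mono2 add_strict_right_mono mult_strict_left_mono add_nonneg_nonneg) auto

text \<open>Homogeneity moves the base point \<open>(x0, y0)\<close> to \<open>(1, 1)\<close>. When
  \<open>h\<close> is the mean at the base point, the new weights sum to one, and means of different
  exponents become comparable.\<close>

lemma pmean_scale:
  assumes "a \<ge> 0" "b \<ge> 0" "x > 0" "y > 0" "h > 0" "p > 0" "x0 > 0" "y0 > 0"
  shows "pmean p a b x y = h * pmean p (a * (x0 / h) powr p) (b * (y0 / h) powr p) (x / x0) (y / y0)"
proof -
  have eq: "a * x powr p + b * y powr p
      = h powr p * ((a * (x0 / h) powr p) * (x / x0) powr p + (b * (y0 / h) powr p) * (y / y0) powr p)"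
    using assms by (simp add: powr_divide field_simps)
  have "(h powr p) powr (1 / p) = h" using assms by (simp add: powr_powr)
  then show ?thesis
    unfolding pmean_def eq using assms by (simp add: powr_mult)
qed

lemma jensen_powr:
  fixes u v m n r :: real
  assumes "m \<ge> 0" "n \<ge> 0" "m + n = 1" "u > 0" "v > 0" "r \<ge> 1"
  shows "(m * u + n * v) powr r \<le> m * u powr r + n * v powr r"
proof -
  have "(m *\<^sub>R u + n *\<^sub>R v) powr r \<le> m * u powr r + n * v powr r"
    using powr_convex[OF assms(6)] assms(1-5) by (simp add: convex_on_def)
  then show ?thesis by simp
qed

lemma pmean_exponent_mono:
  assumes "m \<ge> 0" "n \<ge> 0" "m + n = 1" "u > 0" "v > 0" "0 < p" "p \<le> r"
  shows "pmean p m n u v \<le> pmean r m n u v"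
proof -
  have "(m * u powr p + n * v powr p) powr (r / p) \<le> m * (u powr p) powr (r / p) + n * (v powr p) powr (r / p)"
    using assms by (intro jensen_powr) auto
  then have "(m * u powr p + n * v powr p) powr (r / p) \<le> m * u powr r + n * v powr r"
    using assms by (simp add: powr_powr)
  then have "((m * u powr p + n * v powr p) powr (r / p)) powr (1 / r) \<le> (m * u powr r + n * v powr r) powr (1 / r)"
    using assms by (intro powr_mono2) auto
  then show ?thesis using assms by (simp add: powr_powr pmean_def)
qed

lemma pmean_one: "m \<ge> 0 \<Longrightarrow> n \<ge> 0 \<Longrightarrow> u > 0 \<Longrightarrow> v > 0 \<Longrightarrow> pmean 1 m n u v = m * u + n * v"
  by (simp add: pmean_def)

text \<open>\<open>twt p a x\<^sub>0 h\<close> and \<open>twt p b y\<^sub>0 h\<close> with \<open>h = pmean p a b x\<^sub>0 y\<^sub>0\<close> are the coefficients of the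
  linear function tangent to the mean at \<open>(x\<^sub>0, y\<^sub>0)\<close>.\<close>

locale power_mean =
  fixes p a b x0 y0 h :: real
  assumes p: "0 < p" and ab: "a \<ge> 0" "b \<ge> 0" "a + b > 0" and xy0: "x0 > 0" "y0 > 0"
    and h: "h = pmean p a b x0 y0"
begin

definition "m = a * (x0 / h) powr p"
definition "n = b * (y0 / h) powr p"

abbreviation "al \<equiv> twt p a x0 h"
abbreviation "be \<equiv> twt p b y0 h"

lemma h_pos: "h > 0" unfolding h by (rule pmean_pos[OF ab xy0])

lemma h_powr: "h powr p = a * x0 powr p + b * y0 powr p"
  using pmean_arg_pos[OF ab xy0, of p] p by (simp add: h pmean_def powr_powr)

lemma mn: "m \<ge> 0" "n \<ge> 0" "m + n = 1"
proof -
  show "m \<ge> 0" "n \<ge> 0" using ab by (auto simp: m_def n_def)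
  have "m + n = (a * x0 powr p + b * y0 powr p) / h powr p"
    using h_pos xy0 by (simp add: m_def n_def powr_divide add_divide_distrib)
  also have "\<dots> = 1" unfolding h_powr[symmetric] using h_pos by simp
  finally show "m + n = 1" .
qed

lemma wt: "al = m * h / x0" "be = n * h / y0"
  using h_pos xy0 by (simp_all add: twt_def m_def n_def powr_diff field_simps)

lemma wt_nonneg: "0 \<le> al" "0 \<le> be"
  using ab by (auto simp: twt_def)

lemma pmean_eq: "x > 0 \<Longrightarrow> y > 0 \<Longrightarrow> pmean p a b x y = h * pmean p m n (x / x0) (y / y0)"
  unfolding m_def n_def using pmean_scale ab xy0 h_pos p by blast

lemma tangent_at: "al * x0 + be * y0 = h"
proof -
  have "al * x0 + be * y0 = (m + n) * h"
    using xy0 by (simp add: wt algebra_simps)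
  then show ?thesis by (simp add: mn)
qed

lemma tangent_eq:
  "x > 0 \<Longrightarrow> y > 0 \<Longrightarrow> al * x + be * y = h * pmean 1 m n (x / x0) (y / y0)"
  using xy0 mn by (simp add: wt pmean_one algebra_simps)

text \<open>In normalised form the tangent function is \<open>h\<close> times the mean of exponent 1
  with weights \<open>m\<close>, \<open>n\<close>, so this is monotonicity in the exponent;
  \<open>tangent_le\<close> is the other half.\<close>

lemma tangent_ge:
  assumes "p \<le> 1" "x > 0" "y > 0"
  shows "pmean p a b x y \<le> al * x + be * y"
  unfolding tangent_eq[OF assms(2,3)] pmean_eq[OF assms(2,3)]
  using h_pos mn assms xy0 p by (intro mult_left_mono pmean_exponent_mono) auto

lemma tangent_le:
  assumes "1 \<le> p" "x > 0" "y > 0"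
  shows "al * x + be * y \<le> pmean p a b x y"
  unfolding tangent_eq[OF assms(2,3)] pmean_eq[OF assms(2,3)]
  using h_pos mn assms xy0 p by (intro mult_left_mono pmean_exponent_mono) auto

text \<open>\<open>a + b >= 1\<close> says that the mean at \<open>(1, 1)\<close> is at least 1;
  here that is expressed in normalised weights and passed on to a larger exponent, later 1 or
  2.\<close>

lemma one_le_pmean_inverse:
  assumes "1 \<le> a + b" "p \<le> r"
  shows "1 \<le> h * pmean r m n (1 / x0) (1 / y0)"
proof -
  have "1 \<le> pmean p a b 1 1" using assms p by (simp add: pmean_def ge_one_powr_ge_zero)
  also have "\<dots> = h * pmean p m n (1 / x0) (1 / y0)" by (rule pmean_eq) auto
  also have "\<dots> \<le> h * pmean r m n (1 / x0) (1 / y0)"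
    using h_pos mn assms xy0 p by (intro mult_left_mono pmean_exponent_mono) auto
  finally show ?thesis .
qed

lemma one_le_wt_sum:
  assumes "1 \<le> a + b" "p \<le> 1"
  shows "1 \<le> al + be"
  using one_le_pmean_inverse[OF assms] tangent_eq[of 1 1] by simp

text \<open>With \<open>k = - mink X Y\<close> the right-hand side is minus the square of
  \<open>al X + be Y\<close>, which therefore lies on or above the hyperboloid. Exponent 2 is the
  natural one because \<open>h^2 * (m / x0^2 + n / y0^2)\<close> is the product of
  \<open>al * x0 + be * y0\<close> and \<open>al / x0 + be / y0\<close>.\<close>

lemma one_le_wt_norm:
  assumes "1 \<le> a + b" "p \<le> 2" and k: "x0 / y0 + y0 / x0 \<le> 2 * k"
  shows "1 \<le> (al)\<^sup>2 + (be)\<^sup>2 + 2 * al * be * k"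
proof -
  have nn: "al \<ge> 0" "be \<ge> 0" using wt_nonneg by auto
  define s where "s = m / x0\<^sup>2 + n / y0\<^sup>2"
  have s: "0 \<le> s" using mn by (simp add: s_def)
  have "pmean 2 m n (1 / x0) (1 / y0) = sqrt s"
    using xy0 by (simp add: pmean_def s_def powr_half_sqrt power_divide s[unfolded s_def])
  then have "1 \<le> h * sqrt s" using one_le_pmean_inverse[OF assms(1,2)] by simp
  then have "1\<^sup>2 \<le> (h * sqrt s)\<^sup>2" by (intro power_mono) auto
  then have "1 \<le> h\<^sup>2 * s" using s by (simp add: power_mult_distrib)
  also have "h\<^sup>2 * s = h * (al / x0 + be / y0)"
    by (simp add: s_def wt power2_eq_square algebra_simps)
  also have "\<dots> = (al * x0 + be * y0) * (al / x0 + be / y0)"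
    using tangent_at by simp
  also have "\<dots> = al\<^sup>2 + be\<^sup>2 + al * be * (x0 / y0 + y0 / x0)"
    using xy0 by (simp add: field_simps power2_eq_square)
  also have "\<dots> \<le> al\<^sup>2 + be\<^sup>2 + al * be * (2 * k)"
    using k nn by (intro add_left_mono mult_left_mono) auto
  finally show ?thesis by (simp add: algebra_simps)
qed

text \<open>For \<open>1 / 2 \<le> p \<le> 1\<close> the mean is compared with the one of exponent \<open>1 / 2\<close>, whose square root is linear in
  the square roots of its arguments.\<close>

lemma pmean_ge_tangent_minus:
  assumes "1 \<le> a + b" "1 / 2 \<le> p" "p \<le> 1" and xy: "x > 0" "y > 0"
    and c: "0 \<le> c" "c \<le> 1" and k: "k \<ge> 1" and e: "0 \<le> e"
    and bound: "(sqrt (x * y0) - sqrt (y * x0))\<^sup>2 \<le> e * (k - 1)"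
    and l: "l = ((al)\<^sup>2 + (be)\<^sup>2 + 2 * al * be * k - c\<^sup>2) / (2 * h)"
  shows "al * x + be * y - l * e \<le> pmean p a b x y"
    and "c < 1 \<Longrightarrow> 0 < e \<Longrightarrow> al * x + be * y - l * e < pmean p a b x y"
proof -
  have nn: "al \<ge> 0" "be \<ge> 0" using wt_nonneg by auto
  have pos: "x / x0 > 0" "y / y0 > 0" using xy xy0 by auto
  define X Y where "X = sqrt (x / x0)" and "Y = sqrt (y / y0)"
  have "h * (m * X + n * Y)\<^sup>2 = h * pmean (1/2) m n (x / x0) (y / y0)"
    using pos mn by (simp add: pmean_def powr_half_sqrt X_def Y_def)
  also have "\<dots> \<le> pmean p a b x y"
    unfolding pmean_eq[OF xy] using h_pos mn assms xy0 p pos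
    by (intro mult_left_mono pmean_exponent_mono) auto
  finally have lower: "h * (m * X + n * Y)\<^sup>2 \<le> pmean p a b x y" .
  have XY2: "X\<^sup>2 = x / x0" "Y\<^sup>2 = y / y0" using pos by (auto simp: X_def Y_def)
  have tang: "al * x + be * y = h * (m * X\<^sup>2 + n * Y\<^sup>2)"
    unfolding tangent_eq[OF xy] XY2 using pos mn by (simp add: pmean_one)
  \<comment> \<open>With \<open>m + n = 1\<close> this is the variance formula for two values: the
    tangent function exceeds the mean of exponent 1/2 by
    \<open>h * m * n * (X - Y)^2\<close>.\<close>
  have "(m * X + n * Y)\<^sup>2 = m * X\<^sup>2 * (m + n) + n * Y\<^sup>2 * (m + n) - m * n * (X - Y)\<^sup>2"
    by (simp add: power2_eq_square algebra_simps)
  then have sq: "(m * X + n * Y)\<^sup>2 = m * X\<^sup>2 + n * Y\<^sup>2 - m * n * (X - Y)\<^sup>2" by (simp add: mn)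
  have "sqrt (x * y0) - sqrt (y * x0) = sqrt (x0 * y0) * (X - Y)"
    using xy xy0 by (simp add: X_def Y_def real_sqrt_mult real_sqrt_divide field_simps)
  then have "(sqrt (x * y0) - sqrt (y * x0))\<^sup>2 = (x0 * y0) * (X - Y)\<^sup>2"
    using xy0 by (simp add: power_mult_distrib)
  with bound have b2: "(x0 * y0) * (X - Y)\<^sup>2 \<le> e * (k - 1)" by simp
  have albe: "al * be = h\<^sup>2 * m * n / (x0 * y0)" by (simp add: wt power2_eq_square)
  have eq: "al * be * ((x0 * y0) * D) = h * (h * (m * n * D))" for D
    using xy0 by (simp add: albe power2_eq_square)
  have "al * be * ((x0 * y0) * (X - Y)\<^sup>2) \<le> al * be * (e * (k - 1))"
    using nn b2 by (intro mult_left_mono) auto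
  then have b3: "h * (h * (m * n * (X - Y)\<^sup>2)) \<le> al * be * (k - 1) * e"
    unfolding eq by (simp only: mult.assoc mult.left_commute[of e] mult.commute[of e])
  \<comment> \<open>\<open>l\<close> is the multiple of the null vector of the contact direction
    whose subtraction brings the square of \<open>al X + be Y\<close> to \<open>- c^2\<close>.
    Besides \<open>(al + be)^2 - c^2\<close>, which is nonnegative and positive for
    \<open>c < 1\<close>, there remains exactly the term that bounds the variance.\<close>
  have l2: "2 * h * l = (al + be)\<^sup>2 - c\<^sup>2 + 2 * al * be * (k - 1)"
  proof -
    have "2 * h * l = al\<^sup>2 + be\<^sup>2 + 2 * al * be * k - c\<^sup>2"
      using h_pos by (simp add: l)
    then show ?thesis by (simp add: power2_eq_square algebra_simps)
  qed
  have "1\<^sup>2 \<le> (al + be)\<^sup>2" using one_le_wt_sum[OF assms(1,3)] by (intro power_mono) auto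
  then have ge1: "1 \<le> (al + be)\<^sup>2" by simp
  have c2: "c\<^sup>2 \<le> 1" using c by (simp add: power_le_one)
  have "h * (h * (m * n * (X - Y)\<^sup>2)) \<le> h * (l * e)"
  proof -
    have "2 * al * be * (k - 1) * e \<le> 2 * h * l * e"
      unfolding l2 using e ge1 c2 by (intro mult_right_mono) auto
    then show ?thesis using b3 by (simp add: algebra_simps)
  qed
  then have "h * (m * n * (X - Y)\<^sup>2) \<le> l * e" using h_pos by (simp only: mult_le_cancel_left_pos)
  moreover have "h * (m * X + n * Y)\<^sup>2 = al * x + be * y - h * (m * n * (X - Y)\<^sup>2)"
    unfolding tang sq by (simp add: algebra_simps)
  ultimately show "al * x + be * y - l * e \<le> pmean p a b x y" using lower by linarith
  assume "c < 1" "0 < e"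
  then have "c\<^sup>2 < 1" using c by (simp add: power_less_one_iff)
  have "2 * al * be * (k - 1) * e < 2 * h * l * e"
    unfolding l2 using \<open>0 < e\<close> ge1 \<open>c\<^sup>2 < 1\<close> by (intro mult_strict_right_mono) auto
  then have "h * (h * (m * n * (X - Y)\<^sup>2)) < h * (l * e)" using b3 by (simp add: algebra_simps)
  then have "h * (m * n * (X - Y)\<^sup>2) < l * e" using h_pos by (simp only: mult_less_cancel_left_pos)
  moreover have "h * (m * X + n * Y)\<^sup>2 = al * x + be * y - h * (m * n * (X - Y)\<^sup>2)"
    unfolding tang sq by (simp add: algebra_simps)
  ultimately show "al * x + be * y - l * e < pmean p a b x y" using lower by linarith
qed

end

section \<open>The contact argument\<close>

text \<open>The last clause says that \<open>K\<close> contains the intersection of its supporting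
  closed horo-balls; by compactness the witness \<open>Y\<close> stands for the supremum in the
  support function.\<close>

definition hconv :: "'m::finite minkowski set \<Rightarrow> bool" where
  "hconv K \<longleftrightarrow> K \<subseteq> hyp \<and> compact K \<and> K \<noteq> {} \<and>
     (\<forall>X\<in>hyp. (\<forall>z\<in>sphere 0 1. \<exists>Y\<in>K. lc X z \<le> lc Y z) \<longrightarrow> X \<in> K)"

lemma continuous_on_pmean [continuous_intros]:
  assumes "continuous_on S f" "continuous_on S g" "\<And>x. x \<in> S \<Longrightarrow> f x > 0" "\<And>x. x \<in> S \<Longrightarrow> g x > 0"
    and "a \<ge> 0" "b \<ge> 0" "a + b > 0"
  shows "continuous_on S (\<lambda>x. pmean p a b (f x) (g x))"
  unfolding pmean_def
proof (intro continuous_on_powr continuous_on_add continuous_on_mult continuous_on_const assms(1,2) ballI)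
  fix x assume x: "x \<in> S"
  show "f x \<noteq> 0" "g x \<noteq> 0" using assms(3,4)[OF x] by auto
  show "a * f x powr p + b * g x powr p \<noteq> 0"
    using pmean_arg_pos[OF assms(5-7) assms(3,4)[OF x], of p] by simp
qed

definition segpt :: "'m::finite minkowski \<Rightarrow> 'm minkowski \<Rightarrow> real \<Rightarrow> 'm minkowski" where
  "segpt X X' e = (1 - e) *\<^sub>R X + e *\<^sub>R X'"

text \<open>The point of \<^const>\<open>hyp\<close> congruent to \<open>segpt X X' e\<close> modulo the null direction of \<open>z\<close>.\<close>

definition horopt :: "real ^ 'm \<Rightarrow> 'm::finite minkowski \<Rightarrow> 'm minkowski \<Rightarrow> real \<Rightarrow> 'm minkowski" where
  "horopt z X X' e = segpt X X' e -
     ((- mink (segpt X X' e) (segpt X X' e) - 1) / (2 * lc (segpt X X' e) z)) *\<^sub>R nullv z"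

text \<open>The null correction is explicit because \<open>- mink V V - 1\<close> equals
  \<open>2 * e * (1 - e) * (- mink X X' - 1)\<close> on the chord. It is of first order in
  \<open>e\<close>, like the displacement itself, and invisible in direction
  \<open>z\<close>.\<close>

lemma horopt_props:
  assumes X: "X \<in> hyp" "X' \<in> hyp" and z: "z \<in> sphere 0 1" and e: "0 \<le> e" "e \<le> 1"
  defines "l \<equiv> e * (1 - e) * (- mink X X' - 1) / ((1 - e) * lc X z + e * lc X' z)"
  shows "horopt z X X' e = segpt X X' e - l *\<^sub>R nullv z" "horopt z X X' e \<in> hyp" "0 \<le> l"
    "0 < (1 - e) * lc X z + e * lc X' z"
    "lc (horopt z X X' e) v = (1 - e) * lc X v + e * lc X' v - l * (1 - z \<bullet> v)"
proof -
  let ?V = "segpt X X' e"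
  have VV: "- mink ?V ?V - 1 = 2 * (e * (1 - e) * (- mink X X' - 1))"
    unfolding segpt_def mink_comb[OF X] by (simp add: power2_eq_square algebra_simps)
  have Vz: "lc ?V z = (1 - e) * lc X z + e * lc X' z" by (simp add: segpt_def lc_add lc_scaleR)
  have k: "- mink X X' - 1 \<ge> 0" using minus_mink_ge_one[OF X] by simp
  have "- mink ?V ?V - 1 \<ge> 0" unfolding VV using e k by simp
  then have le: "mink ?V ?V \<le> -1" by simp
  have "snd ?V > 0"
  proof (cases "e = 0")
    case False
    then show ?thesis using e hypD[OF X(1)] hypD[OF X(2)]
      by (auto simp: segpt_def intro!: add_nonneg_pos)
  qed (use hypD[OF X(1)] in \<open>simp add: segpt_def\<close>)
  note H = hyp_from_above[OF le this z]
  have l: "l = (- mink ?V ?V - 1) / (2 * lc ?V z)"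
    unfolding VV Vz l_def by (rule mult_divide_mult_cancel_left[symmetric]) simp
  show eq: "horopt z X X' e = ?V - l *\<^sub>R nullv z" by (simp add: horopt_def l)
  show "horopt z X X' e \<in> hyp" "0 \<le> l" "0 < (1 - e) * lc X z + e * lc X' z"
    using H unfolding eq l Vz by auto
  show "lc (horopt z X X' e) v = (1 - e) * lc X v + e * lc X' v - l * (1 - z \<bullet> v)"
    unfolding eq by (simp add: lc_diff lc_scaleR lc_nullv lc_add segpt_def)
qed

lemma inner_le_one:
  assumes "norm (z::'a::real_inner) \<le> 1" "norm v \<le> 1"
  shows "0 \<le> 1 - z \<bullet> v"
  using norm_cauchy_schwarz[of z v] mult_mono[OF assms] by simp

text \<open>The null correction only lowers \<open>lc\<close>, so in each direction one of the two
  end points dominates.\<close>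

lemma horopt_in:
  assumes "hconv K" "X \<in> K" "X' \<in> K" "z \<in> sphere 0 1" "0 \<le> e" "e \<le> 1"
  shows "horopt z X X' e \<in> K"
proof -
  have X: "X \<in> hyp" "X' \<in> hyp" using assms by (auto simp: hconv_def)
  note H = horopt_props[OF X assms(4-6)]
  have "\<exists>Y\<in>K. lc (horopt z X X' e) v \<le> lc Y v" if "v \<in> sphere 0 1" for v
  proof -
    have "(1 - e) * lc X v + e * lc X' v
        \<le> (1 - e) * max (lc X v) (lc X' v) + e * max (lc X v) (lc X' v)"
      using assms by (intro add_mono mult_left_mono) auto
    then have "(1 - e) * lc X v + e * lc X' v \<le> max (lc X v) (lc X' v)" by (simp add: algebra_simps)
    moreover have "0 \<le> 1 - z \<bullet> v" using assms that by (intro inner_le_one) auto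
    ultimately have "lc (horopt z X X' e) v \<le> max (lc X v) (lc X' v)"
      using H(3) H(5)[of v] by (smt (verit) mult_nonneg_nonneg)
    then show ?thesis using assms(2,3) by (auto simp: max_def split: if_splits)
  qed
  then show ?thesis using assms(1) H(2) by (simp add: hconv_def)
qed

lemma unit_inner_eq:
  assumes "norm (z::'a::real_inner) = 1" "norm v = 1" "z \<bullet> v = 1"
  shows "z = v"
  using norm_cauchy_schwarz_eq[of z v] assms by simp

text \<open>The factor \<open>e\<close> is pulled out so that the remaining bracket is free of
  \<open>e\<close>; it is positive for \<open>v\<close> near \<open>z\<close> once
  \<open>lc X z < lc X' z\<close>, because the correction carries the factor
  \<open>1 - z \<bullet> v\<close>.\<close>

lemma horopt_lower:
  assumes X: "X \<in> hyp" "X' \<in> hyp" and z: "z \<in> sphere 0 1" and e: "0 \<le> e" "e \<le> 1"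
    and v: "norm v \<le> 1" and le: "lc X z \<le> lc X' z"
  shows "lc (horopt z X X' e) v - lc X v
    \<ge> e * (lc X' v - lc X v - (- mink X X' - 1) / lc X z * (1 - z \<bullet> v))"
proof -
  note H = horopt_props[OF X z e]
  have k: "- mink X X' - 1 \<ge> 0" using minus_mink_ge_one[OF X] by simp
  have x0: "0 < lc X z" using lc_pos[OF X(1)] z by simp
  have ge: "lc X z \<le> (1 - e) * lc X z + e * lc X' z"
    using mult_left_mono[OF le e(1)] by (simp add: algebra_simps)
  have "e * (1 - e) * (- mink X X' - 1) / ((1 - e) * lc X z + e * lc X' z)
      \<le> e * (- mink X X' - 1) / lc X z"
    using e k x0 ge by (intro frac_le mult_right_mono mult_left_le mult_nonneg_nonneg) auto
  then have "e * (1 - e) * (- mink X X' - 1) / ((1 - e) * lc X z + e * lc X' z) * (1 - z \<bullet> v)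
      \<le> e * (- mink X X' - 1) / lc X z * (1 - z \<bullet> v)"
    using inner_le_one[of z v] z v by (intro mult_right_mono) auto
  then show ?thesis unfolding H(5) by (simp add: algebra_simps)
qed

lemma horopt_tendsto:
  assumes X: "X \<in> hyp" and z: "z \<in> sphere 0 1" and e: "(e \<longlongrightarrow> 0) F"
  shows "((\<lambda>i. horopt z X X' (e i)) \<longlongrightarrow> X) F"
proof -
  have "lc X z > 0" using lc_pos[OF X] z by simp
  then have "((\<lambda>i. horopt z X X' (e i)) \<longlongrightarrow> segpt X X' 0 -
     ((- mink (segpt X X' 0) (segpt X X' 0) - 1) / (2 * lc (segpt X X' 0) z)) *\<^sub>R nullv z) F"
    unfolding horopt_def segpt_def mink_def lc_def by (intro tendsto_intros e) auto
  then show ?thesis using hypD[OF X] by (simp add: segpt_def)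
qed

lemma pmean_has_derivative:
  assumes "power_mean p a b x0 y0 h"
  shows "((\<lambda>s. pmean p a b (x0 + s * dx) (y0 + s * dy)) has_real_derivative
     (twt p a x0 h * dx + twt p b y0 h * dy)) (at 0)"
proof -
  interpret power_mean p a b x0 y0 h by fact
  have A: "0 < a * x0 powr p + b * y0 powr p" by (rule pmean_arg_pos[OF ab xy0])
  have 1: "((\<lambda>s. a * (x0 + s * dx) powr p + b * (y0 + s * dy) powr p) has_real_derivative
      p * (a * x0 powr (p - 1) * dx + b * y0 powr (p - 1) * dy)) (at 0)"
    using xy0 p by (auto intro!: derivative_eq_intros simp: algebra_simps)
  have 2: "((\<lambda>s. pmean p a b (x0 + s * dx) (y0 + s * dy)) has_real_derivative
      (1 / p) * (a * x0 powr p + b * y0 powr p) powr (1 / p - 1)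
        * (p * (a * x0 powr (p - 1) * dx + b * y0 powr (p - 1) * dy))) (at 0)"
    unfolding pmean_def using A by (intro DERIV_fun_powr[THEN DERIV_cong, OF 1]) auto
  have 3: "(a * x0 powr p + b * y0 powr p) powr (1 / p - 1) = h powr (1 - p)"
    unfolding h_powr[symmetric] using p by (simp add: powr_powr algebra_simps)
  have "twt p a x0 h * dx + twt p b y0 h * dy
      = h powr (1 - p) * (a * x0 powr (p - 1) * dx + b * y0 powr (p - 1) * dy)"
  proof -
    have "h powr (1 - p) = 1 / h powr (p - 1)" using powr_minus_divide[of h "p - 1"] by simp
    then show ?thesis using h_pos xy0 by (simp add: twt_def powr_divide algebra_simps add_divide_distrib)
  qed
  then show ?thesis using 2 p unfolding 3 by simp
qed

section \<open>Contact between a multiple of W and the mean of a pair\<close>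

locale psum =
  fixes p a b :: real
  assumes p: "1 / 2 \<le> p" "p \<le> 2" and ab: "a \<ge> 0" "b \<ge> 0" and ab1: "a + b \<ge> 1"
begin

lemma p0: "p > 0" and ab0: "a + b > 0" using p ab1 by auto

definition pl :: "'m::finite minkowski \<Rightarrow> 'm minkowski \<Rightarrow> real ^ 'm \<Rightarrow> real" where
  "pl X Y v = pmean p a b (lc X v) (lc Y v)"

text \<open>The tangent function of the mean at direction \<open>v\<close>, represented by a single
  Minkowski vector. For \<open>p > 1\<close> it is one of the vectors in the light-cone sum.\<close>

definition tvec :: "'m::finite minkowski \<Rightarrow> 'm minkowski \<Rightarrow> real ^ 'm \<Rightarrow> 'm minkowski" where
  "tvec X Y v = twt p a (lc X v) (pl X Y v) *\<^sub>R X + twt p b (lc Y v) (pl X Y v) *\<^sub>R Y"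

lemma power_meanI:
  assumes "X \<in> hyp" "Y \<in> hyp" "norm v \<le> 1"
  shows "power_mean p a b (lc X v) (lc Y v) (pl X Y v)"
  by unfold_locales (use p0 ab ab0 assms in \<open>simp_all add: pl_def lc_pos\<close>)

lemma pl_pos:
  assumes "X \<in> hyp" "Y \<in> hyp" "norm v \<le> 1"
  shows "0 < pl X Y v"
  using power_mean.h_pos[OF power_meanI[OF assms]] .

lemma lc_tvec: "lc (tvec X Y v) u =
    twt p a (lc X v) (pl X Y v) * lc X u + twt p b (lc Y v) (pl X Y v) * lc Y u"
  by (simp add: tvec_def lc_add lc_scaleR)

context
  fixes X Y :: "'m::finite minkowski" and v :: "real ^ 'm"
  assumes X: "X \<in> hyp" and Y: "Y \<in> hyp" and v: "norm v \<le> 1"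
begin

lemma lc_tvec_self: "lc (tvec X Y v) v = pl X Y v"
  using power_mean.tangent_at[OF power_meanI[OF X Y v]] by (simp add: lc_tvec)

lemma mink_tvec: "mink (tvec X Y v) (tvec X Y v) \<le> -1"
  using power_mean.one_le_wt_norm[OF power_meanI[OF X Y v] ab1 p(2) lc_ratio_bound[OF X Y v]]
  unfolding tvec_def mink_comb[OF X Y] by simp

lemma snd_tvec: "snd (tvec X Y v) > 0"
proof -
  have w: "0 \<le> twt p a (lc X v) (pl X Y v)" "0 \<le> twt p b (lc Y v) (pl X Y v)"
    using power_mean.wt_nonneg[OF power_meanI[OF X Y v]] by auto
  have "twt p a (lc X v) (pl X Y v) \<noteq> 0 \<or> twt p b (lc Y v) (pl X Y v) \<noteq> 0"
    using lc_tvec_self pl_pos[OF X Y v] by (auto simp: lc_tvec)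
  then consider "0 < twt p a (lc X v) (pl X Y v)" | "0 < twt p b (lc Y v) (pl X Y v)"
    using w by linarith
  then show ?thesis using w hypD(2)[OF X] hypD(2)[OF Y]
    by cases (simp_all add: tvec_def add_nonneg_pos add_pos_nonneg)
qed

lemma tvec_ge: "p \<le> 1 \<Longrightarrow> norm u \<le> 1 \<Longrightarrow> pl X Y u \<le> lc (tvec X Y v) u"
  using power_mean.tangent_ge[OF power_meanI[OF X Y v]] lc_pos[OF X, of u] lc_pos[OF Y, of u] by (simp add: lc_tvec pl_def)

lemma tvec_le: "1 \<le> p \<Longrightarrow> norm u \<le> 1 \<Longrightarrow> lc (tvec X Y v) u \<le> pl X Y u"
  using power_mean.tangent_le[OF power_meanI[OF X Y v]] lc_pos[OF X, of u] lc_pos[OF Y, of u] by (simp add: lc_tvec pl_def)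

end

text \<open>The vector \<open>tvec X Y z - c W\<close> is causal and vanishes in direction
  \<open>z\<close>, hence is \<open>l\<close> times the null vector. Comparing squares identifies
  \<open>l\<close> with the constant of \<open>pmean_ge_tangent_minus\<close>. The case
  \<open>c = 1\<close> serves to construct support points, \<open>c < 1\<close> to show that contact
  is unique.\<close>

lemma contact_concave:
  assumes X: "X \<in> hyp" and Y: "Y \<in> hyp" and W: "W \<in> hyp" and c: "0 \<le> c" "c \<le> 1"
    and p1: "p \<le> 1" and z: "z \<in> sphere 0 1" and eq: "pl X Y z = c * lc W z"
    and le: "\<And>u. u \<in> sphere 0 1 \<Longrightarrow> c * lc W u \<le> lc (tvec X Y z) u"
    and u: "u \<in> sphere 0 1"
  shows "c * lc W u \<le> pl X Y u" "c < 1 \<Longrightarrow> u \<noteq> z \<Longrightarrow> c * lc W u < pl X Y u"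
proof -
  have nz: "norm z \<le> 1" using z by simp
  define T where "T = tvec X Y z"
  define N where "N = T - c *\<^sub>R W"
  have lcN: "lc N v = lc T v - c * lc W v" for v by (simp add: N_def lc_diff lc_scaleR)
  have "norm (fst N) \<le> snd N" unfolding cone_iff_lc lcN T_def using le by auto
  moreover have "lc N z = 0" unfolding lcN T_def using lc_tvec_self[OF X Y nz] eq by simp
  ultimately have N: "N = snd N *\<^sub>R nullv z" using cone_lc_zero(1)[of N z] nz by (cases "N = 0") auto
  define l where "l = snd N"
  have T: "T = c *\<^sub>R W + l *\<^sub>R nullv z" using N by (simp add: N_def l_def algebra_simps)
  have "mink T T = - c\<^sup>2 - 2 * l * pl X Y z"
    unfolding T eq using hypD[OF W] mink_nullv_self[OF z]
    by (simp add: mink_simps mink_nullv lc_add lc_scaleR power2_eq_square algebra_simps)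
  then have l: "l = (- mink T T - c\<^sup>2) / (2 * pl X Y z)" using pl_pos[OF X Y nz] by (simp add: field_simps)
  have e: "0 \<le> 1 - z \<bullet> u" using z u by (intro inner_le_one) auto
  have eqL: "c * lc W u = lc T u - l * (1 - z \<bullet> u)" unfolding T by (simp add: lc_add lc_scaleR lc_nullv)
  have pos: "0 < lc X u" "0 < lc Y u" using X Y u by (simp_all add: lc_pos)
  note M = power_mean.pmean_ge_tangent_minus[OF power_meanI[OF X Y nz] ab1 p(1) p1 pos c minus_mink_ge_one[OF X Y] e
      lc_two_null_bound[OF X Y z u], of l]
  have l': "l = ((twt p a (lc X z) (pl X Y z))\<^sup>2 + (twt p b (lc Y z) (pl X Y z))\<^sup>2 +
     2 * twt p a (lc X z) (pl X Y z) * twt p b (lc Y z) (pl X Y z) * - mink X Y - c\<^sup>2) / (2 * pl X Y z)"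
    unfolding l T_def tvec_def mink_comb[OF X Y] by simp
  show "c * lc W u \<le> pl X Y u" using M(1)[OF l'] unfolding eqL T_def lc_tvec by (simp add: pl_def)
  assume "c < 1" "u \<noteq> z"
  have "0 < 1 - z \<bullet> u"
  proof (rule ccontr)
    assume "\<not> 0 < 1 - z \<bullet> u"
    then show False using \<open>u \<noteq> z\<close> unit_inner_eq[of z u] e z u by simp
  qed
  then show "c * lc W u < pl X Y u"
    using M(2)[OF l' \<open>c < 1\<close>] unfolding eqL T_def lc_tvec by (simp add: pl_def)
qed

text \<open>For \<open>p \<ge> 1\<close> the function \<open>pl X Y\<close> is convex, and the first order condition at a minimum over the ball
  yields a linear minorant.\<close>

lemma contact_convex:
  assumes X: "X \<in> hyp" and Y: "Y \<in> hyp"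
    and v: "norm v \<le> 1" and eq: "pl X Y v = c * lc W v"
    and le: "\<And>u. norm u \<le> 1 \<Longrightarrow> c * lc W u \<le> pl X Y u"
    and u: "norm u \<le> 1"
  shows "c * lc W u \<le> lc (tvec X Y v) u"
proof (rule ccontr)
  assume neg: "\<not> ?thesis"
  have lin: "lc Z (v + s *\<^sub>R (u - v)) = lc Z v + s * (lc Z u - lc Z v)" for Z s
    by (simp add: lc_def inner_add_right inner_diff_right algebra_simps)
  define f where "f s = pl X Y (v + s *\<^sub>R (u - v)) - c * lc W (v + s *\<^sub>R (u - v))" for s
  let ?d = "twt p a (lc X v) (pl X Y v) * (lc X u - lc X v) + twt p b (lc Y v) (pl X Y v) * (lc Y u - lc Y v)
     - c * (lc W u - lc W v)"
  note D = pmean_has_derivative[OF power_meanI[OF X Y v], of "lc X u - lc X v" "lc Y u - lc Y v"]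
  have "((\<lambda>s. pl X Y (v + s *\<^sub>R (u - v)) - (c * lc W v + s * (c * (lc W u - lc W v))))
      has_real_derivative ?d) (at 0)"
    unfolding pl_def[of X Y "v + _ *\<^sub>R (u - v)"] lin
    by (rule DERIV_diff[OF D]) (auto intro!: derivative_eq_intros)
  then have "(f has_real_derivative ?d) (at 0)"
    unfolding f_def lin by (simp add: algebra_simps)
  moreover have "?d = lc (tvec X Y v) u - c * lc W u"
    using lc_tvec_self[OF X Y v] eq by (simp add: lc_tvec algebra_simps)
  ultimately obtain d where d: "d > 0" "\<And>s. s > 0 \<Longrightarrow> s < d \<Longrightarrow> f (0 + s) < f 0"
    using DERIV_neg_dec_right[of f ?d 0] neg by auto
  define s where "s = min (d / 2) 1"
  have s: "0 < s" "s \<le> 1" "s < d" using d(1) by (auto simp: s_def)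
  have "norm (v + s *\<^sub>R (u - v)) \<le> 1"
  proof -
    have "v + s *\<^sub>R (u - v) = (1 - s) *\<^sub>R v + s *\<^sub>R u" by (simp add: algebra_simps)
    then have "norm (v + s *\<^sub>R (u - v)) \<le> (1 - s) * norm v + s * norm u"
      using norm_triangle_ineq[of "(1 - s) *\<^sub>R v" "s *\<^sub>R u"] s by simp
    also have "\<dots> \<le> (1 - s) * 1 + s * 1" using s u v by (intro add_mono mult_left_mono) auto
    finally show ?thesis by simp
  qed
  then have "0 \<le> f s" unfolding f_def using le by simp
  moreover have "f 0 = 0" using eq by (simp add: f_def)
  ultimately show False using d(2)[OF s(1) s(3)] by simp
qed

text \<open>For \<open>p \<le> 1\<close> concavity reduces all inequalities to null directions; for \<open>p > 1\<close> the minimum of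
  \<open>pl X Y u / lc W u\<close> over the ball may a priori lie in its interior.\<close>

definition dirs :: "(real ^ 'm::finite) set" where
  "dirs = (if p \<le> 1 then sphere 0 1 else cball 0 1)"

lemma dirs: "compact dirs" "v \<in> dirs \<Longrightarrow> norm v \<le> 1" "sphere 0 1 \<subseteq> dirs"
  by (auto simp: dirs_def split: if_splits)

lemma contact_unique:
  fixes X Y W :: "'m::finite minkowski"
  assumes X: "X \<in> hyp" and Y: "Y \<in> hyp" and W: "W \<in> hyp" and c: "0 \<le> c" "c < 1"
    and le: "\<And>u. u \<in> dirs \<Longrightarrow> c * lc W u \<le> pl X Y u"
    and v: "v \<in> dirs" and eq: "pl X Y v = c * lc W v"
  shows "norm v = 1" "\<And>u. u \<in> dirs \<Longrightarrow> u \<noteq> v \<Longrightarrow> c * lc W u < pl X Y u"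
proof -
  have "norm v = 1 \<and> (\<forall>u\<in>dirs. u \<noteq> v \<longrightarrow> c * lc W u < pl X Y u)"
  proof (cases "p \<le> 1")
    case True
    then have z: "v \<in> sphere 0 1" using v by (simp add: dirs_def)
    have "c * lc W u \<le> lc (tvec X Y v) u" if "u \<in> sphere 0 1" for u
    proof -
      have "c * lc W u \<le> pl X Y u" using le dirs(3) that by auto
      also have "\<dots> \<le> lc (tvec X Y v) u" using tvec_ge[OF X Y _ True] that z by simp
      finally show ?thesis .
    qed
    then show ?thesis
      using contact_concave(2)[OF X Y W c(1) less_imp_le[OF c(2)] True z eq] c z True by (auto simp: dirs_def)
  next
    case False
    then have p1: "1 \<le> p" by simp
    have d: "(dirs :: (real ^ 'm) set) = cball 0 1" using False by (simp add: dirs_def)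
    have nv: "norm v \<le> 1" using v dirs by auto
    define N where "N = tvec X Y v - c *\<^sub>R W"
    have lcN: "lc N u = lc (tvec X Y v) u - c * lc W u" for u by (simp add: N_def lc_diff lc_scaleR)
    have "c * lc W u \<le> lc (tvec X Y v) u" if "norm u \<le> 1" for u
      by (rule contact_convex[OF X Y nv eq _ that]) (use le d in auto)
    then have cone: "norm (fst N) \<le> snd N" unfolding cone_iff_lc lcN by simp
    \<comment> \<open>Here \<open>p <= 2\<close> enters through \<open>mink_tvec\<close>: the square
      of the tangent vector is at most -1, that of \<open>c W\<close> is
      \<open>- c^2\<close>.\<close>
    have "N \<noteq> 0"
    proof
      assume "N = 0"
      then have "tvec X Y v = c *\<^sub>R W" by (simp add: N_def)
      then have "- (c * c) \<le> -1" using mink_tvec[OF X Y nv] hypD[OF W] by (simp add: mink_simps)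
      moreover have "c * c < 1 * 1" using c by (intro mult_strict_mono') auto
      ultimately show False by simp
    qed
    have "lc N v = 0" unfolding lcN using lc_tvec_self[OF X Y nv] eq by simp
    note NN = cone_lc_zero[OF cone \<open>N \<noteq> 0\<close> nv this]
    have "c * lc W u < pl X Y u" if u: "norm u \<le> 1" "u \<noteq> v" for u
    proof -
      have e: "0 \<le> 1 - v \<bullet> u" using nv u by (intro inner_le_one) auto
      have "v \<bullet> u \<noteq> 1"
      proof
        assume 1: "v \<bullet> u = 1"
        then have "1 \<le> norm v * norm u" using norm_cauchy_schwarz[of v u] by simp
        then have "norm u = 1" using NN(3) u by simp
        then show False using u(2) NN(3) unit_inner_eq[of v u] 1 by simp
      qed
      then have "0 < snd N * (1 - v \<bullet> u)" using e NN(2) by simp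
      also have "\<dots> = lc N u" by (subst NN(1)) (simp add: lc_scaleR lc_nullv)
      finally show ?thesis unfolding lcN using tvec_le[OF X Y nv p1 u(1)] by simp
    qed
    then show ?thesis using NN(3) d by auto
  qed
  then show "norm v = 1" "\<And>u. u \<in> dirs \<Longrightarrow> u \<noteq> v \<Longrightarrow> c * lc W u < pl X Y u" by auto
qed

end

section \<open>Improving a pair that is not optimal\<close>

context psum
begin

lemma continuous_on_pl:
  assumes "continuous_on S f" "continuous_on S g" "continuous_on S v"
    and "\<And>x. x \<in> S \<Longrightarrow> f x \<in> hyp" "\<And>x. x \<in> S \<Longrightarrow> g x \<in> hyp" "\<And>x. x \<in> S \<Longrightarrow> norm (v x) \<le> 1"
  shows "continuous_on S (\<lambda>x. pl (f x) (g x) (v x))"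
  unfolding pl_def using assms ab ab0 by (intro continuous_intros) (auto intro!: lc_pos)

lemma tendsto_pl:
  assumes "(f \<longlongrightarrow> X) F" "(v \<longlongrightarrow> u) F" "X \<in> hyp" "Y \<in> hyp" "norm u \<le> 1"
  shows "((\<lambda>i. pl (f i) Y (v i)) \<longlongrightarrow> pl X Y u) F"
proof -
  have "0 < lc X u" "0 < lc Y u" using assms by (simp_all add: lc_pos)
  moreover have "0 < a * lc X u powr p + b * lc Y u powr p"
    using calculation ab ab0 by (intro pmean_arg_pos)
  moreover have "((\<lambda>i. lc (f i) (v i)) \<longlongrightarrow> lc X u) F" "((\<lambda>i. lc Y (v i)) \<longlongrightarrow> lc Y u) F"
    unfolding lc_def by (intro tendsto_intros assms)+
  ultimately show ?thesis
    unfolding pl_def pmean_def by (intro tendsto_intros) auto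
qed

text \<open>If arbitrarily small moves failed, the failing directions would accumulate at
  \<open>z\<close>, since elsewhere there is strict room. Near \<open>z\<close>, however, the move
  raises \<open>lc\<close> and with it the mean.\<close>

lemma improve_left:
  assumes K: "hconv K" and X: "X \<in> K" and Y: "Y \<in> hyp" and W: "W \<in> hyp" and a: "a > 0"
    and z: "z \<in> dirs" "norm z = 1" and c: "0 \<le> c"
    and lt: "\<And>u. u \<in> dirs \<Longrightarrow> u \<noteq> z \<Longrightarrow> c * lc W u < pl X Y u"
    and le: "c * lc W z \<le> pl X Y z"
    and X': "X' \<in> K" "lc X z < lc X' z"
  shows "\<exists>X''\<in>K. \<forall>u\<in>dirs. c * lc W u < pl X'' Y u"
proof (rule ccontr)
  assume neg: "\<not> ?thesis"
  have Kh: "X \<in> hyp" "X' \<in> hyp" using K X X' by (auto simp: hconv_def)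
  have zs: "z \<in> sphere 0 1" using z by simp
  define e where "e n = 1 / (real n + 1)" for n
  have e: "0 < e n" "e n \<le> 1" for n by (auto simp: e_def)
  have e0: "e \<longlonglongrightarrow> 0" unfolding e_def using LIMSEQ_inverse_real_of_nat by (simp add: field_simps)
  define Z where "Z n = horopt z X X' (e n)" for n
  have ZK: "Z n \<in> K" for n
    unfolding Z_def by (rule horopt_in[OF K X X'(1) zs]) (use e[of n] in auto)
  have "\<exists>u\<in>dirs. pl (Z n) Y u \<le> c * lc W u" for n using neg ZK[of n] by force
  then obtain u where u: "\<And>n. u n \<in> dirs" "\<And>n. pl (Z n) Y (u n) \<le> c * lc W (u n)" by metis
  obtain u0 r where r: "u0 \<in> dirs" "strict_mono r" "(u \<circ> r) \<longlonglongrightarrow> u0"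
    using dirs(1) u(1) unfolding compact_def by metis
  have ur: "(\<lambda>n. u (r n)) \<longlonglongrightarrow> u0" using r(3) by (simp add: o_def)
  have er: "(\<lambda>n. e (r n)) \<longlonglongrightarrow> 0" using LIMSEQ_subseq_LIMSEQ[OF e0 r(2)] by (simp add: o_def)
  have Zr: "(\<lambda>n. Z (r n)) \<longlonglongrightarrow> X" unfolding Z_def by (rule horopt_tendsto[OF Kh(1) zs er])
  have "pl X Y u0 \<le> c * lc W u0"
  proof (rule LIMSEQ_le)
    show "(\<lambda>n. pl (Z (r n)) Y (u (r n))) \<longlonglongrightarrow> pl X Y u0"
      by (rule tendsto_pl[OF Zr ur Kh(1) Y dirs(2)[OF r(1)]])
    show "(\<lambda>n. c * lc W (u (r n))) \<longlonglongrightarrow> c * lc W u0"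
      unfolding lc_def by (intro tendsto_intros ur)
    show "\<exists>N. \<forall>n\<ge>N. pl (Z (r n)) Y (u (r n)) \<le> c * lc W (u (r n))" using u(2) by blast
  qed
  then have u0: "u0 = z" using lt[OF r(1)] by force
  \<comment> \<open>The bracket of \<open>horopt_lower\<close>; its positive sign at
    \<open>z\<close> decides for all directions near \<open>z\<close>, independently of the step
    size.\<close>
  define D where "D v = lc X' v - lc X v - (- mink X X' - 1) / lc X z * (1 - z \<bullet> v)" for v
  have "(\<lambda>n. D (u (r n))) \<longlonglongrightarrow> D z"
    unfolding D_def lc_def using ur lc_pos[OF Kh(1), of z] zs unfolding u0 lc_def by (intro tendsto_intros) auto
  moreover have "D z > 0" using X'(2) z by (simp add: D_def dot_square_norm)
  ultimately have "eventually (\<lambda>n. D (u (r n)) > 0) sequentially" by (rule order_tendstoD(1))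
  then obtain n where n: "D (u (r n)) > 0" using eventually_sequentially by auto
  let ?v = "u (r n)" and ?Z = "Z (r n)"
  have nv: "norm ?v \<le> 1" using dirs(2)[OF u(1)] .
  have "0 < e (r n) * D ?v" using n e(1)[of "r n"] by simp
  also have "\<dots> \<le> lc ?Z ?v - lc X ?v"
    unfolding Z_def D_def using horopt_lower[OF Kh zs less_imp_le[OF e(1)] e(2) nv less_imp_le[OF X'(2)], of "r n"]
    by simp
  finally have "lc X ?v < lc ?Z ?v" by simp
  then have "pl X Y ?v < pl ?Z Y ?v"
    unfolding pl_def using a ab p0 lc_pos[OF Kh(1) nv] lc_pos[OF Y nv] by (intro pmean_strict_mono_left) auto
  moreover have "c * lc W ?v \<le> pl X Y ?v"
    using lt[OF u(1)[of "r n"]] le by (cases "?v = z") (auto simp: less_imp_le)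
  ultimately show False using u(2)[of "r n"] by linarith
qed

end

lemma psum_swap: "psum p a b \<Longrightarrow> psum p b a"
  by (simp add: psum_def add.commute)

lemma pl_swap: "psum p a b \<Longrightarrow> psum.pl p a b X Y v = psum.pl p b a Y X v"
  using psum_swap[of p a b] by (simp add: psum.pl_def pmean_commute)

context psum
begin

lemma improve_right:
  assumes "hconv L" "Y \<in> L" "X \<in> hyp" "W \<in> hyp" "b > 0" "z \<in> dirs" "norm z = 1" "0 \<le> c"
    and "\<And>u. u \<in> dirs \<Longrightarrow> u \<noteq> z \<Longrightarrow> c * lc W u < pl X Y u"
    and "c * lc W z \<le> pl X Y z"
    and "Y' \<in> L" "lc Y z < lc Y' z"
  shows "\<exists>Y''\<in>L. \<forall>u\<in>dirs. c * lc W u < pl X Y'' u"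
  using psum.improve_left[OF psum_swap[OF psum_axioms] assms(1-8), of Y'] assms(9-)
  unfolding pl_swap[OF psum_axioms] by blast

lemma ratio_attains_inf:
  fixes X Y W :: "'m::finite minkowski"
  assumes X: "X \<in> hyp" and Y: "Y \<in> hyp" and W: "W \<in> hyp"
  shows "\<exists>v\<in>dirs. \<forall>u\<in>dirs. pl X Y v / lc W v * lc W u \<le> pl X Y u"
proof -
  have Wp: "0 < lc W u" if "u \<in> dirs" for u using lc_pos[OF W dirs(2)[OF that]] .
  have cont: "continuous_on dirs (\<lambda>u. pl X Y u / lc W u)"
  proof (intro continuous_on_divide continuous_on_pl continuous_on_lc continuous_on_const continuous_on_id)
    show "\<forall>u\<in>dirs. lc W u \<noteq> 0" using Wp by force
  qed (use X Y dirs(2) in auto)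
  obtain z :: "real ^ 'm" where "norm z = 1" using vector_choose_size[of 1] by auto
  then have "z \<in> dirs" using dirs(3) by (auto simp: subset_iff)
  then have "dirs \<noteq> ({} :: (real^'m) set)" by blast
  from continuous_attains_inf[OF dirs(1) this cont]
  obtain v where v: "v \<in> dirs" "\<And>u. u \<in> dirs \<Longrightarrow> pl X Y v / lc W v \<le> pl X Y u / lc W u" by blast
  have "pl X Y v / lc W v * lc W u \<le> pl X Y u" if "u \<in> dirs" for u
    using v(2)[OF that] Wp[OF that] by (simp add: le_divide_eq)
  then show ?thesis using v(1) by blast
qed

lemma improve_scale:
  assumes X: "X \<in> hyp" and Y: "Y \<in> hyp" and W: "W \<in> hyp" and c: "c < 1"
    and lt: "\<And>u. u \<in> dirs \<Longrightarrow> c * lc W u < pl X Y u"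
  shows "\<exists>c'>c. c' \<le> 1 \<and> (\<forall>u\<in>dirs. c' * lc W u \<le> pl X Y u)"
proof -
  obtain v where v: "v \<in> dirs" "\<And>u. u \<in> dirs \<Longrightarrow> pl X Y v / lc W v * lc W u \<le> pl X Y u"
    using ratio_attains_inf[OF X Y W] by blast
  have Wp: "0 < lc W u" if "u \<in> dirs" for u using lc_pos[OF W dirs(2)[OF that]] .
  \<comment> \<open>The cap at 1 keeps the new constant in the range over which
    \<open>exists_pair\<close> maximises.\<close>
  let ?c = "min 1 (pl X Y v / lc W v)"
  have "c < ?c" using c lt[OF v(1)] Wp[OF v(1)] by (simp add: less_divide_eq)
  moreover have "?c * lc W u \<le> pl X Y u" if u: "u \<in> dirs" for u
  proof -
    have "?c * lc W u \<le> pl X Y v / lc W v * lc W u" using Wp[OF u] by (intro mult_right_mono) auto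
    then show ?thesis using v(2)[OF u] by simp
  qed
  ultimately show ?thesis by (intro exI[of _ ?c]) auto
qed

text \<open>The pair maximises the largest \<open>c\<close> with \<open>c * lc W u \<le> pl X Y u\<close> for all \<open>u\<close>.  If \<open>c < 1\<close>, there is a
  single contact direction \<open>v\<close>, and moving along \<open>horopt\<close> towards a point of \<open>K\<close> or \<open>L\<close> that is higher in
  direction \<open>v\<close> increases \<open>c\<close>.\<close>

lemma exists_pair:
  fixes K L :: "'m::finite minkowski set"
  assumes K: "hconv K" and L: "hconv L" and W: "W \<in> hyp"
    and cover: "\<And>z. z \<in> sphere 0 1 \<Longrightarrow> \<exists>X\<in>K. \<exists>Y\<in>L. lc W z \<le> pl X Y z"
  shows "\<exists>X\<in>K. \<exists>Y\<in>L. \<forall>u\<in>dirs. lc W u \<le> pl X Y u"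
proof -
  have KL: "compact K" "compact L" "K \<noteq> {}" "L \<noteq> {}" "K \<subseteq> hyp" "L \<subseteq> hyp"
    using K L by (auto simp: hconv_def)
  define B where "B = {0..1::real} \<times> K \<times> L"
  \<comment> \<open>With the constant as a further coordinate, \<open>A\<close> is a closed part of
    a compact set and the maximum is attained without showing continuity of the minimum over
    directions.\<close>
  define A where "A = {t\<in>B. \<forall>u\<in>dirs. fst t * lc W u \<le> pl (fst (snd t)) (snd (snd t)) u}"
  have B: "compact B" unfolding B_def using KL by (intro compact_Times) auto
  have A: "A = B \<inter> (\<Inter>u\<in>dirs. {t\<in>B. fst t * lc W u \<le> pl (fst (snd t)) (snd (snd t)) u})"
    by (auto simp: A_def)
  have "closed {t\<in>B. fst t * lc W u \<le> pl (fst (snd t)) (snd (snd t)) u}" if "u \<in> dirs" for u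
    using dirs(2)[OF that] KL compact_imp_closed[OF B]
    by (intro continuous_on_closed_Collect_le continuous_intros continuous_on_pl) (auto simp: B_def)
  then have "compact A" unfolding A using B by (intro compact_Int_closed closed_INT) auto
  moreover obtain X0 Y0 where XY0: "X0 \<in> K" "Y0 \<in> L" using KL by blast
  have "X0 \<in> hyp" "Y0 \<in> hyp" using XY0 KL by auto
  then have "0 \<le> pl X0 Y0 u" if "u \<in> dirs" for u
    using pl_pos[of X0 Y0 u] dirs(2)[OF that] by simp
  then have "(0, X0, Y0) \<in> A" unfolding A_def B_def using XY0 by simp
  then have "A \<noteq> {}" by blast
  ultimately obtain t where t: "t \<in> A" "\<And>s. s \<in> A \<Longrightarrow> fst s \<le> fst t"
    using continuous_attains_sup[OF _ _ continuous_on_fst[OF continuous_on_id], of A] by blast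
  obtain c X Y where tt: "t = (c, X, Y)" by (cases t) auto
  have c: "0 \<le> c" "c \<le> 1" and XK: "X \<in> K" and YL: "Y \<in> L"
    and le: "\<And>u. u \<in> dirs \<Longrightarrow> c * lc W u \<le> pl X Y u"
    using t(1) by (auto simp: tt A_def B_def)
  have X: "X \<in> hyp" and Y: "Y \<in> hyp" using XK YL KL by auto
  have max: "\<not> (\<forall>u\<in>dirs. c * lc W u < pl X' Y' u)" if XY': "X' \<in> K" "Y' \<in> L" "c < 1" for X' Y'
  proof
    assume "\<forall>u\<in>dirs. c * lc W u < pl X' Y' u"
    then obtain c' where c': "c' > c" "c' \<le> 1" "\<forall>u\<in>dirs. c' * lc W u \<le> pl X' Y' u"
      using improve_scale[of X' Y' W c] XY' KL W by blast
    then have "(c', X', Y') \<in> A" using XY' c(1) by (simp add: A_def B_def)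
    from t(2)[OF this] show False using c'(1) by (simp add: tt)
  qed
  have "c = 1"
  proof (rule ccontr)
    assume "c \<noteq> 1"
    then have c1: "c < 1" using c by simp
    then obtain v where v: "v \<in> dirs" "pl X Y v \<le> c * lc W v" using max[OF XK YL] by force
    have eq: "pl X Y v = c * lc W v" using v le[OF v(1)] by simp
    note U = contact_unique[OF X Y W c(1) c1 le v(1) eq]
    have "v \<in> sphere 0 1" using U(1) by simp
    then obtain X' Y' where XY': "X' \<in> K" "Y' \<in> L" "lc W v \<le> pl X' Y' v" using cover by blast
    have nv: "norm v \<le> 1" using U(1) by simp
    have "pl X Y v < pl X' Y' v"
    proof -
      have "c * lc W v < 1 * lc W v" using c1 lc_pos[OF W nv] by (intro mult_strict_right_mono)
      then show ?thesis using eq XY'(3) by simp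
    qed
    have lt: "a * lc X v powr p + b * lc Y v powr p < a * lc X' v powr p + b * lc Y' v powr p"
    proof (rule ccontr)
      assume "\<not> ?thesis"
      then have "pl X' Y' v \<le> pl X Y v"
        unfolding pl_def pmean_def using p0 ab by (intro powr_mono2) auto
      then show False using \<open>pl X Y v < pl X' Y' v\<close> by simp
    qed
    have "X' \<in> hyp" "Y' \<in> hyp" using XY' KL by auto
    then have XYp: "0 < lc X v" "0 < lc Y v" "0 < lc X' v" "0 < lc Y' v"
      using X Y nv by (simp_all add: lc_pos)
    \<comment> \<open>A strict increase of the mean must come from an argument with positive weight,
      and only such an argument can be used to improve the pair.\<close>
    have "(a > 0 \<and> lc X v < lc X' v) \<or> (b > 0 \<and> lc Y v < lc Y' v)"
    proof (rule ccontr)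
      assume neg: "\<not> ?thesis"
      have "a * lc X' v powr p \<le> a * lc X v powr p"
        using neg ab XYp p0 by (cases "a = 0") (auto intro!: powr_mono2)
      moreover have "b * lc Y' v powr p \<le> b * lc Y v powr p"
        using neg ab XYp p0 by (cases "b = 0") (auto intro!: powr_mono2)
      ultimately show False using lt by linarith
    qed
    then show False
    proof
      assume "a > 0 \<and> lc X v < lc X' v"
      then show False using improve_left[OF K XK Y W _ v(1) U(1) c(1) U(2) le[OF v(1)] XY'(1)] max[OF _ YL c1] by blast
    next
      assume "b > 0 \<and> lc Y v < lc Y' v"
      then show False using improve_right[OF L YL X W _ v(1) U(1) c(1) U(2) le[OF v(1)] XY'(2)] max[OF XK _ c1] by blast
    qed
  qed
  then show ?thesis using XK YL le by auto
qed

end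

section \<open>The light-cone sum\<close>

lemma inverse_hoelder_conj: "p \<noteq> 0 \<Longrightarrow> p \<noteq> 1 \<Longrightarrow> 1 / hoelder_conj p = (p - 1) / p"
  by (simp add: hoelder_conj_def)

abbreviation hw :: "real \<Rightarrow> real \<Rightarrow> real \<Rightarrow> real" where
  "hw p t a \<equiv> t powr (1 / hoelder_conj p) * a powr (1 / p)"

text \<open>\<open>a * (x / h) powr p\<close> is the normalised weight of \<open>x\<close>. Taking
  it as the parameter makes the light-cone coefficient that of the tangent function, because the
  exponents \<open>(p - 1) / p\<close> and \<open>1 / p\<close> of \<open>a\<close> add up to
  1.\<close>

lemma powr_conj_coeff:
  assumes "a \<ge> 0" "x > 0" "h > 0" "p > 0" "p \<noteq> 1"
  shows "hw p (a * (x / h) powr p) a = twt p a x h"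
proof (cases "a = 0")
  case False
  then have a: "a > 0" using assms by simp
  have "(a * (x / h) powr p) powr ((p - 1) / p) * a powr (1 / p)
      = a powr ((p - 1) / p + 1 / p) * (x / h) powr (p - 1)"
    using assms a by (simp add: powr_mult powr_powr powr_add)
  also have "(p - 1) / p + 1 / p = 1" using assms by (simp add: field_simps)
  finally show ?thesis using assms a by (simp add: inverse_hoelder_conj twt_def)
qed (simp add: twt_def)

lemma pmean_zero_left:
  assumes "b \<ge> 0" "y > 0" "p > 0"
  shows "pmean p 0 b x y = b powr (1 / p) * y"
  using assms by (simp add: pmean_def powr_mult powr_powr)

lemma conj_tangent:
  assumes "a > 0" "b > 0" "p > 0" "p \<noteq> 1" "0 < t" "t < 1"
  obtains x0 y0 where "power_mean p a b x0 y0 1"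
    "twt p a x0 1 = hw p (1 - t) a"
    "twt p b y0 1 = hw p t b"
proof
  let ?x = "((1 - t) / a) powr (1 / p)" and ?y = "(t / b) powr (1 / p)"
  have x: "?x > 0" "a * (?x / 1) powr p = 1 - t" using assms by (auto simp: powr_powr)
  have y: "?y > 0" "b * (?y / 1) powr p = t" using assms by (auto simp: powr_powr)
  show "power_mean p a b ?x ?y 1"
    by unfold_locales (use assms x y in \<open>auto simp: pmean_def\<close>)
  show "twt p a ?x 1 = hw p (1 - t) a"
    using powr_conj_coeff[of a ?x 1 p] assms x by simp
  show "twt p b ?y 1 = hw p t b"
    using powr_conj_coeff[of b ?y 1 p] assms y by simp
qed

text \<open>The tangent inequality at the base point of \<open>conj_tangent\<close>. If a weight
  vanishes or \<open>t\<close> is an end point, one summand drops out, as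
  \<open>0 powr s = 0\<close>, and the remaining power of \<open>t\<close> or \<open>1 - t\<close>
  is at most 1.\<close>

lemma hoelder_le:
  fixes x y :: real
  assumes ab: "a \<ge> 0" "b \<ge> 0" "a + b > 0" and p: "p > 1" and t: "0 \<le> t" "t \<le> 1" and xy: "x > 0" "y > 0"
  shows "hw p (1 - t) a * x + hw p t b * y
    \<le> pmean p a b x y" (is "?l \<le> _")
proof -
  have q: "1 / hoelder_conj p > 0" using p by (simp add: inverse_hoelder_conj)
  have t1: "t powr (1 / hoelder_conj p) \<le> 1" "(1 - t) powr (1 / hoelder_conj p) \<le> 1"
    using t q powr_mono2[of "1 / hoelder_conj p" t 1] powr_mono2[of "1 / hoelder_conj p" "1 - t" 1] by auto
  have l: "b powr (1 / p) * y \<le> pmean p a b x y"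
    unfolding pmean_zero_left[OF ab(2) xy(2) order_less_trans[OF zero_less_one p], of x, symmetric] pmean_def
    using assms by (intro powr_mono2) auto
  have r: "a powr (1 / p) * x \<le> pmean p a b x y"
    unfolding pmean_zero_left[OF ab(1) xy(1) order_less_trans[OF zero_less_one p], of y, symmetric]
      pmean_commute[of p a b] pmean_def
    using assms by (intro powr_mono2) auto
  consider "a = 0 \<or> t = 1" | "b = 0 \<or> t = 0" | "a > 0" "b > 0" "0 < t" "t < 1" using ab t by linarith
  then show ?thesis
  proof cases
    case 1
    then have "?l \<le> 1 * (b powr (1 / p) * y)"
      unfolding mult.assoc using t1 xy mult_right_mono[OF t1(1), of "b powr (1 / p) * y"] by auto
    then show ?thesis using l by simp
  next
    case 2
    then have "?l \<le> 1 * (a powr (1 / p) * x)"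
      unfolding mult.assoc using t1 xy mult_right_mono[OF t1(2), of "a powr (1 / p) * x"] by auto
    then show ?thesis using r by simp
  next
    case 3
    obtain x0 y0 where "power_mean p a b x0 y0 1"
      "twt p a x0 1 = hw p (1 - t) a"
      "twt p b y0 1 = hw p t b"
      using conj_tangent[of a b p t] 3 p by auto
    then show ?thesis using power_mean.tangent_le[of p a b x0 y0 1 x y] p xy by simp
  qed
qed

lemma hoelder_ge:
  fixes x y :: real
  assumes ab: "a \<ge> 0" "b \<ge> 0" "a + b > 0" and p: "0 < p" "p < 1" and t: "0 < t" "t < 1" and xy: "x > 0" "y > 0"
  shows "pmean p a b x y \<le>
    hw p (1 - t) a * x + hw p t b * y"
proof -
  have q: "1 / hoelder_conj p \<le> 0" using p by (simp add: inverse_hoelder_conj divide_nonpos_pos)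
  have t1: "1 \<le> t powr (1 / hoelder_conj p)" "1 \<le> (1 - t) powr (1 / hoelder_conj p)"
    using t powr_mono2'[OF q, of t 1] powr_mono2'[OF q, of "1 - t" 1] by auto
  consider "a = 0" | "b = 0" | "a > 0" "b > 0" using ab by linarith
  then show ?thesis
  proof cases
    case 1
    then show ?thesis
      using mult_right_mono[OF t1(1), of "b powr (1 / p) * y"] assms by (simp add: pmean_zero_left mult.assoc)
  next
    case 2
    then show ?thesis
      using mult_right_mono[OF t1(2), of "a powr (1 / p) * x"] assms
      by (simp add: pmean_zero_left mult.assoc pmean_commute[of p a 0])
  next
    case 3
    obtain x0 y0 where "power_mean p a b x0 y0 1"
      "twt p a x0 1 = hw p (1 - t) a"
      "twt p b y0 1 = hw p t b"
      using conj_tangent[of a b p t] 3 p t by auto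
    then show ?thesis using power_mean.tangent_ge[of p a b x0 y0 1 x y] p xy by simp
  qed
qed

lemma le_of_powr_left_limit:
  assumes "\<And>t. 0 < t \<Longrightarrow> t < 1 \<Longrightarrow> w \<le> t powr c * d"
  shows "w \<le> (d::real)"
proof -
  have "((\<lambda>t. t powr c * d) \<longlongrightarrow> 1 powr c * d) (at_left (1::real))"
    by (intro tendsto_intros) auto
  moreover have "eventually (\<lambda>t. w \<le> t powr c * d) (at_left (1::real))"
    using assms by (auto simp: eventually_at_left_field intro!: exI[of _ 0])
  ultimately have "w \<le> 1 powr c * d" by (rule tendsto_lowerbound) simp
  then show ?thesis by simp
qed

text \<open>At \<open>t = n\<close>, the normalised weight of \<open>y\<close>, the right-hand side
  equals the mean. If \<open>a\<close> or \<open>b\<close> vanishes, the infimum is only approached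
  as \<open>t\<close> tends to an end point, whence the limit.\<close>

lemma hoelder_inf:
  fixes x y :: real
  assumes ab0: "a \<ge> 0" "b \<ge> 0" "a + b > 0" and p01: "0 < p" "p < 1" and xy: "x > 0" "y > 0"
    and le: "\<And>t. 0 < t \<Longrightarrow> t < 1 \<Longrightarrow> w \<le> hw p (1 - t) a * x
      + hw p t b * y"
  shows "w \<le> pmean p a b x y"
proof -
  consider "a = 0" | "b = 0" | "a > 0" "b > 0" using ab0 by linarith
  then show ?thesis
  proof cases
    case 1
    have "w \<le> b powr (1 / p) * y"
      by (rule le_of_powr_left_limit[of _ "1 / hoelder_conj p"]) (use le 1 in \<open>auto simp: mult.assoc\<close>)
    then show ?thesis using 1 assms by (simp add: pmean_zero_left)
  next
    case 2
    have "w \<le> a powr (1 / p) * x"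
    proof (rule le_of_powr_left_limit[of _ "1 / hoelder_conj p"])
      fix t :: real assume "0 < t" "t < 1"
      then show "w \<le> t powr (1 / hoelder_conj p) * (a powr (1 / p) * x)"
        using le[of "1 - t"] 2 by (simp add: mult.assoc)
    qed
    then show ?thesis using 2 assms by (simp add: pmean_zero_left pmean_commute[of p a 0])
  next
    case 3
    define h where "h = pmean p a b x y"
    interpret power_mean p a b x y h by unfold_locales (use assms h_def in auto)
    have "m > 0" "n > 0" using 3 xy h_pos by (auto simp: m_def n_def)
    then have "w \<le> hw p (1 - n) a * x
      + hw p n b * y" using mn by (intro le) auto
    also have "1 - n = m" using mn by simp
    also have "hw p m a * x
      + hw p n b * y = h"
      unfolding m_def n_def using powr_conj_coeff[OF ab0(1) xy(1) h_pos] powr_conj_coeff[OF ab0(2) xy(2) h_pos]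
        tangent_at p01 by simp
    finally show ?thesis by (simp add: h_def)
  qed
qed

context psum
begin

definition pset :: "'m::finite minkowski set \<Rightarrow> 'm minkowski set \<Rightarrow> 'm minkowski set" where
  "pset K L = {W \<in> hyp. \<forall>z\<in>sphere 0 1. \<exists>X\<in>K. \<exists>Y\<in>L. lc W z \<le> pl X Y z}"

lemma lc_admissible_iff:
  "lc_admissible p t a X b Y W \<longleftrightarrow> (\<forall>z\<in>sphere 0 1. lc W z \<le> lc (lc_vector p t a X b Y) z)"
  unfolding lc_admissible_def cone_iff_lc by (simp add: lc_diff)

lemma lc_lc_vector: "p \<noteq> 1 \<Longrightarrow> lc (lc_vector p t a X b Y) z =
    hw p (1 - t) a * lc X z
      + hw p t b * lc Y z"
  by (simp add: lc_vector_def lc_add lc_scaleR)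

lemma lc_lc_vector_one:
  assumes "p = 1" "X \<in> hyp" "Y \<in> hyp" "norm z \<le> 1"
  shows "lc (lc_vector p t a X b Y) z = pl X Y z"
  using assms ab lc_pos[OF assms(2,4)] lc_pos[OF assms(3,4)]
  unfolding pl_def by (simp add: lc_vector_def lc_add lc_scaleR pmean_one)

lemma light_cone_sum_subset:
  assumes "K \<subseteq> hyp" "L \<subseteq> hyp"
  shows "light_cone_sum p a K b L \<subseteq> pset K L"
proof
  fix W assume W: "W \<in> light_cone_sum p a K b L"
  show "W \<in> pset K L"
  proof (cases "p \<ge> 1")
    case True
    then obtain X Y t where XYt: "X \<in> K" "Y \<in> L" "0 \<le> t" "t \<le> 1" "W \<in> hyp" "lc_admissible p t a X b Y W"
      using W by (auto simp: light_cone_sum_def)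
    have h: "X \<in> hyp" "Y \<in> hyp" using XYt assms by auto
    have "lc W z \<le> pl X Y z" if z: "z \<in> sphere 0 1" for z
    proof -
      have nz: "norm z \<le> 1" using z by simp
      have "lc W z \<le> lc (lc_vector p t a X b Y) z" using XYt(6) z by (simp add: lc_admissible_iff)
      also have "\<dots> \<le> pl X Y z"
      proof (cases "p = 1")
        case True then show ?thesis using lc_lc_vector_one[OF _ h nz] by simp
      next
        case False
        then show ?thesis unfolding lc_lc_vector[OF False] pl_def
          using True ab ab0 XYt lc_pos[OF h(1) nz] lc_pos[OF h(2) nz] by (intro hoelder_le) auto
      qed
      finally show ?thesis .
    qed
    then show ?thesis using XYt(1,2,5) unfolding pset_def by blast
  next
    case False
    obtain X Y where XY: "X \<in> K" "Y \<in> L" "\<And>t. 0 < t \<Longrightarrow> t < 1 \<Longrightarrow> W \<in> hyp \<and> lc_admissible p t a X b Y W"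
      using W False by (auto simp: light_cone_sum_def)
    have h: "X \<in> hyp" "Y \<in> hyp" using XY assms by auto
    have Wh: "W \<in> hyp" using XY(3)[of "1/2"] by simp
    have "lc W z \<le> pl X Y z" if z: "z \<in> sphere 0 1" for z
    proof -
      have nz: "norm z \<le> 1" using z by simp
      have "p < 1" "p \<noteq> 1" using False by auto
      show ?thesis unfolding pl_def
        using ab ab0 p0 \<open>p < 1\<close> lc_pos[OF h(1) nz] lc_pos[OF h(2) nz]
      proof (rule hoelder_inf)
        fix t :: real assume "0 < t" "t < 1"
        then show "lc W z \<le> hw p (1 - t) a * lc X z
            + hw p t b * lc Y z"
          using XY(3) z lc_admissible_iff lc_lc_vector[OF \<open>p \<noteq> 1\<close>] by metis
      qed
    qed
    then show ?thesis using XY(1,2) Wh unfolding pset_def by blast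
  qed
qed

lemma tvec_lc_vector:
  assumes "p > 1" "X \<in> hyp" "Y \<in> hyp" "norm v \<le> 1"
  obtains t where "0 \<le> t" "t \<le> 1" "lc_vector p t a X b Y = tvec X Y v"
proof -
  interpret m: power_mean p a b "lc X v" "lc Y v" "pl X Y v" by (rule power_meanI[OF assms(2-4)])
  have "1 - m.n = m.m" using m.mn by simp
  then have "lc_vector p m.n a X b Y = tvec X Y v"
    unfolding lc_vector_def tvec_def m.m_def m.n_def
    using powr_conj_coeff[OF ab(1) m.xy0(1) m.h_pos p0] powr_conj_coeff[OF ab(2) m.xy0(2) m.h_pos p0] assms(1)
    by simp
  then show ?thesis using that m.mn by (metis diff_ge_0_iff_ge \<open>1 - m.n = m.m\<close>)
qed

text \<open>Given the pair of \<open>exists_pair\<close>, it remains to treat \<open>t\<close>. For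
  \<open>p > 1\<close> it is read off from \<open>tvec\<close> at a minimiser of
  \<open>pl X Y / lc W\<close> over the ball, where \<open>contact_convex\<close> makes the tangent
  function dominate \<open>lc W\<close>; for \<open>p < 1\<close> every \<open>t\<close> works by
  \<open>hoelder_ge\<close>.\<close>

theorem light_cone_sum_eq:
  assumes K: "hconv K" and L: "hconv L"
  shows "light_cone_sum p a K b L = pset K L"
proof
  have Kh: "K \<subseteq> hyp" "L \<subseteq> hyp" using K L by (auto simp: hconv_def)
  then show "light_cone_sum p a K b L \<subseteq> pset K L" by (rule light_cone_sum_subset)
  show "pset K L \<subseteq> light_cone_sum p a K b L"
  proof
    fix W assume W: "W \<in> pset K L"
    then have Wh: "W \<in> hyp" by (simp add: pset_def)
    obtain X Y where XY: "X \<in> K" "Y \<in> L" "\<And>u. u \<in> dirs \<Longrightarrow> lc W u \<le> pl X Y u"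
      using exists_pair[OF K L Wh] W by (force simp: pset_def)
    have h: "X \<in> hyp" "Y \<in> hyp" using XY Kh by auto
    show "W \<in> light_cone_sum p a K b L"
    proof (cases "p > 1")
      case True
      then have d: "(dirs :: (real ^ 'a) set) = cball 0 1" by (simp add: dirs_def)
      have Wp: "0 < lc W u" if "u \<in> dirs" for u using lc_pos[OF Wh dirs(2)[OF that]] .
      obtain v where v: "v \<in> dirs" "\<And>u. u \<in> dirs \<Longrightarrow> pl X Y v / lc W v * lc W u \<le> pl X Y u"
        using ratio_attains_inf[OF h Wh] by blast
      define c where "c = pl X Y v / lc W v"
      have c1: "1 \<le> c" using XY(3)[OF v(1)] Wp[OF v(1)] by (simp add: c_def le_divide_eq)
      have nv: "norm v \<le> 1" using dirs(2)[OF v(1)] .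
      have T: "c * lc W u \<le> lc (tvec X Y v) u" if "norm u \<le> 1" for u
      proof (rule contact_convex[OF h nv _ _ that])
        show "pl X Y v = c * lc W v" using Wp[OF v(1)] by (simp add: c_def)
        fix u :: "real ^ 'a" assume "norm u \<le> 1"
        then have "u \<in> dirs" by (simp add: d)
        then show "c * lc W u \<le> pl X Y u" using v(2)[of u] by (simp add: c_def)
      qed
      obtain t where t: "0 \<le> t" "t \<le> 1" "lc_vector p t a X b Y = tvec X Y v"
        by (rule tvec_lc_vector[OF True h nv])
      have "lc W z \<le> lc (lc_vector p t a X b Y) z" if z: "z \<in> sphere 0 1" for z
      proof -
        have "1 * lc W z \<le> c * lc W z"
          using c1 lc_pos[OF Wh, of z] z by (intro mult_right_mono) auto
        then show ?thesis using T[of z] z t(3) by simp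
      qed
      then have "lc_admissible p t a X b Y W" by (simp add: lc_admissible_iff)
      moreover have "p \<ge> 1" "t \<in> {0..1}" using True t by auto
      ultimately have "\<exists>t\<in>{0..1}. lc_admissible p t a X b Y W" by blast
      then show ?thesis unfolding light_cone_sum_def using XY(1,2) Wh \<open>p \<ge> 1\<close> by auto
    next
      case False
      then have le: "lc W z \<le> pl X Y z" if "z \<in> sphere 0 1" for z using XY(3) dirs(3) that by blast
      show ?thesis
      proof (cases "p = 1")
        case True
        have "lc_admissible p 0 a X b Y W"
          unfolding lc_admissible_iff using le lc_lc_vector_one[OF True h] by simp
        then show ?thesis using True XY Wh by (force simp: light_cone_sum_def)
      next
        case False
        then have p1: "p < 1" using \<open>\<not> p > 1\<close> by simp
        have "lc_admissible p t a X b Y W" if t: "0 < t" "t < 1" for t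
          unfolding lc_admissible_iff lc_lc_vector[OF False]
        proof
          fix z :: "real ^ 'a" assume z: "z \<in> sphere 0 1"
          then have nz: "norm z \<le> 1" by simp
          have "lc W z \<le> pmean p a b (lc X z) (lc Y z)" using le[OF z] by (simp add: pl_def)
          also have "\<dots> \<le> hw p (1 - t) a * lc X z
            + hw p t b * lc Y z"
            using hoelder_ge[OF ab ab0 p0 p1 t lc_pos[OF h(1) nz] lc_pos[OF h(2) nz]] .
          finally show "lc W z \<le> hw p (1 - t) a * lc X z
            + hw p t b * lc Y z" .
        qed
        then have "\<forall>t\<in>{0<..<1}. lc_admissible p t a X b Y W" by simp
        then show ?thesis unfolding light_cone_sum_def using p1 XY(1,2) Wh by auto
      qed
    qed
  qed
qed

end

section \<open>Horospherical support functions\<close>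

lemma closed_horoball_iff:
  assumes "z \<in> sphere 0 1"
  shows "X \<in> closed_horoball z s \<longleftrightarrow> X \<in> hyp \<and> ln (lc X z) \<le> s"
  by (simp add: closed_horoball_def mink_nullv[unfolded nullv_def])

lemma horo_support_lc: "horo_support K z = (SUP X\<in>K. ln (lc X z))"
  by (simp add: horo_support_def mink_nullv[unfolded nullv_def])

lemma horo_support_max:
  assumes "X \<in> K" "K \<subseteq> hyp" "z \<in> sphere 0 1" "\<And>Y. Y \<in> K \<Longrightarrow> lc Y z \<le> lc X z"
  shows "horo_support K z = ln (lc X z)"
  unfolding horo_support_lc
proof (rule cSup_eq_maximum)
  show "ln (lc X z) \<in> (\<lambda>X. ln (lc X z)) ` K" using assms by blast
  fix y assume "y \<in> (\<lambda>X. ln (lc X z)) ` K"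
  then obtain Y where Y: "Y \<in> K" "y = ln (lc Y z)" by blast
  have "Y \<in> hyp" using Y assms by blast
  then have "0 < lc Y z" using assms(3) by (simp add: lc_pos)
  then show "y \<le> ln (lc X z)" using Y assms(4)[OF Y(1)] by simp
qed

lemma h_convex_bounded_domain_eq:
  fixes \<Omega> :: "'m::finite minkowski set"
  assumes "h_convex_bounded_domain \<Omega>"
  shows "\<Omega> = {X\<in>hyp. \<forall>z\<in>sphere 0 1. ln (lc X z) \<le> horo_support \<Omega> z}" (is "_ = ?R")
proof -
  have ne: "\<Omega> \<noteq> {}" and ex: "\<exists>r. \<forall>X\<in>\<Omega>. \<forall>Y\<in>\<Omega>. hdist X Y \<le> r"
    "\<exists>F. F \<subseteq> sphere 0 1 \<times> UNIV \<and> \<Omega> = hyp \<inter> (\<Inter>(z, s)\<in>F. closed_horoball z s)"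
    using assms by (simp_all add: h_convex_bounded_domain_def)
  from ex(1) obtain r where r: "\<And>X Y. X \<in> \<Omega> \<Longrightarrow> Y \<in> \<Omega> \<Longrightarrow> hdist X Y \<le> r" by blast
  from ex(2) obtain F where F: "F \<subseteq> sphere 0 1 \<times> UNIV"
    and eq: "\<Omega> = hyp \<inter> (\<Inter>(z, s)\<in>F. closed_horoball z s)" by blast
  have sub: "\<Omega> \<subseteq> hyp" using eq by blast
  obtain X0 where X0: "X0 \<in> \<Omega>" using ne by blast
  \<comment> \<open>A real \<open>SUP\<close> is a genuine supremum only over a set that is bounded
    above; bounded diameter provides this through \<open>lc_ratio_bound\<close>.\<close>
  have "bdd_above ((\<lambda>X. ln (lc X z)) ` \<Omega>)" if z: "z \<in> sphere 0 1" for z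
  proof (rule bdd_aboveI2)
    fix X assume X: "X \<in> \<Omega>"
    have h: "X \<in> hyp" "X0 \<in> hyp" using X X0 sub by auto
    have nz: "norm z \<le> 1" using z by simp
    have "- mink X X0 \<le> cosh r"
      using r[OF X X0] cosh_hdist[OF h] cosh_real_nonneg_le_iff[of "hdist X X0" r] by simp
    then have "lc X z / lc X0 z + lc X0 z / lc X z \<le> 2 * cosh r"
      using lc_ratio_bound[OF h nz] by linarith
    moreover have "0 \<le> lc X0 z / lc X z" using lc_pos[OF h(1) nz] lc_pos[OF h(2) nz] by simp
    ultimately have "lc X z / lc X0 z \<le> 2 * cosh r" by linarith
    then have "lc X z \<le> 2 * cosh r * lc X0 z" using lc_pos[OF h(2) nz] by (simp add: divide_le_eq)
    then show "ln (lc X z) \<le> ln (2 * cosh r * lc X0 z)" using lc_pos[OF h(1) nz] by simp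
  qed
  then have "ln (lc X z) \<le> horo_support \<Omega> z" if "X \<in> \<Omega>" "z \<in> sphere 0 1" for X z
    unfolding horo_support_lc using that by (intro cSUP_upper)
  then have "\<Omega> \<subseteq> ?R" using sub by blast
  moreover have "?R \<subseteq> \<Omega>"
  proof
    fix X assume X: "X \<in> ?R"
    have "X \<in> closed_horoball z s" if zs: "(z, s) \<in> F" for z s
    proof -
      have z: "z \<in> sphere 0 1" using zs F by auto
      have "\<Omega> \<subseteq> closed_horoball z s" using zs eq by blast
      then have "horo_support \<Omega> z \<le> s"
        unfolding horo_support_lc using ne z by (intro cSUP_least) (auto simp: closed_horoball_iff)
      moreover have "ln (lc X z) \<le> horo_support \<Omega> z" "X \<in> hyp" using X z by auto
      ultimately show ?thesis using z by (simp add: closed_horoball_iff)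
    qed
    then show "X \<in> \<Omega>" unfolding eq using X by auto
  qed
  ultimately show ?thesis by blast
qed

lemma h_convex_bounded_domain_unique:
  assumes "h_convex_bounded_domain \<Omega>" "h_convex_bounded_domain \<Omega>'"
    and "\<And>z. z \<in> sphere 0 1 \<Longrightarrow> horo_support \<Omega> z = horo_support \<Omega>' z"
  shows "\<Omega> = \<Omega>'"
proof -
  have "{X\<in>hyp. \<forall>z\<in>sphere 0 1. ln (lc X z) \<le> horo_support \<Omega> z}
      = {X\<in>hyp. \<forall>z\<in>sphere 0 1. ln (lc X z) \<le> horo_support \<Omega>' z}"
    using assms(3) by (intro Collect_cong) simp
  then show ?thesis
    unfolding h_convex_bounded_domain_eq[OF assms(1), symmetric] h_convex_bounded_domain_eq[OF assms(2), symmetric] .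
qed

lemma compact_max_lc:
  assumes "compact K" "K \<noteq> {}"
  shows "\<exists>k. \<forall>z. k z \<in> K \<and> (\<forall>Y\<in>K. lc Y z \<le> lc (k z) z)"
proof (intro choice allI)
  fix z
  have "continuous_on K (\<lambda>X. lc X z)" by (intro continuous_intros)
  from continuous_attains_sup[OF assms this] show "\<exists>X. X \<in> K \<and> (\<forall>Y\<in>K. lc Y z \<le> lc X z)" by blast
qed

context psum
begin

lemma pl_mono:
  assumes "X \<in> hyp" "Y \<in> hyp" "norm z \<le> 1" "lc X z \<le> lc X' z" "lc Y z \<le> lc Y' z"
  shows "pl X Y z \<le> pl X' Y' z"
  unfolding pl_def using assms ab p0 lc_pos[OF assms(1,3)] lc_pos[OF assms(2,3)] by (intro pmean_mono) auto

text \<open>\<open>W\<close> is the tangent vector dropped onto the hyperboloid along the null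
  direction of \<open>z\<close>, which keeps its value at \<open>z\<close>. That it stays below
  \<open>pl X Y\<close> elsewhere is \<open>contact_concave\<close> with \<open>c = 1\<close> if
  \<open>p <= 1\<close>, and \<open>tvec_le\<close> otherwise.\<close>

lemma pset_support_point:
  fixes K L :: "'m::finite minkowski set"
  assumes KL: "X \<in> K" "Y \<in> L" "X \<in> hyp" "Y \<in> hyp" and z: "z \<in> sphere 0 1"
  shows "\<exists>W\<in>pset K L. lc W z = pl X Y z"
proof -
  have nz: "norm z \<le> 1" using z by simp
  define T where "T = tvec X Y z"
  define l where "l = (- mink T T - 1) / (2 * lc T z)"
  define W where "W = T - l *\<^sub>R nullv z"
  note H = hyp_from_above[OF mink_tvec[OF KL(3,4) nz] snd_tvec[OF KL(3,4) nz] z, folded T_def, folded l_def, folded W_def]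
  have lcW: "lc W u = lc T u - l * (1 - z \<bullet> u)" for u by (simp add: W_def lc_diff lc_scaleR lc_nullv)
  have Wz: "lc W z = pl X Y z" unfolding lcW T_def using lc_tvec_self[OF KL(3,4) nz] z by (simp add: dot_square_norm)
  have WT: "lc W u \<le> lc T u" if "u \<in> sphere 0 1" for u
    unfolding lcW using H(2) inner_le_one[of z u] that nz by simp
  have "lc W u \<le> pl X Y u" if u: "u \<in> sphere 0 1" for u
  proof (cases "p \<le> 1")
    case True
    have "1 * lc W u \<le> pl X Y u"
      by (rule contact_concave(1)[OF KL(3,4) H(1) _ _ True z _ _ u]) (use Wz WT T_def in auto)
    then show ?thesis by simp
  next
    case False
    then have "lc T u \<le> pl X Y u" unfolding T_def using tvec_le[OF KL(3,4) nz] u by simp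
    then show ?thesis using WT[OF u] by simp
  qed
  then have "W \<in> pset K L" using H(1) KL(1,2) unfolding pset_def by blast
  then show ?thesis using Wz by blast
qed

theorem h_p_sum_eq:
  fixes K L :: "'m::finite minkowski set"
  assumes K: "compact K" "K \<noteq> {}" "K \<subseteq> hyp" and L: "compact L" "L \<noteq> {}" "L \<subseteq> hyp"
  shows "h_p_sum p a K b L = pset K L"
proof -
  obtain k l where k: "\<And>z. k z \<in> K" "\<And>z Y. Y \<in> K \<Longrightarrow> lc Y z \<le> lc (k z) z"
    and l: "\<And>z. l z \<in> L" "\<And>z Y. Y \<in> L \<Longrightarrow> lc Y z \<le> lc (l z) z"
    using compact_max_lc[OF K(1,2)] compact_max_lc[OF L(1,2)] by blast
  have kh: "k z \<in> hyp" and lh: "l z \<in> hyp" for z using k(1)[of z] l(1)[of z] K(3) L(3) by blast+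
  define P where "P z = pl (k z) (l z) z" for z
  have Ppos: "0 < P z" if "z \<in> sphere 0 1" for z unfolding P_def using kh lh that by (intro pl_pos) auto
  have pset: "pset K L = {W\<in>hyp. \<forall>z\<in>sphere 0 1. lc W z \<le> P z}"
  proof -
    have "(\<exists>X\<in>K. \<exists>Y\<in>L. lc W z \<le> pl X Y z) \<longleftrightarrow> lc W z \<le> P z" if z: "z \<in> sphere 0 1" for W z
    proof
      assume "\<exists>X\<in>K. \<exists>Y\<in>L. lc W z \<le> pl X Y z"
      then obtain X Y where XY: "X \<in> K" "Y \<in> L" "lc W z \<le> pl X Y z" by blast
      have "pl X Y z \<le> P z" unfolding P_def using XY K(3) L(3) z k l by (intro pl_mono) auto
      then show "lc W z \<le> P z" using XY(3) by simp
    next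
      assume "lc W z \<le> P z"
      then show "\<exists>X\<in>K. \<exists>Y\<in>L. lc W z \<le> pl X Y z" unfolding P_def using k l by blast
    qed
    then show ?thesis by (auto simp: pset_def)
  qed
  have supp: "horo_support (pset K L) z
      = (1 / p) * ln (a * exp (p * horo_support K z) + b * exp (p * horo_support L z))"
    if z: "z \<in> sphere 0 1" for z
  proof -
    obtain W where W: "W \<in> pset K L" "lc W z = P z"
      using pset_support_point[OF k(1) l(1) kh lh z, of z z] unfolding P_def by blast
    have pos: "0 < lc (k z) z" "0 < lc (l z) z" using kh lh z by (simp_all add: lc_pos)
    have hK: "horo_support K z = ln (lc (k z) z)" using k K(3) z by (intro horo_support_max) auto
    have hL: "horo_support L z = ln (lc (l z) z)" using l L(3) z by (intro horo_support_max) auto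
    have "horo_support (pset K L) z = ln (lc W z)"
      by (rule horo_support_max) (use W z pset in auto)
    also have "\<dots> = ln (P z)" using W by simp
    also have "\<dots> = (1 / p) * ln (a * lc (k z) z powr p + b * lc (l z) z powr p)"
      unfolding P_def pl_def pmean_def using pmean_arg_pos[OF ab ab0 pos, of p] by (subst ln_powr) auto
    also have "\<dots> = (1 / p) * ln (a * exp (p * horo_support K z) + b * exp (p * horo_support L z))"
      unfolding hK hL using pos by (simp add: powr_def)
    finally show ?thesis .
  qed
  have dom: "h_convex_bounded_domain (pset K L)"
    unfolding h_convex_bounded_domain_def
  proof (intro conjI)
    obtain z0 :: "real ^ 'm" where z0: "norm z0 = 1" using vector_choose_size[of 1] by auto
    then show "pset K L \<noteq> {}" using pset_support_point[OF k(1) l(1) kh lh, of z0] by force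
    show "\<exists>F. F \<subseteq> sphere 0 1 \<times> UNIV \<and> pset K L = hyp \<inter> (\<Inter>(z, s)\<in>F. closed_horoball z s)"
    proof (intro exI conjI)
      show "{(z, ln (P z)) |z. z \<in> sphere 0 1} \<subseteq> sphere 0 1 \<times> UNIV" by auto
      have "lc W z \<le> P z \<longleftrightarrow> W \<in> closed_horoball z (ln (P z))" if "z \<in> sphere 0 1" "W \<in> hyp" for W z
        using that Ppos[OF that(1)] lc_pos[OF that(2), of z] by (simp add: closed_horoball_iff)
      then show "pset K L = hyp \<inter> (\<Inter>(z, s)\<in>{(z, ln (P z)) |z. z \<in> sphere 0 1}. closed_horoball z s)"
        unfolding pset by auto
    qed
    define B where "B = K \<times> L \<times> sphere (0 :: real ^ 'm) 1"
    have B1: "compact B" unfolding B_def using K L by (intro compact_Times compact_sphere)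
    obtain x0 y0 where "x0 \<in> K" "y0 \<in> L" using K(2) L(2) by blast
    then have "(x0, y0, z0) \<in> B" unfolding B_def using z0 by simp
    then have B2: "B \<noteq> {}" by blast
    have "continuous_on B (\<lambda>t. pl (fst t) (fst (snd t)) (snd (snd t)))"
      using K(3) L(3) by (intro continuous_on_pl continuous_intros) (auto simp: B_def)
    from continuous_attains_sup[OF B1 B2 this] obtain t where "t \<in> B" and t: "\<forall>s\<in>B. pl (fst s) (fst (snd s)) (snd (snd s)) \<le> pl (fst t) (fst (snd t)) (snd (snd t))"
      by blast
    define M where "M = pl (fst t) (fst (snd t)) (snd (snd t))"
    have PM: "P z \<le> M" if "z \<in> sphere 0 1" for z
      using t[rule_format, of "(k z, l z, z)"] k(1) l(1) that by (simp add: B_def P_def M_def)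
    have sM: "snd W \<le> M" if W: "W \<in> pset K L" for W
    proof -
      have "lc W z \<le> M" if "z \<in> sphere 0 1" for z
        using W PM[OF that] that unfolding pset by force
      \<comment> \<open>\<open>snd W\<close> is the average of \<open>lc W\<close> over two
        antipodal directions.\<close>
      then have "lc W z0 \<le> M" "lc W (- z0) \<le> M" using z0 by simp_all
      then show ?thesis by (simp add: lc_def)
    qed
    have "hdist X Y \<le> arcosh (max 1 (2 * M\<^sup>2))" if XY: "X \<in> pset K L" "Y \<in> pset K L" for X Y
    proof -
      have h: "X \<in> hyp" "Y \<in> hyp" using XY by (auto simp: pset_def)
      have "- (fst X \<bullet> fst Y) \<le> norm (fst X) * norm (fst Y)"
        using Cauchy_Schwarz_ineq2[of "fst X" "fst Y"] by linarith
      also have "\<dots> \<le> snd X * snd Y"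
        using hyp_norm_less[OF h(1)] hyp_norm_less[OF h(2)] hypD(2)[OF h(1)] by (intro mult_mono) auto
      finally have "- mink X Y \<le> 2 * (snd X * snd Y)" by (simp add: mink_def)
      also have "\<dots> \<le> 2 * (M * M)"
        using sM[OF XY(1)] sM[OF XY(2)] hypD(2)[OF h(1)] hypD(2)[OF h(2)]
        by (intro mult_left_mono mult_mono) auto
      finally have "cosh (hdist X Y) \<le> cosh (arcosh (max 1 (2 * M\<^sup>2)))"
        using cosh_hdist(1)[OF h] by (simp add: power2_eq_square)
      then show ?thesis using cosh_hdist(2)[OF h] by (subst (asm) cosh_real_nonneg_le_iff) auto
    qed
    then show "\<exists>r. \<forall>X\<in>pset K L. \<forall>Y\<in>pset K L. hdist X Y \<le> r" by blast
  qed
  show ?thesis unfolding h_p_sum_def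
  proof (rule the_equality)
    fix \<Omega> assume O: "h_convex_bounded_domain \<Omega> \<and> (\<forall>z\<in>sphere 0 1. horo_support \<Omega> z =
        1 / p * ln (a * exp (p * horo_support K z) + b * exp (p * horo_support L z)))"
    then show "\<Omega> = pset K L" using dom supp by (intro h_convex_bounded_domain_unique) auto
  qed (use dom supp in blast)
qed

end

section \<open>The ball-wise sum\<close>

lemma mink_cone_nonpos:
  assumes "norm (fst T) \<le> snd T" "norm (fst N) \<le> snd N"
  shows "mink T N \<le> 0"
proof -
  have "fst T \<bullet> fst N \<le> norm (fst T) * norm (fst N)" by (rule norm_cauchy_schwarz)
  also have "\<dots> \<le> snd T * snd N" using assms order_trans[OF norm_ge_zero assms(1)] by (intro mult_mono) auto
  finally show ?thesis by (simp add: mink_def)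
qed

lemma mink_cone_neg:
  assumes "norm (fst T) < snd T" "norm (fst N) \<le> snd N" "snd N > 0"
  shows "mink T N < 0"
proof -
  have "fst T \<bullet> fst N \<le> norm (fst T) * norm (fst N)" by (rule norm_cauchy_schwarz)
  also have "\<dots> \<le> norm (fst T) * snd N" using assms by (intro mult_left_mono) auto
  also have "\<dots> < snd T * snd N" using assms by (intro mult_strict_right_mono) auto
  finally show ?thesis by (simp add: mink_def)
qed

lemma hdist_eq_zero: "X \<in> hyp \<Longrightarrow> Y \<in> hyp \<Longrightarrow> hdist X Y = 0 \<Longrightarrow> X = Y"
  using cosh_hdist(1)[of X Y] by (intro hyp_eqI) auto

lemma hsegment_unique:
  assumes X: "X \<in> hyp" and Y: "Y \<in> hyp" and P: "P \<in> hsegment X Y" and Q: "Q \<in> hsegment X Y"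
    and eq: "hdist X P = hdist X Q"
  shows "P = Q"
proof -
  have main: "P = (1 / sinh (hdist X Y)) *\<^sub>R (sinh (hdist X Y - hdist X P) *\<^sub>R X + sinh (hdist X P) *\<^sub>R Y)"
    if d: "hdist X Y > 0" and P: "P \<in> hsegment X Y" for P
  proof -
    define d r where "d = hdist X Y" and "r = hdist X P"
    have Ph: "P \<in> hyp" and s: "hdist P Y = d - r" using P by (auto simp: hsegment_def d_def r_def)
    have r0: "0 \<le> r" "0 \<le> d - r" using cosh_hdist(2)[OF X Ph] cosh_hdist(2)[OF Ph Y] s by (auto simp: r_def)
    have S: "sinh d > 0" using d by (simp add: d_def)
    have XY: "mink X Y = - cosh d" "mink Y X = - cosh d"
      using cosh_hdist(1)[OF X Y] mink_commute[of X Y] by (auto simp: d_def)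
    have PX: "mink P X = - cosh r" "mink P Y = - cosh (d - r)"
      using cosh_hdist(1)[OF X Ph] cosh_hdist(1)[OF Ph Y] mink_commute[of X P] s by (auto simp: r_def)
    \<comment> \<open>The point at distance \<open>r\<close> from \<open>X\<close> on the geodesic
      to \<open>Y\<close>. Its products with \<open>X\<close> and \<open>Y\<close> are those of
      \<open>P\<close>, hence \<open>mink P Z = -1\<close> and the two points agree.\<close>
    define Z where "Z = (1 / sinh d) *\<^sub>R (sinh (d - r) *\<^sub>R X + sinh r *\<^sub>R Y)"
    have a: "sinh (d - r) + sinh r * cosh d = sinh d * cosh r" by (simp add: sinh_diff)
    have "sinh r = sinh (d - (d - r))" by simp
    then have b: "sinh (d - r) * cosh d + sinh r = sinh d * cosh (d - r)"
      by (metis sinh_diff add.commute add_diff_cancel_left' diff_add_cancel mult.commute)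
    have c: "sinh (d - r) * cosh r + sinh r * cosh (d - r) = sinh d"
      using sinh_add[of "d - r" r] by (simp add: mult.commute)
    have "sinh d * mink Z X = - (sinh (d - r) + sinh r * cosh d)"
      using hypD(1)[OF X] S by (simp add: Z_def mink_simps XY)
    then have "sinh d * mink Z X = sinh d * (- cosh r)" unfolding a by simp
    then have ZX: "mink Z X = - cosh r" using S by (simp only: mult_cancel_left) simp
    have "sinh d * mink Z Y = - (sinh (d - r) * cosh d + sinh r)"
      using hypD(1)[OF Y] S by (simp add: Z_def mink_simps XY)
    then have "sinh d * mink Z Y = sinh d * (- cosh (d - r))" unfolding b by simp
    then have ZY: "mink Z Y = - cosh (d - r)" using S by (simp only: mult_cancel_left) simp
    have "mink Z Z = (sinh (d - r) * mink Z X + sinh r * mink Z Y) / sinh d"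
      by (subst (2) Z_def) (simp add: mink_simps)
    also have "\<dots> = - (sinh (d - r) * cosh r + sinh r * cosh (d - r)) / sinh d"
      by (simp add: ZX ZY)
    finally have ZZ: "mink Z Z = -1" unfolding c using S by simp
    have "mink P Z = (sinh (d - r) * mink P X + sinh r * mink P Y) / sinh d"
      by (simp add: Z_def mink_simps)
    also have "\<dots> = - (sinh (d - r) * cosh r + sinh r * cosh (d - r)) / sinh d"
      by (simp add: PX)
    finally have PZ: "mink P Z = -1" unfolding c using S by simp
    have "sinh (d - r) * snd X + sinh r * snd Y > 0"
      using r0 S hypD(2)[OF X] hypD(2)[OF Y]
      by (cases "r = 0") (auto intro!: add_nonneg_pos)
    then have "snd Z > 0" using S by (simp add: Z_def)
    then have "P = Z" using ZZ PZ Ph by (intro hyp_eqI) (auto simp: hyp_def)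
    then show ?thesis by (simp add: Z_def d_def r_def)
  qed
  have Ph: "P \<in> hyp" "Q \<in> hyp" using P Q by (auto simp: hsegment_def)
  show ?thesis
  proof (cases "hdist X Y > 0")
    case True
    show ?thesis using main[OF True P] main[OF True Q] eq by simp
  next
    case False
    then have "hdist X P \<le> 0" "hdist X Q \<le> 0"
      using P cosh_hdist(2)[OF Ph(1) Y] eq by (auto simp: hsegment_def)
    then show ?thesis
      using hdist_eq_zero[OF X Ph(1)] hdist_eq_zero[OF X Ph(2)] cosh_hdist(2)[OF X Ph(1)] cosh_hdist(2)[OF X Ph(2)]
      by simp
  qed
qed

text \<open>For \<open>R >= 1\<close>, \<open>T\<close> is \<open>R\<close> times a point
  \<open>P\<close> of the hyperboloid, and the square of \<open>T - W\<close> is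
  \<open>- R^2 - 1 + 2 * R * cosh (hdist P W)\<close>, which is nonpositive exactly when
  \<open>cosh (hdist P W) <= cosh (ln R)\<close>. For \<open>R < 1\<close> no point of the
  hyperboloid lies in the causal past of \<open>T\<close>.\<close>

lemma cone_ball:
  fixes X Y :: "'m::finite minkowski"
  assumes X: "X \<in> hyp" and Y: "Y \<in> hyp" and al: "0 \<le> \<alpha>" and be: "0 \<le> \<beta>"
  defines "T \<equiv> \<alpha> *\<^sub>R X + \<beta> *\<^sub>R Y"
    and "R \<equiv> sqrt (\<alpha>\<^sup>2 + \<beta>\<^sup>2 + 2 * \<alpha> * \<beta> * cosh (hdist X Y))"
  shows "(if R \<ge> 1 then hcball (THE P. P \<in> hsegment X Y \<and>
            cosh (hdist P X) = (\<alpha> + \<beta> * cosh (hdist X Y)) / R) (ln R) else {})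
       = {W\<in>hyp. norm (fst (T - W)) \<le> snd (T - W)}"
proof -
  define C where "C = cosh (hdist X Y)"
  have C: "C = - mink X Y" "1 \<le> C" using cosh_hdist(1)[OF X Y] minus_mink_ge_one[OF X Y] by (auto simp: C_def)
  have R2: "R\<^sup>2 = \<alpha>\<^sup>2 + \<beta>\<^sup>2 + 2 * \<alpha> * \<beta> * C" unfolding R_def C_def[symmetric] using al be C(2) by simp
  have R0: "0 \<le> R" unfolding R_def C_def[symmetric] using al be C(2) by simp
  have TT: "mink T T = - R\<^sup>2" unfolding T_def mink_comb[OF X Y] R2 by (simp add: C(1))
  have sT: "0 \<le> snd T" using al be hypD(2)[OF X] hypD(2)[OF Y] by (simp add: T_def)
  show ?thesis
  proof (cases "R \<ge> 1")
    case False
    have "\<not> norm (fst (T - W)) \<le> snd (T - W)" if W: "W \<in> hyp" for W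
    proof
      assume N: "norm (fst (T - W)) \<le> snd (T - W)"
      have "mink T T = mink W W + 2 * mink W (T - W) + mink (T - W) (T - W)"
        using mink_commute[of T W] by (simp add: mink_simps)
      also have "\<dots> \<le> -1"
        using hypD(1)[OF W] mink_cone_nonpos[OF less_imp_le[OF hyp_norm_less[OF W]] N] mink_cone_nonpos[OF N N] by simp
      finally have "1\<^sup>2 \<le> R\<^sup>2" unfolding TT by simp
      then show False using False R0 power2_le_imp_le[of 1 R] by simp
    qed
    then show ?thesis using False by auto
  next
    case True
    then have Rp: "R > 0" by simp
    define P where "P = (1 / R) *\<^sub>R T"
    have "T \<noteq> 0" using TT Rp by (auto simp: mink_zero_left)
    have "snd T > 0"
    proof -
      have "(norm (fst T))\<^sup>2 < (snd T)\<^sup>2" using TT Rp mink_le_norm[of T] by (smt (verit) zero_less_power)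
      then have "snd T \<noteq> 0" by auto
      then show ?thesis using sT by simp
    qed
    have Ph: "P \<in> hyp" using TT Rp \<open>snd T > 0\<close> by (simp add: hyp_def P_def mink_simps power2_eq_square)
    have TP: "T = R *\<^sub>R P" using Rp by (simp add: P_def)
    define S where "S = sinh (hdist X Y)"
    have S: "0 \<le> S" "S\<^sup>2 = C\<^sup>2 - 1" using cosh_hdist(2)[OF X Y] by (auto simp: S_def C_def sinh_square_eq)
    \<comment> \<open>Stated with weights \<open>s\<close>, \<open>r\<close> so that it covers both
      end points, with the coefficients exchanged for \<open>Y\<close>.\<close>
    have dist: "cosh (hdist Z P) = (s + r * C) / R" "sinh (hdist Z P) = r * S / R"
      if Z: "Z \<in> hyp" and ZT: "mink Z T = - (s + r * C)" and sr: "0 \<le> r" "R\<^sup>2 = s\<^sup>2 + r\<^sup>2 + 2 * s * r * C" for Z s r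
    proof -
      show c: "cosh (hdist Z P) = (s + r * C) / R"
        using cosh_hdist(1)[OF Z Ph] unfolding P_def mink_simps ZT by (simp only: mult_minus_right minus_minus) simp
      show "sinh (hdist Z P) = r * S / R"
      proof (rule power2_eq_imp_eq)
        have "(sinh (hdist Z P))\<^sup>2 = ((s + r * C)\<^sup>2 - R\<^sup>2) / R\<^sup>2"
          using Rp by (simp add: sinh_square_eq c power_divide diff_divide_distrib)
        also have "(s + r * C)\<^sup>2 - R\<^sup>2 = r\<^sup>2 * S\<^sup>2" unfolding sr(2) S by (simp add: power2_eq_square algebra_simps)
        finally show "(sinh (hdist Z P))\<^sup>2 = (r * S / R)\<^sup>2" by (simp add: power_divide power_mult_distrib)
      qed (use cosh_hdist(2)[OF Z Ph] sr(1) S Rp in auto)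
    qed
    have "mink X T = - (\<alpha> + \<beta> * C)" using hypD(1)[OF X] by (simp add: T_def mink_simps C)
    note PX = dist[OF X this be R2]
    have "mink Y T = - (\<beta> + \<alpha> * C)" using hypD(1)[OF Y] mink_commute[of X Y] by (simp add: T_def mink_simps C)
    from dist[OF Y this al] have PY: "cosh (hdist P Y) = (\<beta> + \<alpha> * C) / R" "sinh (hdist P Y) = \<alpha> * S / R"
      by (simp_all add: hdist_commute[of P Y] R2)
    have "cosh (hdist X P + hdist P Y) = ((\<alpha> + \<beta> * C) * (\<beta> + \<alpha> * C) + \<alpha> * \<beta> * S\<^sup>2) / R\<^sup>2"
      unfolding cosh_add PX PY by (simp add: power2_eq_square add_divide_distrib algebra_simps)
    also have "(\<alpha> + \<beta> * C) * (\<beta> + \<alpha> * C) + \<alpha> * \<beta> * S\<^sup>2 = C * R\<^sup>2"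
      unfolding R2 S by (simp add: power2_eq_square algebra_simps)
    also have "C * R\<^sup>2 / R\<^sup>2 = cosh (hdist X Y)" using Rp by (simp add: C_def)
    finally have "hdist X P + hdist P Y = hdist X Y"
      using cosh_hdist(2)[OF X Ph] cosh_hdist(2)[OF Ph Y] cosh_hdist(2)[OF X Y] by simp
    then have Pseg: "P \<in> hsegment X Y" using Ph by (simp add: hsegment_def)
    have the: "(THE P. P \<in> hsegment X Y \<and> cosh (hdist P X) = (\<alpha> + \<beta> * cosh (hdist X Y)) / R) = P"
    proof (rule the_equality)
      show "P \<in> hsegment X Y \<and> cosh (hdist P X) = (\<alpha> + \<beta> * cosh (hdist X Y)) / R"
        using Pseg PX(1) by (simp add: hdist_commute[of P X] C_def)
      fix Q assume Q: "Q \<in> hsegment X Y \<and> cosh (hdist Q X) = (\<alpha> + \<beta> * cosh (hdist X Y)) / R"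
      then have Qh: "Q \<in> hyp" by (simp add: hsegment_def)
      have "cosh (hdist X Q) = cosh (hdist X P)" using Q PX(1) by (simp add: hdist_commute[of Q X] C_def)
      then have "hdist X Q = hdist X P" using cosh_hdist(2)[OF X Ph] cosh_hdist(2)[OF X Qh] by simp
      then show "Q = P" using hsegment_unique[OF X Y] Q Pseg by blast
    qed
    have "hdist P W \<le> ln R \<longleftrightarrow> norm (fst (T - W)) \<le> snd (T - W)" if W: "W \<in> hyp" for W
    proof -
      define N where "N = T - W"
      have PW: "cosh (hdist P W) = - mink P W" using cosh_hdist(1)[OF Ph W] .
      have NN: "mink N N = - R\<^sup>2 - 1 + 2 * R * cosh (hdist P W)"
      proof -
        have TW: "mink T W = R * mink P W" by (subst TP) (simp add: mink_simps)
        show ?thesis unfolding N_def PW using hypD(1)[OF W] TT TW mink_commute[of W T] by (simp add: mink_simps)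
      qed
      have "hdist P W \<le> ln R \<longleftrightarrow> cosh (hdist P W) \<le> cosh (ln R)"
        using True cosh_hdist(2)[OF Ph W] by (simp add: cosh_real_nonneg_le_iff)
      also have "\<dots> \<longleftrightarrow> 2 * R * cosh (hdist P W) \<le> R\<^sup>2 + 1"
        using Rp by (simp add: cosh_ln_real field_simps power2_eq_square)
      also have "\<dots> \<longleftrightarrow> mink N N \<le> 0" unfolding NN by auto
      also have "\<dots> \<longleftrightarrow> norm (fst N) \<le> \<bar>snd N\<bar>"
        unfolding mink_le_norm using abs_le_square_iff[of "norm (fst N)" "snd N"] by simp
      \<comment> \<open>If \<open>T - W\<close> were past-directed, \<open>W\<close> would be
        \<open>T\<close> plus a future causal vector, with square below \<open>- R^2\<close>; on
        \<open>hyp\<close> this is excluded by \<open>R >= 1\<close>.\<close>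
      also have "\<dots> \<longleftrightarrow> norm (fst N) \<le> snd N"
      proof
        assume le: "norm (fst N) \<le> \<bar>snd N\<bar>"
        show "norm (fst N) \<le> snd N"
        proof (rule ccontr)
          assume "\<not> ?thesis"
          then have neg: "snd N < 0" using le by simp
          have M: "norm (fst (- N)) \<le> snd (- N)" "snd (- N) > 0" using le neg by auto
          have "mink W W = mink T T + 2 * mink T (- N) + mink (- N) (- N)"
            using mink_commute[of T W] by (simp add: N_def mink_simps)
          also have "\<dots> < - R\<^sup>2"
            using TT mink_cone_nonpos[OF M(1) M(1)] mink_cone_neg[OF norm_less_snd M, of T] \<open>snd T > 0\<close> Rp by simp
          also have "\<dots> \<le> -1" using True by simp
          finally show False using hypD(1)[OF W] by simp
        qed
      qed (use abs_ge_self order_trans in blast)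
      finally show ?thesis by (simp add: N_def)
    qed
    then show ?thesis using True unfolding the hcball_def by auto
  qed
qed

lemma powr_twice: "(x::real) powr (2 / c) = (x powr (1 / c))\<^sup>2"
  by (simp add: power2_eq_square flip: powr_add)

lemma bw_ball_eq:
  assumes "X \<in> hyp" "Y \<in> hyp" "p \<noteq> 1"
  shows "bw_ball p t a X b Y = {W\<in>hyp. lc_admissible p t a X b Y W}"
proof -
  let ?al = "hw p (1 - t) a"
  let ?be = "hw p t b"
  have R: "bw_radius p t a X b Y = sqrt (?al\<^sup>2 + ?be\<^sup>2 + 2 * ?al * ?be * cosh (hdist X Y))"
    unfolding bw_radius_def powr_twice by (simp add: power_mult_distrib ac_simps)
  show ?thesis
    unfolding bw_ball_def bw_center_def R lc_admissible_def lc_vector_def if_not_P[OF assms(3)]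
    by (rule cone_ball[OF assms(1,2)]) auto
qed

lemma bw_ball1_eq:
  assumes "X \<in> hyp" "Y \<in> hyp" "0 \<le> a" "0 \<le> b"
  shows "bw_ball1 a X b Y = {W\<in>hyp. lc_admissible 1 t a X b Y W}"
  unfolding bw_ball1_def bw_center1_def bw_radius1_def lc_admissible_def lc_vector_def if_P[OF refl]
  by (rule cone_ball[OF assms])

theorem ball_wise_sum_eq:
  assumes K: "K \<subseteq> hyp" and L: "L \<subseteq> hyp" and "0 \<le> a" "0 \<le> b"
  shows "ball_wise_sum p a K b L = light_cone_sum p a K b L"
proof -
  have h: "X \<in> hyp" "Y \<in> hyp" if "X \<in> K" "Y \<in> L" for X Y using that K L by auto
  consider "p > 1" | "p = 1" | "p < 1" by linarith
  then show ?thesis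
  proof cases
    case 1
    then show ?thesis using h by (simp add: ball_wise_sum_def light_cone_sum_def bw_ball_eq)
  next
    case 2
    \<comment> \<open>For \<open>p = 1\<close> the light-cone vector does not depend on
      \<open>t\<close>, so the union over the nonempty range of \<open>t\<close> collapses.\<close>
    have "bw_ball1 a X b Y = (\<Union>t\<in>{0..1}. {W\<in>hyp. lc_admissible p t a X b Y W})"
      if "X \<in> K" "Y \<in> L" for X Y
    proof -
      have "{W\<in>hyp. lc_admissible p t a X b Y W} = bw_ball1 a X b Y" for t
        using bw_ball1_eq[OF h[OF that] assms(3,4)] 2 by simp
      then show ?thesis by simp
    qed
    then show ?thesis using 2 by (simp add: ball_wise_sum_def light_cone_sum_def)
  next
    case 3
    then show ?thesis using h by (simp add: ball_wise_sum_def light_cone_sum_def bw_ball_eq)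
  qed
qed

section \<open>From local to global convexity\<close>

text \<open>The pairs whose segment lies in \<open>S\<close> form a closed and open subset of the
  connected set \<open>S \<times> S\<close>. Openness: the middle part of a segment is a compact
  subset of the interior by strictness, so nearby segments stay inside there, and local convexity at
  the end points covers the rest.\<close>

theorem locally_strictly_convex_imp_convex:
  fixes S :: "'a::euclidean_space set"
  assumes "closed S" "connected S"
    and loc: "\<And>x. x \<in> S \<Longrightarrow> \<exists>r>0. convex (S \<inter> ball x r)"
    and strict: "\<And>x y. x \<in> S \<Longrightarrow> y \<in> S \<Longrightarrow> x \<noteq> y \<Longrightarrow> closed_segment x y \<subseteq> S
      \<Longrightarrow> open_segment x y \<subseteq> interior S"
  shows "convex S"
proof -
  define A where "A = {q \<in> S \<times> S. closed_segment (fst q) (snd q) \<subseteq> S}"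
  have eqA: "A = (S \<times> S) \<inter> (\<Inter>t\<in>{0..1}. (\<lambda>q. (1 - t) *\<^sub>R fst q + t *\<^sub>R snd q) -` S)"
    by (force simp: A_def closed_segment_def)
  have "closed (\<Inter>t\<in>{0..1::real}. (\<lambda>q :: 'a \<times> 'a. (1 - t) *\<^sub>R fst q + t *\<^sub>R snd q) -` S)"
    using assms(1) by (intro closed_INT ballI closed_vimage continuous_intros)
  then have clA: "closedin (top_of_set (S \<times> S)) A"
    unfolding eqA by (rule closedin_closed_Int)
  have opA: "openin (top_of_set (S \<times> S)) A"
    unfolding openin_euclidean_subtopology_iff
  proof (intro conjI ballI)
    show "A \<subseteq> S \<times> S" by (auto simp: A_def)
    fix q assume q: "q \<in> A"
    obtain x y where xy: "q = (x, y)" by (cases q)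
    have xS: "x \<in> S" and yS: "y \<in> S" and seg: "closed_segment x y \<subseteq> S"
      using q by (auto simp: A_def xy)
    have "\<exists>e>0. \<forall>x'\<in>S. \<forall>y'\<in>S. dist x' x < e \<longrightarrow> dist y' y < e \<longrightarrow> closed_segment x' y' \<subseteq> S"
    proof (cases "x = y")
      case True
      obtain r where r: "r > 0" "convex (S \<inter> ball x r)" using loc[OF xS] by blast
      have "closed_segment x' y' \<subseteq> S" if "x' \<in> S" "y' \<in> S" "dist x' x < r" "dist y' y < r" for x' y'
      proof -
        have "x' \<in> S \<inter> ball x r" "y' \<in> S \<inter> ball x r" using that True by (simp_all add: dist_commute)
        then have "closed_segment x' y' \<subseteq> S \<inter> ball x r" using r(2) by (rule closed_segment_subset)
        then show ?thesis by blast
      qed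
      then show ?thesis using r(1) by blast
    next
      case False
      obtain r1 where r1: "r1 > 0" "convex (S \<inter> ball x r1)" using loc[OF xS] by blast
      obtain r2 where r2: "r2 > 0" "convex (S \<inter> ball y r2)" using loc[OF yS] by blast
      define d where "d = dist x y"
      have d: "d > 0" using False by (simp add: d_def)
      \<comment> \<open>The cut points lie within half of each radius from the end points; the bound
        1/3 keeps \<open>t\<close> below \<open>1 - t\<close>.\<close>
      define t where "t = min (1/3) (min (r1 / (2 * d)) (r2 / (2 * d)))"
      have t: "0 < t" "t \<le> 1/3" using r1 r2 d by (auto simp: t_def)
      have td: "t * d < r1" "t * d < r2"
      proof -
        have "t * d \<le> r1 / (2 * d) * d" "t * d \<le> r2 / (2 * d) * d"
          using d by (intro mult_right_mono; simp add: t_def)+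
        then show "t * d < r1" "t * d < r2" using d r1(1) r2(1) by auto
      qed
      define g where "g x' y' s = (1 - s) *\<^sub>R x' + s *\<^sub>R y'" for x' y' :: 'a and s :: real
      have gd: "dist (g x' y' s) (g x y s) < e"
        if "0 \<le> s" "s \<le> 1" "dist x' x < e" "dist y' y < e" for x' y' s e
      proof -
        have "g x' y' s - g x y s = (1 - s) *\<^sub>R (x' - x) + s *\<^sub>R (y' - y)"
          by (simp add: g_def algebra_simps)
        then have "dist (g x' y' s) (g x y s) \<le> (1 - s) * dist x' x + s * dist y' y"
          using norm_triangle_ineq[of "(1 - s) *\<^sub>R (x' - x)" "s *\<^sub>R (y' - y)"] that
          by (simp add: dist_norm)
        also have "\<dots> < e"
          using convex_bound_lt[of "dist x' x" e "dist y' y" "1 - s" s] that by simp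
        finally show ?thesis .
      qed
      define C where "C = g x y ` {t..1 - t}"
      have "compact C" unfolding C_def g_def by (intro compact_continuous_image continuous_intros compact_Icc)
      moreover have "C \<subseteq> interior S"
      proof -
        have "C \<subseteq> open_segment x y"
        proof
          fix w assume "w \<in> C"
          then obtain s where "t \<le> s" "s \<le> 1 - t" "w = (1 - s) *\<^sub>R x + s *\<^sub>R y"
            by (auto simp: C_def g_def)
          then show "w \<in> open_segment x y" unfolding in_segment(2) using False t
            by (intro conjI exI[of _ s]) auto
        qed
        then show ?thesis using strict[OF xS yS False seg] by blast
      qed
      ultimately obtain e0 where e0: "e0 > 0" "(\<Union>c\<in>C. ball c e0) \<subseteq> interior S"
        by (rule compact_subset_open_imp_ball_epsilon_subset[OF _ open_interior])
      define e where "e = min e0 (min (r1 - t * d) (r2 - t * d))"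
      have e: "e > 0" using e0 td by (simp add: e_def)
      have "closed_segment x' y' \<subseteq> S"
        if x': "x' \<in> S" "dist x' x < e" and y': "y' \<in> S" "dist y' y < e" for x' y'
      proof -
        have mid: "g x' y' s \<in> S" if s: "t \<le> s" "s \<le> 1 - t" for s
        proof -
          have "dist (g x' y' s) (g x y s) < e" using gd x'(2) y'(2) s t by simp
          then have "g x' y' s \<in> ball (g x y s) e0" by (simp add: e_def dist_commute)
          moreover have "g x y s \<in> C" using s by (simp add: C_def)
          ultimately have "g x' y' s \<in> (\<Union>c\<in>C. ball c e0)" by (rule UN_I[rotated])
          then have "g x' y' s \<in> interior S" using e0(2) by (rule subsetD[rotated])
          then show ?thesis by (rule subsetD[OF interior_subset])
        qed
        have near: "g x' y' s \<in> S \<inter> ball w r"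
          if s: "t \<le> s" "s \<le> 1 - t" and w: "dist (g x y s) w = t * d" "e \<le> r - t * d" for s w r
        proof -
          have "dist (g x' y' s) (g x y s) < e" using gd x'(2) y'(2) t s by simp
          then have "dist (g x' y' s) w < r" using dist_triangle[of "g x' y' s" w "g x y s"] w by simp
          then show ?thesis using mid[OF s] by (simp add: dist_commute)
        qed
        have "g x y t - x = t *\<^sub>R (y - x)" "g x y (1 - t) - y = t *\<^sub>R (x - y)"
          by (simp_all add: g_def algebra_simps)
        then have "dist (g x y t) x = t * d" "dist (g x y (1 - t)) y = t * d"
          using t by (simp_all add: dist_norm d_def norm_minus_commute)
        then have P: "g x' y' t \<in> S \<inter> ball x r1" and Q: "g x' y' (1 - t) \<in> S \<inter> ball y r2"
          using t by (intro near; simp add: e_def)+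
        have td0: "0 \<le> t * d" using t d by simp
        have X: "x' \<in> S \<inter> ball x r1" and Y: "y' \<in> S \<inter> ball y r2"
          using x' y' td0 by (simp_all add: e_def dist_commute)
        have "g x' y' s \<in> S" if s: "0 \<le> s" "s \<le> 1" for s
        proof -
          consider "t \<le> s \<and> s \<le> 1 - t" | "s < t" | "s > 1 - t" by linarith
          then show ?thesis
          proof cases
            case 1 then show ?thesis using mid by simp
          next
            case 2
            have "g x' y' s = (1 - s / t) *\<^sub>R x' + (s / t) *\<^sub>R g x' y' t"
              using t by (simp add: g_def scaleR_add_right algebra_simps)
            moreover have "(1 - s / t) *\<^sub>R x' + (s / t) *\<^sub>R g x' y' t \<in> S \<inter> ball x r1"
              using r1(2) X P 2 s t by (intro convexD) auto
            ultimately show ?thesis by simp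
          next
            case 3
            define w where "w = (1 - s) / t"
            have wt: "w * t = 1 - s" using t by (simp add: w_def)
            have "(1 - w) *\<^sub>R y' + w *\<^sub>R g x' y' (1 - t) = (w * t) *\<^sub>R x' + (1 - w * t) *\<^sub>R y'"
              by (simp add: g_def algebra_simps)
            then have "g x' y' s = (1 - w) *\<^sub>R y' + w *\<^sub>R g x' y' (1 - t)"
              unfolding wt by (simp add: g_def)
            moreover have "(1 - w) *\<^sub>R y' + w *\<^sub>R g x' y' (1 - t) \<in> S \<inter> ball y r2"
              using r2(2) Y Q 3 s t by (intro convexD) (auto simp: w_def)
            ultimately show ?thesis by simp
          qed
        qed
        then show ?thesis unfolding closed_segment_def g_def by blast
      qed
      then show ?thesis using e by (intro exI[of _ e] conjI ballI impI)
    qed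
    then obtain e where e: "e > 0"
      "\<forall>x'\<in>S. \<forall>y'\<in>S. dist x' x < e \<longrightarrow> dist y' y < e \<longrightarrow> closed_segment x' y' \<subseteq> S"
      by (elim exE conjE)
    have "q' \<in> A" if "q' \<in> S \<times> S" "dist q' q < e" for q'
    proof -
      have "dist (fst q') x < e" "dist (snd q') y < e"
        using that(2) dist_fst_le[of q' q] dist_snd_le[of q' q] by (auto simp: xy)
      then show ?thesis using e(2)[rule_format, of "fst q'" "snd q'"] that(1) by (simp add: A_def mem_Times_iff)
    qed
    then show "\<exists>e>0. \<forall>x'\<in>S \<times> S. dist x' q < e \<longrightarrow> x' \<in> A"
      using e(1) by (intro exI[of _ e] conjI ballI impI)
  qed
  have A: "A = {} \<or> A = S \<times> S"
    using connected_Times[OF assms(2) assms(2), unfolded connected_clopen, rule_format, of A] opA clA by simp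
  show ?thesis unfolding convex_contains_segment
  proof (intro ballI)
    fix x y assume "x \<in> S" "y \<in> S"
    moreover from this have "(x, x) \<in> A" by (simp add: A_def)
    ultimately have "(x, y) \<in> A" using A by auto
    then show "closed_segment x y \<subseteq> S" by (simp add: A_def)
  qed
qed

section \<open>Second derivatives along lines and convexity of sublevel sets\<close>

lemma second_deriv_pos_increasing:
  fixes g g1 :: "real \<Rightarrow> real"
  assumes "0 < r" and g: "\<And>s. \<bar>s - s0\<bar> < r \<Longrightarrow> (g has_real_derivative g1 s) (at s)"
    and g1: "(g1 has_real_derivative g2) (at s0)" "g1 s0 = 0" "g2 > 0"
  shows "\<exists>d>0. \<forall>h. 0 < h \<and> h < d \<longrightarrow> g s0 < g (s0 + h)"
proof -
  obtain d where d: "d > 0" "\<And>h. h > 0 \<Longrightarrow> h < d \<Longrightarrow> g1 s0 < g1 (s0 + h)"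
    using DERIV_pos_inc_right[OF g1(1,3)] by blast
  have "g s0 < g (s0 + h)" if h: "0 < h" "h < min d r" for h
  proof (rule DERIV_pos_imp_increasing_open[of s0 "s0 + h" g])
    show "s0 < s0 + h" using h by simp
    show "\<exists>y. (g has_real_derivative y) (at x) \<and> 0 < y" if "s0 < x" "x < s0 + h" for x
      using g[of x] d(2)[of "x - s0"] g1(2) that h by (intro exI[of _ "g1 x"]) auto
    have "\<And>x. x \<in> {s0..s0 + h} \<Longrightarrow> isCont g x" using g h by (intro DERIV_isCont[OF g]) auto
    then show "continuous_on {s0..s0 + h} g" by (simp add: continuous_at_imp_continuous_on)
  qed
  then show ?thesis using d(1) assms(1) by (intro exI[of _ "min d r"]) auto
qed

lemma has_real_derivative_shift:
  assumes "((\<lambda>s. F (s0 + s)) has_real_derivative d) (at 0)"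
  shows "(F has_real_derivative d) (at s0)"
  using assms DERIV_shift[of F d 0 s0] by (simp add: add.commute)

locale line_derivs =
  fixes G :: "'a::euclidean_space \<Rightarrow> real" and f1 f2 :: "'a \<Rightarrow> 'a \<Rightarrow> real" and V :: "'a set"
  assumes V: "open V"
    and f1: "\<And>u v. u \<in> V \<Longrightarrow> ((\<lambda>s. G (u + s *\<^sub>R v)) has_real_derivative f1 u v) (at 0)"
    and f2: "\<And>u v. u \<in> V \<Longrightarrow> ((\<lambda>s. f1 (u + s *\<^sub>R v) v) has_real_derivative f2 u v) (at 0)"
begin

lemma f1_at:
  assumes "u + s0 *\<^sub>R v \<in> V"
  shows "((\<lambda>s. G (u + s *\<^sub>R v)) has_real_derivative f1 (u + s0 *\<^sub>R v) v) (at s0)"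
  by (rule has_real_derivative_shift) (use f1[OF assms, of v] in \<open>simp add: algebra_simps\<close>)

lemma f2_at:
  assumes "u + s0 *\<^sub>R v \<in> V"
  shows "((\<lambda>s. f1 (u + s *\<^sub>R v) v) has_real_derivative f2 (u + s0 *\<^sub>R v) v) (at s0)"
  by (rule has_real_derivative_shift) (use f2[OF assms, of v] in \<open>simp add: algebra_simps\<close>)

lemma not_local_max:
  assumes u: "u + s0 *\<^sub>R v \<in> V" and pos: "f1 (u + s0 *\<^sub>R v) v = 0 \<Longrightarrow> f2 (u + s0 *\<^sub>R v) v > 0"
    and max: "0 < d" "\<And>s. \<bar>s - s0\<bar> < d \<Longrightarrow> G (u + s *\<^sub>R v) \<le> G (u + s0 *\<^sub>R v)"
  shows False
proof -
  let ?w = "u + s0 *\<^sub>R v"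
  have z: "f1 (?w) v = 0"
    by (rule DERIV_local_max[OF f1_at[OF u] max(1)]) (use max(2) in \<open>auto simp: abs_minus_commute\<close>)
  have "open ((\<lambda>s. u + s *\<^sub>R v) -` V)" by (intro open_vimage V continuous_intros)
  then obtain r where r: "r > 0" "ball s0 r \<subseteq> (\<lambda>s. u + s *\<^sub>R v) -` V"
    using u unfolding open_contains_ball by (metis vimageI)
  have "\<exists>e>0. \<forall>h. 0 < h \<and> h < e \<longrightarrow> G (?w) < G (u + (s0 + h) *\<^sub>R v)"
  proof (rule second_deriv_pos_increasing[OF r(1) _ f2_at[OF u] z pos[OF z]])
    fix s assume "\<bar>s - s0\<bar> < r"
    then have "s \<in> ball s0 r" by (simp add: dist_real_def abs_minus_commute)
    then show "((\<lambda>s. G (u + s *\<^sub>R v)) has_real_derivative f1 (u + s *\<^sub>R v) v) (at s)"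
      using r(2) by (intro f1_at) auto
  qed
  then obtain e where e: "e > 0" "\<And>h. 0 < h \<Longrightarrow> h < e \<Longrightarrow> G (?w) < G (u + (s0 + h) *\<^sub>R v)" by blast
  define h where "h = min e d / 2"
  have "0 < h" "h < e" "h < d" using e(1) max(1) by (auto simp: h_def)
  then show False using e(2)[of h] max(2)[of "s0 + h"] by simp
qed

text \<open>A positive maximum of \<open>G\<close> on the segment would be interior and critical,
  against the second derivative test. Positivity is asked only where \<open>f1\<close> vanishes,
  that is in directions tangent to level sets, the only ones that curvature controls.\<close>

lemma sublevel_convex:
  assumes B: "convex B" "B \<subseteq> V"
    and pos: "\<And>u v. u \<in> B \<Longrightarrow> v \<noteq> 0 \<Longrightarrow> f1 u v = 0 \<Longrightarrow> f2 u v > 0"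
  shows "convex {u\<in>B. G u \<le> 0}"
  unfolding convex_contains_segment
proof (intro ballI subsetI)
  fix x y w assume x: "x \<in> {u\<in>B. G u \<le> 0}" and y: "y \<in> {u\<in>B. G u \<le> 0}" and w: "w \<in> closed_segment x y"
  define v where "v = y - x"
  have seg: "x + s *\<^sub>R v \<in> B" if "0 \<le> s" "s \<le> 1" for s
  proof -
    have "(1 - s) *\<^sub>R x + s *\<^sub>R y \<in> B" using B(1) x y that by (intro convexD) auto
    then show ?thesis by (simp add: v_def algebra_simps)
  qed
  have "continuous_on {0..1} (\<lambda>s. G (x + s *\<^sub>R v))"
    using seg B(2) by (intro continuous_at_imp_continuous_on ballI DERIV_isCont[OF f1_at]) auto
  then obtain s0 where s0: "0 \<le> s0" "s0 \<le> 1" "\<And>s. 0 \<le> s \<Longrightarrow> s \<le> 1 \<Longrightarrow> G (x + s *\<^sub>R v) \<le> G (x + s0 *\<^sub>R v)"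
    using continuous_attains_sup[of "{0..1::real}" "\<lambda>s. G (x + s *\<^sub>R v)"] by auto
  have "G (x + s0 *\<^sub>R v) \<le> 0"
  proof (rule ccontr)
    assume neg: "\<not> ?thesis"
    have "s0 \<noteq> 0" "s0 \<noteq> 1" using neg x y by (auto simp: v_def)
    then have s01: "0 < s0" "s0 < 1" using s0 by auto
    have "v \<noteq> 0" using neg x by auto
    show False
      by (rule not_local_max[of x s0 v "min s0 (1 - s0)"])
        (use seg[of s0] B(2) pos[OF seg[of s0] \<open>v \<noteq> 0\<close>] s01 s0 in auto)
  qed
  moreover obtain s where s: "0 \<le> s" "s \<le> 1" "w = x + s *\<^sub>R v"
    using w by (auto simp: closed_segment_def v_def algebra_simps)
  ultimately show "w \<in> {u\<in>B. G u \<le> 0}" using seg[OF s(1,2)] s0(3)[OF s(1,2)] by simp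
qed

end

section \<open>Charts of the hyperboloid along a null direction\<close>

text \<open>The linear map \<open>proj z\<close> has the line spanned by \<open>nullv z\<close> as its kernel; it identifies \<open>hyp\<close> with a half
  space, with inverse \<open>emb z\<close>.  Its segments are the Euclidean segments
  of the upper half space model with \<open>z\<close> at infinity.\<close>

definition proj :: "real ^ 'm \<Rightarrow> 'm::finite minkowski \<Rightarrow> real ^ 'm" where
  "proj z X = fst X - snd X *\<^sub>R z"

definition ht :: "real ^ 'm \<Rightarrow> real ^ 'm::finite \<Rightarrow> real" where
  "ht z u = - (u \<bullet> z)"

definition emb :: "real ^ 'm \<Rightarrow> real ^ 'm::finite \<Rightarrow> 'm minkowski" where
  "emb z u = (u, 0) + ((1 + u \<bullet> u) / (2 * ht z u)) *\<^sub>R nullv z"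

lemma proj_add: "proj z (X + Y) = proj z X + proj z Y"
  and proj_diff: "proj z (X - Y) = proj z X - proj z Y"
  and proj_scaleR: "proj z (c *\<^sub>R X) = c *\<^sub>R proj z X"
  by (simp_all add: proj_def algebra_simps)

lemma proj_nullv: "proj z (nullv z) = 0"
  by (simp add: proj_def nullv_def)

lemma proj_pair: "proj z (u, 0) = u"
  by (simp add: proj_def)

lemma proj_emb: "proj z (emb z u) = u"
  by (simp add: emb_def proj_add proj_scaleR proj_nullv proj_pair)

lemma ht_proj: "z \<in> sphere 0 1 \<Longrightarrow> ht z (proj z X) = lc X z"
  by (simp add: ht_def proj_def lc_def inner_diff_left dot_square_norm)

lemma mink_pair_nullv: "mink (u, 0) (nullv z) = - ht z u" "mink (nullv z) (u, 0) = - ht z u"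
  by (simp_all add: mink_def nullv_def ht_def inner_commute)

lemma mink_pair: "mink (u, 0) (v, 0) = u \<bullet> v"
  by (simp add: mink_def)

lemma emb_in_hyp:
  assumes z: "z \<in> sphere 0 1" and u: "ht z u > 0"
  shows "emb z u \<in> hyp"
proof -
  have "mink (emb z u) (emb z u) = -1"
    unfolding emb_def using mink_nullv_self[OF z] u
    by (simp only: mink_simps mink_pair_nullv mink_pair) (simp add: field_simps)
  moreover have "snd (emb z u) > 0"
  proof -
    have "0 < 1 + u \<bullet> u" using inner_ge_zero[of u] by linarith
    then show ?thesis using u by (simp add: emb_def nullv_def)
  qed
  ultimately show ?thesis by (simp add: hyp_def)
qed

lemma emb_proj:
  assumes z: "z \<in> sphere 0 1" and X: "X \<in> hyp"
  shows "emb z (proj z X) = X"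
proof -
  have z1: "z \<bullet> z = 1" using z by (simp add: dot_square_norm)
  have xx: "fst X \<bullet> fst X = snd X * snd X - 1" using hypD(1)[OF X] by (simp add: mink_def)
  have pos: "lc X z > 0" using lc_pos[OF X] z by simp
  have "1 + proj z X \<bullet> proj z X = snd X * (2 * lc X z)"
    by (simp add: proj_def inner_diff_left inner_diff_right z1 xx lc_def inner_commute algebra_simps)
  then have "(1 + proj z X \<bullet> proj z X) / (2 * ht z (proj z X)) = snd X"
    using pos by (simp add: ht_proj[OF z])
  then show ?thesis by (simp add: emb_def nullv_def proj_def prod_eq_iff)
qed

lemma proj_horopt:
  assumes X: "X \<in> hyp" "X' \<in> hyp" and z: "z \<in> sphere 0 1" and e: "0 \<le> e" "e \<le> 1"
  shows "proj z (horopt z X X' e) = (1 - e) *\<^sub>R proj z X + e *\<^sub>R proj z X'"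
proof -
  have "proj z (horopt z X X' e) = proj z (segpt X X' e)"
    unfolding horopt_def by (simp add: proj_diff proj_scaleR proj_nullv)
  then show ?thesis by (simp add: segpt_def proj_add proj_scaleR)
qed

text \<open>\<open>proj z\<close> maps \<open>horopt\<close> to the corresponding point of a
  Euclidean segment and is injective on \<open>hyp\<close> by \<open>emb_proj\<close>.\<close>

lemma horopt_in_of_convex_proj:
  assumes K: "K \<subseteq> hyp" and z: "z \<in> sphere 0 1" and conv: "convex (proj z ` K)"
    and XK: "X \<in> K" "X' \<in> K" and e: "0 \<le> e" "e \<le> 1"
  shows "horopt z X X' e \<in> K"
proof -
  have X: "X \<in> hyp" "X' \<in> hyp" using XK K by auto
  have "proj z (horopt z X X' e) \<in> proj z ` K"
    unfolding proj_horopt[OF X z e] using XK e by (intro convexD[OF conv]) auto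
  then obtain Z where Z: "Z \<in> K" "proj z (horopt z X X' e) = proj z Z" by (elim imageE)
  have "Z \<in> hyp" using Z(1) K by blast
  have "horopt z X X' e = Z"
    using emb_proj[OF z horopt_props(2)[OF X z e]] emb_proj[OF z \<open>Z \<in> hyp\<close>] unfolding Z(2) by (rule trans[OF sym])
  then show ?thesis using Z(1) by simp
qed

text \<open>\<open>X - N\<close> is the future null vector that determines the horosphere through
  \<open>X\<close> with outward unit normal \<open>N\<close>.\<close>

lemma minus_normal_null:
  assumes X: "X \<in> hyp" and N: "mink X N = 0" "mink N N = 1"
  shows "norm (fst (X - N)) = snd (X - N)" "snd (X - N) > 0"
proof -
  have "mink (X - N) (X - N) = 0" using hypD(1)[OF X] N mink_commute[of X N] by (simp add: mink_simps)
  then have "(norm (fst (X - N)))\<^sup>2 = (snd (X - N))\<^sup>2" by (simp only: mink_le_norm)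
  then have abs: "norm (fst (X - N)) = \<bar>snd (X - N)\<bar>"
    using abs_le_square_iff[of "norm (fst (X - N))" "snd (X - N)"] abs_le_square_iff[of "snd (X - N)" "norm (fst (X - N))"]
    by simp
  show pos: "snd (X - N) > 0"
  proof (rule ccontr)
    assume neg: "\<not> ?thesis"
    show False
    proof (cases "snd (X - N) = 0")
      case True
      then have "X - N = 0" using abs by (simp add: prod_eq_iff)
      then show False using N hypD(1)[OF X] by simp
    next
      case False
      then have M: "norm (fst (N - X)) \<le> snd (N - X)" "0 < snd (N - X)"
        using neg abs norm_minus_commute[of "fst X" "fst N"] by auto
      have "mink X (N - X) < 0" by (rule mink_cone_neg[OF hyp_norm_less[OF X] M])
      then show False using N hypD(1)[OF X] by (simp add: mink_simps)
    qed
  qed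
  then show "norm (fst (X - N)) = snd (X - N)" using abs by simp
qed

text \<open>A point outside \<open>K\<close> is separated from \<open>K\<close> by the horosphere that touches at a nearest point of \<open>K\<close>.\<close>

theorem hconv_of_horopt_closed:
  fixes K :: "'m::finite minkowski set"
  assumes K: "compact K" "K \<noteq> {}" "K \<subseteq> hyp"
    and closed: "\<And>z X Y e. z \<in> sphere 0 1 \<Longrightarrow> X \<in> K \<Longrightarrow> Y \<in> K \<Longrightarrow> 0 \<le> e \<Longrightarrow> e \<le> 1 \<Longrightarrow> horopt z X Y e \<in> K"
  shows "hconv K"
  unfolding hconv_def
proof (intro conjI ballI impI K)
  fix Z assume Zh: "Z \<in> hyp" and le: "\<forall>z\<in>sphere 0 1. \<exists>Y\<in>K. lc Z z \<le> lc Y z"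
  show "Z \<in> K"
  proof (rule ccontr)
    assume ZK: "Z \<notin> K"
    have "continuous_on K (\<lambda>X. - mink X Z)" by (intro continuous_intros)
    from continuous_attains_inf[OF K(1,2) this]
    obtain X where X: "X \<in> K" and near: "\<And>Y. Y \<in> K \<Longrightarrow> - mink X Z \<le> - mink Y Z" by blast
    have Xh: "X \<in> hyp" using X K(3) by blast
    define k0 where "k0 = - mink X Z"
    have "k0 \<noteq> 1" using hyp_eqI[OF Xh Zh] X ZK by (auto simp: k0_def)
    then have k0: "k0 > 1" using minus_mink_ge_one[OF Xh Zh] by (simp add: k0_def)
    \<comment> \<open>\<open>k0\<close> and \<open>s\<close> are cosh and sinh of the distance from
      \<open>X\<close> to \<open>Z\<close>; \<open>N\<close> is the unit tangent at \<open>X\<close>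
      of the geodesic to \<open>Z\<close>.\<close>
    define s where "s = sqrt (k0\<^sup>2 - 1)"
    have "k0\<^sup>2 > 1" using k0 by (simp add: one_less_power)
    then have s: "s > 0" "s\<^sup>2 = k0\<^sup>2 - 1" by (auto simp: s_def)
    define N where "N = (1 / s) *\<^sub>R (Z - k0 *\<^sub>R X)"
    have ZX: "mink Z X = - k0" "mink X Z = - k0" using mink_commute[of X Z] by (auto simp: k0_def)
    have XN: "mink X N = 0" using hypD(1)[OF Xh] by (simp add: N_def mink_simps ZX)
    have "s\<^sup>2 * mink N N = k0\<^sup>2 - 1"
      using hypD(1)[OF Xh] hypD(1)[OF Zh] s(1)
      by (simp add: N_def mink_simps ZX power2_eq_square)
    then have NN: "mink N N = 1" using s \<open>k0\<^sup>2 > 1\<close> by simp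
    have Z: "Z = k0 *\<^sub>R X + s *\<^sub>R N" using s by (simp add: N_def)
    note nn = minus_normal_null[OF Xh XN NN]
    define c where "c = snd (X - N)"
    define z where "z = (1 / c) *\<^sub>R fst (X - N)"
    have c: "c > 0" using nn(2) by (simp add: c_def)
    have nc: "norm (fst (X - N)) = c" using nn(1) by (simp only: c_def)
    have z: "z \<in> sphere 0 1" unfolding z_def mem_sphere_0 norm_scaleR nc using c by simp
    have nz: "norm z \<le> 1" using z by simp
    have zeta: "X - N = c *\<^sub>R nullv z"
      using c by (simp add: nullv_def z_def c_def prod_eq_iff)
    have lcz: "c * lc V z = - mink V (X - N)" for V
      unfolding zeta by (simp add: mink_simps mink_nullv)
    have x0: "c * lc X z = 1" unfolding lcz using hypD(1)[OF Xh] XN by (simp add: mink_simps)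
    have NX: "mink N X = 0" using XN mink_commute[of X N] by simp
    have w0: "c * lc Z z = k0 + s"
      unfolding lcz Z using hypD(1)[OF Xh] XN NX NN by (simp add: mink_simps)
    obtain Y where Y: "Y \<in> K" "lc Z z \<le> lc Y z" using le z by blast
    have Yh: "Y \<in> hyp" using Y K(3) by blast
    define y k m where "y = c * lc Y z" and "k = - mink X Y" and "m = - mink Y Z"
    have y: "y \<ge> k0 + s" unfolding y_def w0[symmetric] using Y(2) c by (intro mult_left_mono) auto
    have k1: "k \<ge> 1" unfolding k_def by (rule minus_mink_ge_one[OF Xh Yh])
    have YX: "mink Y X = - k" using mink_commute[of X Y] by (simp add: k_def)
    have YN: "mink Y N = y - k"
      using lcz[of Y] by (simp add: y_def mink_simps YX)
    have m: "m = k0 * k - s * (y - k)" unfolding m_def Z by (simp add: mink_simps YX YN)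
    \<comment> \<open>As \<open>X\<close> is nearest to \<open>Z\<close>, no step from
      \<open>X\<close> towards \<open>Y\<close> along \<open>horopt\<close> comes closer;
      \<open>q e\<close> is the null correction in this comparison divided by \<open>e\<close>. The
      limit yields \<open>y <= 1\<close>, against \<open>y >= k0 + s\<close>.\<close>
    define q where "q e = (1 - e) * ((k - 1) * (k0 + s)) / ((1 - e) + e * y)" for e
    have ineq: "q e \<le> m - k0" if e: "0 < e" "e < 1" for e
    proof -
      define l where "l = e * (1 - e) * (k - 1) / ((1 - e) * lc X z + e * lc Y z)"
      note H = horopt_props[OF Xh Yh z less_imp_le[OF e(1)] less_imp_le[OF e(2)], folded k_def, folded l_def]
      have "k0 \<le> - mink (horopt z X Y e) Z"
        unfolding k0_def by (intro near closed z X Y) (use e in auto)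
      also have "\<dots> = (1 - e) * k0 + e * m - l * lc Z z"
        unfolding H(1) segpt_def by (simp add: mink_simps mink_nullv ZX m_def)
      finally have "l * lc Z z \<le> e * (m - k0)" by (simp add: algebra_simps)
      moreover have "l * lc Z z = e * q e"
      proof -
        have "(1 - e) + e * y = c * ((1 - e) * lc X z + e * lc Y z)"
          using x0 by (simp add: y_def algebra_simps)
        then show ?thesis unfolding q_def w0[symmetric] using c by (simp add: l_def)
      qed
      ultimately show ?thesis using e(1) by (simp only: mult_le_cancel_left_pos)
    qed
    have "(q \<longlongrightarrow> q 0) (at_right (0::real))"
      unfolding q_def by (intro tendsto_intros) auto
    moreover have "eventually (\<lambda>e. q e \<le> m - k0) (at_right (0::real))"
      unfolding eventually_at_right_field using ineq by (intro exI[of _ 1]) auto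
    ultimately have "q 0 \<le> m - k0"
      by (rule tendsto_upperbound) simp
    then have "s * y \<le> s * 1" unfolding m q_def by (simp add: algebra_simps)
    then have "y \<le> 1" using s(1) by (simp only: mult_le_cancel_left_pos)
    then show False using y k0 s(1) by simp
  qed
qed

section \<open>Calculus of smooth functions\<close>

lemma frechet_derivative_cong_open:
  assumes "open S" "x \<in> S" "\<And>y. y \<in> S \<Longrightarrow> f y = g y"
  shows "frechet_derivative f (at x) = frechet_derivative g (at x)"
proof -
  have "(f has_derivative D) (at x) \<longleftrightarrow> (g has_derivative D) (at x)" for D
    using has_derivative_transform_within_open[OF _ assms(1,2), of f D UNIV g]
      has_derivative_transform_within_open[OF _ assms(1,2), of g D UNIV f] assms(3) by auto
  then show ?thesis by (simp add: frechet_derivative_def)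
qed

lemma Ck_on_cong:
  assumes "open S" "\<And>y. y \<in> S \<Longrightarrow> f y = g y" "Ck_on k S f"
  shows "Ck_on k S g"
  using assms(2,3)
proof (induction k arbitrary: f g)
  case 0
  then show ?case using continuous_on_cong[of S S f g] by simp
next
  case (Suc k)
  have "g differentiable (at x)" if "x \<in> S" for x
  proof -
    have "f differentiable (at x)" using Suc.prems(2) that by simp
    then obtain D where "(f has_derivative D) (at x)" unfolding differentiable_def by (elim exE)
    then have "(g has_derivative D) (at x)"
      by (rule has_derivative_transform_within_open[OF _ assms(1) that]) (rule Suc.prems(1))
    then show ?thesis by (auto simp: differentiable_def)
  qed
  moreover have "Ck_on k S (\<lambda>x. frechet_derivative g (at x) v)" for v
    by (rule Suc.IH[of "\<lambda>x. frechet_derivative f (at x) v"])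
      (use Suc.prems frechet_derivative_cong_open[OF assms(1), of _ f g] in auto)
  ultimately show ?case by simp
qed

text \<open>\<open>Ck_on\<close> refers to \<open>frechet_derivative\<close>; on an open set any
  explicit formula for the derivative may take its place.\<close>

lemma Ck_on_SucI:
  assumes "open S" "\<And>x. x \<in> S \<Longrightarrow> (f has_derivative f' x) (at x)" "\<And>v. Ck_on k S (\<lambda>x. f' x v)"
  shows "Ck_on (Suc k) S f"
proof -
  have "Ck_on k S (\<lambda>x. frechet_derivative f (at x) v)" for v
    by (rule Ck_on_cong[OF assms(1) _ assms(3)[of v]]) (simp add: frechet_derivative_at[OF assms(2), symmetric])
  then show ?thesis using assms(2) by (auto simp: differentiable_def)
qed

lemma Ck_on_SucD:
  assumes "Ck_on (Suc k) S f" "x \<in> S"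
  shows "(f has_derivative frechet_derivative f (at x)) (at x)"
  using assms by (simp add: frechet_derivative_works)

lemma Ck_on_lower: "Ck_on (Suc k) S f \<Longrightarrow> Ck_on k S f"
proof (induction k arbitrary: f)
  case 0
  then show ?case by (auto intro!: continuous_at_imp_continuous_on differentiable_imp_continuous_within)
next
  case (Suc k)
  then show ?case by simp
qed

lemma Ck_on_subset: "Ck_on k S f \<Longrightarrow> T \<subseteq> S \<Longrightarrow> Ck_on k T f"
proof (induction k arbitrary: f)
  case 0
  then show ?case by (auto intro: continuous_on_subset)
next
  case (Suc k)
  then show ?case by (auto dest: subsetD)
qed

lemma Ck_on_const: "open S \<Longrightarrow> Ck_on k S (\<lambda>x. c)"
proof (induction k arbitrary: c)
  case (Suc k)
  show ?case by (rule Ck_on_SucI[OF Suc.prems, where f' = "\<lambda>x v. 0"]) (auto intro: Suc)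
qed simp

lemma Ck_on_bounded_linear:
  assumes "open S" "bounded_linear L"
  shows "Ck_on k S L"
proof (cases k)
  case 0
  then show ?thesis using linear_continuous_on[OF assms(2)] by simp
next
  case (Suc n)
  then show ?thesis
    using Ck_on_SucI[OF assms(1), of L "\<lambda>x. L" n] bounded_linear_imp_has_derivative[OF assms(2)]
      Ck_on_const[OF assms(1)] by auto
qed

lemma Ck_on_add:
  assumes "open S"
  shows "Ck_on k S f \<Longrightarrow> Ck_on k S g \<Longrightarrow> Ck_on k S (\<lambda>x. f x + g x)"
proof (induction k arbitrary: f g)
  case 0
  then show ?case by (simp add: continuous_on_add)
next
  case (Suc k)
  show ?case
  proof (rule Ck_on_SucI[OF assms])
    show "((\<lambda>x. f x + g x) has_derivative
        (\<lambda>v. frechet_derivative f (at x) v + frechet_derivative g (at x) v)) (at x)" if "x \<in> S" for x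
      using Suc.prems that by (intro has_derivative_add Ck_on_SucD)
    show "Ck_on k S (\<lambda>x. frechet_derivative f (at x) v + frechet_derivative g (at x) v)" for v
      using Suc.prems by (intro Suc.IH) auto
  qed
qed

lemma Ck_on_sum:
  assumes "open S" "\<And>i. i \<in> A \<Longrightarrow> Ck_on k S (f i)"
  shows "Ck_on k S (\<lambda>x. \<Sum>i\<in>A. f i x)"
  using assms(2)
  by (induction A rule: infinite_finite_induct) (auto intro: Ck_on_const[OF assms(1)] Ck_on_add[OF assms(1)])

lemma Ck_on_bilinear:
  assumes S: "open S" and h: "bounded_bilinear h"
  shows "Ck_on k S f \<Longrightarrow> Ck_on k S g \<Longrightarrow> Ck_on k S (\<lambda>x. h (f x) (g x))"
proof (induction k arbitrary: f g)
  case 0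
  then show ?case by (simp add: bounded_bilinear.continuous_on[OF h])
next
  case (Suc k)
  show ?case
  proof (rule Ck_on_SucI[OF S])
    show "((\<lambda>x. h (f x) (g x)) has_derivative
        (\<lambda>v. h (f x) (frechet_derivative g (at x) v) + h (frechet_derivative f (at x) v) (g x))) (at x)"
      if "x \<in> S" for x
      using Suc.prems that by (intro bounded_bilinear.FDERIV[OF h] Ck_on_SucD)
    show "Ck_on k S (\<lambda>x. h (f x) (frechet_derivative g (at x) v) + h (frechet_derivative f (at x) v) (g x))" for v
      using Suc.prems Ck_on_lower[OF Suc.prems(1)] Ck_on_lower[OF Suc.prems(2)]
      by (intro Ck_on_add[OF S] Suc.IH) auto
  qed
qed

lemma Ck_on_powr:
  fixes f :: "'a::real_normed_vector \<Rightarrow> real"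
  assumes S: "open S" and pos: "\<And>x. x \<in> S \<Longrightarrow> f x > 0"
  shows "Ck_on k S f \<Longrightarrow> Ck_on k S (\<lambda>x. f x powr c)"
proof (induction k arbitrary: c)
  case 0
  then show ?case using pos by (auto intro!: continuous_on_powr continuous_on_const) fastforce
next
  case (Suc k)
  show ?case
  proof (rule Ck_on_SucI[OF S])
    show "((\<lambda>x. f x powr c) has_derivative (\<lambda>v. c * f x powr (c - 1) * frechet_derivative f (at x) v)) (at x)"
      if "x \<in> S" for x
    proof -
      have "((\<lambda>y. y powr c) has_real_derivative c * f x powr (c - 1)) (at (f x))"
        using has_real_derivative_powr[OF pos[OF that]] .
      then have "((\<lambda>y. y powr c) has_derivative (\<lambda>v. c * f x powr (c - 1) * v)) (at (f x))"
        by (simp add: has_field_derivative_def)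
      from has_derivative_compose[OF Ck_on_SucD[OF Suc.prems that] this] show ?thesis .
    qed
    show "Ck_on k S (\<lambda>x. c * f x powr (c - 1) * frechet_derivative f (at x) v)" for v
    proof (intro Ck_on_bilinear[OF S bounded_bilinear_mult] Ck_on_const[OF S] Suc.IH)
      show "Ck_on k S f" using Suc.prems by (rule Ck_on_lower)
      show "Ck_on k S (\<lambda>x. frechet_derivative f (at x) v)" using Suc.prems by simp
    qed
  qed
qed

text \<open>Schwarz: both mixed derivatives are limits of the second difference quotient.\<close>

abbreviation diff2 :: "('a::real_vector \<Rightarrow> real) \<Rightarrow> 'a \<Rightarrow> 'a \<Rightarrow> 'a \<Rightarrow> real" where
  "diff2 f x u w \<equiv> f (x + u + w) - f (x + u) - f (x + w) + f x"

text \<open>The mean value theorem is applied along \<open>a\<close> to the difference in direction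
  \<open>b\<close>, then along \<open>b\<close> to the derivative in direction
  \<open>a\<close>.\<close>

lemma mixed_difference_mean_value:
  fixes f A :: "'a::real_normed_vector \<Rightarrow> real"
  assumes h: "h > 0" and sq: "\<And>s t. 0 \<le> s \<Longrightarrow> s \<le> h \<Longrightarrow> 0 \<le> t \<Longrightarrow> t \<le> h \<Longrightarrow> x + s *\<^sub>R a + t *\<^sub>R b \<in> U"
    and f: "\<And>y. y \<in> U \<Longrightarrow> (f has_derivative f' y) (at y)"
    and A: "\<And>y. y \<in> U \<Longrightarrow> ((\<lambda>y. f' y a) has_derivative A' y) (at y)"
  shows "\<exists>s t. 0 < s \<and> s < h \<and> 0 < t \<and> t < h \<and>
    diff2 f x (h *\<^sub>R a) (h *\<^sub>R b) = h * h * A' (x + s *\<^sub>R a + t *\<^sub>R b) b"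
proof -
  have line: "((\<lambda>s. F (y + s *\<^sub>R w)) has_real_derivative F' w) (at s)"
    if "(F has_derivative F') (at (y + s *\<^sub>R w))" for F :: "'a \<Rightarrow> real" and F' y s w
  proof -
    have "((\<lambda>s. y + s *\<^sub>R w) has_derivative (\<lambda>r. r *\<^sub>R w)) (at s)" by (auto intro!: derivative_eq_intros)
    from has_derivative_compose[OF this that]
    have "((\<lambda>s. F (y + s *\<^sub>R w)) has_derivative (\<lambda>r. F' (r *\<^sub>R w))) (at s)" .
    moreover have "(\<lambda>r. F' (r *\<^sub>R w)) = (\<lambda>r. F' w * r)"
      using linear_cmul[OF has_derivative_linear[OF that]] by (simp add: mult.commute)
    ultimately show ?thesis by (simp add: has_field_derivative_def)
  qed
  define g where "g s = f (x + s *\<^sub>R a + h *\<^sub>R b) - f (x + s *\<^sub>R a)" for s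
  have "(g has_real_derivative (f' (x + s *\<^sub>R a + h *\<^sub>R b) a - f' (x + s *\<^sub>R a) a)) (at s)" if "0 \<le> s" "s \<le> h" for s
  proof -
    have "((\<lambda>s. f ((x + h *\<^sub>R b) + s *\<^sub>R a)) has_real_derivative f' (x + s *\<^sub>R a + h *\<^sub>R b) a) (at s)"
      by (rule line) (use f[OF sq[OF that, of h]] h in \<open>simp add: add.assoc add.commute add.left_commute\<close>)
    moreover have "((\<lambda>s. f (x + s *\<^sub>R a)) has_real_derivative f' (x + s *\<^sub>R a) a) (at s)"
      by (rule line) (use f[OF sq[OF that, of 0]] h in simp)
    ultimately show ?thesis
      unfolding g_def by (intro DERIV_diff) (simp_all add: add.assoc add.commute add.left_commute)
  qed
  from MVT2[OF h this] obtain s where s: "0 < s" "s < h"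
    "g h - g 0 = h * (f' (x + s *\<^sub>R a + h *\<^sub>R b) a - f' (x + s *\<^sub>R a) a)" by auto
  have "((\<lambda>t. f' ((x + s *\<^sub>R a) + t *\<^sub>R b) a) has_real_derivative A' (x + s *\<^sub>R a + t *\<^sub>R b) b) (at t)"
    if "0 \<le> t" "t \<le> h" for t
    by (rule line) (use A[OF sq[of s t]] that s in simp)
  from MVT2[OF h this] obtain t where t: "0 < t" "t < h"
    "f' (x + s *\<^sub>R a + h *\<^sub>R b) a - f' (x + s *\<^sub>R a) a = h * A' (x + s *\<^sub>R a + t *\<^sub>R b) b" by auto
  have "diff2 f x (h *\<^sub>R a) (h *\<^sub>R b) = g h - g 0"
    by (simp add: g_def)
  then show ?thesis using s t by (intro exI[of _ s] exI[of _ t]) simp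
qed

lemma second_difference_limit:
  fixes f :: "'a::real_normed_vector \<Rightarrow> real"
  assumes U: "open U" "x \<in> U"
    and f: "\<And>y. y \<in> U \<Longrightarrow> (f has_derivative f' y) (at y)"
    and A: "\<And>y. y \<in> U \<Longrightarrow> ((\<lambda>y. f' y a) has_derivative A' y) (at y)"
    and cont: "continuous_on U (\<lambda>y. A' y b)"
  shows "((\<lambda>h. diff2 f x (h *\<^sub>R a) (h *\<^sub>R b) / (h * h))
    \<longlongrightarrow> A' x b) (at_right 0)"
proof (rule tendstoI)
  fix e :: real assume e: "e > 0"
  obtain r where r: "r > 0" "ball x r \<subseteq> U" using U unfolding open_contains_ball by blast
  have "isCont (\<lambda>y. A' y b) x" using cont U by (simp add: continuous_on_eq_continuous_at)
  then obtain d where d: "d > 0" "\<And>y. dist y x < d \<Longrightarrow> dist (A' y b) (A' x b) < e"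
    using e unfolding continuous_at_eps_delta by blast
  define M where "M = norm a + norm b + 1"
  have M: "M > 0" by (simp add: M_def add_nonneg_pos)
  have near: "norm (s *\<^sub>R a + t *\<^sub>R b) < min r d"
    if "0 \<le> s" "s \<le> h" "0 \<le> t" "t \<le> h" "h < min r d / M" for s t h
  proof -
    have "norm (s *\<^sub>R a + t *\<^sub>R b) \<le> s * norm a + t * norm b"
      using norm_triangle_ineq[of "s *\<^sub>R a" "t *\<^sub>R b"] that by simp
    also have "\<dots> \<le> h * norm a + h * norm b" using that by (intro add_mono mult_right_mono) auto
    also have "\<dots> \<le> h * M" using that by (simp add: M_def algebra_simps)
    also have "\<dots> < min r d" using that(5) M by (simp only: less_divide_eq)
    finally show ?thesis .
  qed
  let ?q = "\<lambda>h. diff2 f x (h *\<^sub>R a) (h *\<^sub>R b) / (h * h)"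
  have "dist (?q h) (A' x b) < e" if h: "0 < h" "h < min r d / M" for h
  proof -
    have sq: "x + s *\<^sub>R a + t *\<^sub>R b \<in> U" if "0 \<le> s" "s \<le> h" "0 \<le> t" "t \<le> h" for s t
    proof -
      have "x + s *\<^sub>R a + t *\<^sub>R b \<in> ball x r"
        using near[OF that h(2)] by (simp add: mem_ball dist_commute[of x]) (simp add: dist_norm add.assoc)
      then show ?thesis using r(2) by (rule subsetD[rotated])
    qed
    obtain s t where st: "0 < s" "s < h" "0 < t" "t < h"
      "diff2 f x (h *\<^sub>R a) (h *\<^sub>R b) = h * h * A' (x + s *\<^sub>R a + t *\<^sub>R b) b"
      using mixed_difference_mean_value[OF h(1) sq f A] by blast
    have "?q h = A' (x + s *\<^sub>R a + t *\<^sub>R b) b" unfolding st(5) using h(1) by simp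
    moreover have "dist (x + s *\<^sub>R a + t *\<^sub>R b) x < d" using near[of s h t] st h(2) by (simp add: dist_norm add.assoc)
    ultimately show ?thesis using d(2) by simp
  qed
  then show "\<forall>\<^sub>F h in at_right 0. dist (?q h) (A' x b) < e"
    unfolding eventually_at_right_field using r(1) d(1) M by (intro exI[of _ "min r d / M"]) auto
qed

lemma mixed_derivatives_commute:
  fixes f :: "'a::real_normed_vector \<Rightarrow> real"
  assumes U: "open U" "x \<in> U"
    and f: "\<And>y. y \<in> U \<Longrightarrow> (f has_derivative f' y) (at y)"
    and A: "\<And>y. y \<in> U \<Longrightarrow> ((\<lambda>y. f' y a) has_derivative A' y) (at y)"
    and B: "\<And>y. y \<in> U \<Longrightarrow> ((\<lambda>y. f' y b) has_derivative B' y) (at y)"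
    and cont: "continuous_on U (\<lambda>y. A' y b)" "continuous_on U (\<lambda>y. B' y a)"
  shows "A' x b = B' x a"
proof -
  have eq: "diff2 f x (h *\<^sub>R b) (h *\<^sub>R a) / (h * h)
      = diff2 f x (h *\<^sub>R a) (h *\<^sub>R b) / (h * h)" for h
    by (simp add: add.assoc add.commute[of "h *\<^sub>R b"])
  show ?thesis
    by (rule tendsto_unique[OF _ second_difference_limit[OF U f A cont(1)]
          second_difference_limit[OF U f B cont(2), unfolded eq]]) simp
qed

section \<open>Curvature of the boundary\<close>

text \<open>\<open>A\<close> is symmetric and \<open>Q\<close> definite on \<open>V\<close> only, as
  for the Minkowski form on a tangent space. A minimiser of the Rayleigh quotient is an eigenvector
  by the first variation, and the minimum is at most the value at \<open>w\<close>.\<close>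

lemma rayleigh_eigenvector:
  fixes A :: "'a::euclidean_space \<Rightarrow> 'a" and Q :: "'a \<Rightarrow> 'a \<Rightarrow> real"
  assumes V: "subspace V" and A: "linear A" and AV: "\<And>v. v \<in> V \<Longrightarrow> A v \<in> V"
    and Q: "bounded_bilinear Q" and Qc: "\<And>u v. Q u v = Q v u" and Qpos: "\<And>v. v \<in> V \<Longrightarrow> v \<noteq> 0 \<Longrightarrow> 0 < Q v v"
    and sym: "\<And>u v. u \<in> V \<Longrightarrow> v \<in> V \<Longrightarrow> Q (A u) v = Q (A v) u"
    and w: "w \<in> V" "w \<noteq> 0"
  shows "\<exists>v \<kappa>. v \<in> V \<and> v \<noteq> 0 \<and> A v = \<kappa> *\<^sub>R v \<and> \<kappa> * Q w w \<le> Q (A w) w"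
proof -
  interpret Q: bounded_bilinear Q by fact
  have cA: "continuous_on S A" for S using linear_continuous_on A by (simp add: linear_conv_bounded_linear)
  define S where "S = V \<inter> sphere 0 1"
  have S: "compact S" unfolding S_def using closed_subspace[OF V] by (intro closed_Int_compact) auto
  have sw: "sgn w \<in> S" using w V by (simp add: S_def sgn_div_norm subspace_scale)
  have "continuous_on S (\<lambda>v. Q (A v) v / Q v v)"
    using Qpos by (intro continuous_on_divide Q.continuous_on cA continuous_on_id) (force simp: S_def)
  then obtain v where v: "v \<in> S" "\<And>u. u \<in> S \<Longrightarrow> Q (A v) v / Q v v \<le> Q (A u) u / Q u u"
    using continuous_attains_inf[OF S] sw by blast
  have vV: "v \<in> V" "v \<noteq> 0" using v(1) by (auto simp: S_def)
  define \<kappa> where "\<kappa> = Q (A v) v / Q v v"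
  have ge: "\<kappa> * Q u u \<le> Q (A u) u" if u: "u \<in> V" for u
  proof (cases "u = 0")
    case False
    have "sgn u \<in> S" using False u V by (simp add: S_def sgn_div_norm subspace_scale)
    then have "\<kappa> \<le> Q (A (sgn u)) (sgn u) / Q (sgn u) (sgn u)" using v(2) by (simp add: \<kappa>_def)
    also have "\<dots> = Q (A u) u / Q u u"
      using False by (simp add: sgn_div_norm linear_cmul[OF A] Q.scaleR_left Q.scaleR_right)
    finally show ?thesis using Qpos[OF u False] by (simp add: le_divide_eq)
  qed (simp add: linear_0[OF A] Q.zero_left)
  have orth: "Q (A v - \<kappa> *\<^sub>R v) u = 0" if u: "u \<in> V" for u
  proof (rule ccontr)
    define b where "b = Q (A v - \<kappa> *\<^sub>R v) u"
    define q where "q = Q (A u) u - \<kappa> * Q u u"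
    assume "Q (A v - \<kappa> *\<^sub>R v) u \<noteq> 0"
    then have b: "b \<noteq> 0" by (simp add: b_def)
    have q0: "Q (A v) v = \<kappa> * Q v v" using Qpos[OF vV] by (simp add: \<kappa>_def)
    have q: "0 \<le> q" using ge[OF u] by (simp add: q_def)
    have main: "0 \<le> 2 * t * b + t\<^sup>2 * q" for t
    proof -
      have "v + t *\<^sub>R u \<in> V" using vV u V by (simp add: subspace_add subspace_scale)
      then have "\<kappa> * Q (v + t *\<^sub>R u) (v + t *\<^sub>R u) \<le> Q (A (v + t *\<^sub>R u)) (v + t *\<^sub>R u)" by (rule ge)
      then show ?thesis
        using q0 sym[OF u vV(1)] Qc[of u v]
        by (simp add: linear_add[OF A] linear_cmul[OF A] Q.add_left Q.add_right Q.scaleR_left Q.scaleR_right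
            Q.diff_left b_def q_def power2_eq_square algebra_simps)
    qed
    \<comment> \<open>Makes \<open>2 * t * b + t^2 * q\<close> negative for every
      \<open>q >= 0\<close>, including \<open>q = 0\<close>.\<close>
    define t where "t = - b / (q + 1)"
    have bt: "b = - (t * (q + 1))" using q by (simp add: t_def)
    have "2 * t * b + t\<^sup>2 * q = - (t\<^sup>2 * (q + 2))"
      unfolding bt by (simp add: power2_eq_square algebra_simps)
    moreover have "t \<noteq> 0" using b bt by auto
    then have "0 < t\<^sup>2 * (q + 2)" using q by simp
    ultimately show False using main[of t] by simp
  qed
  have D: "A v - \<kappa> *\<^sub>R v \<in> V" using vV AV V by (simp add: subspace_diff subspace_scale)
  have "A v - \<kappa> *\<^sub>R v = 0" using Qpos[OF D] orth[OF D] by (metis less_irrefl)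
  then show ?thesis using vV ge[OF w(1)] by (intro exI[of _ v] exI[of _ \<kappa>]) simp
qed

section \<open>Defining functions, their gradients and the shape operator\<close>

definition flip :: "'m::finite minkowski \<Rightarrow> 'm minkowski" where
  "flip X = (fst X, - snd X)"

lemma mink_flip: "mink (flip X) Y = X \<bullet> Y"
  by (simp add: mink_def flip_def inner_prod_def)

lemma bounded_bilinear_mink: "bounded_bilinear (mink :: 'm::finite minkowski \<Rightarrow> 'm minkowski \<Rightarrow> real)"
proof -
  have "bounded_linear (flip :: 'm minkowski \<Rightarrow> 'm minkowski)"
    unfolding flip_def[abs_def]
    by (intro bounded_linear_Pair bounded_linear_fst bounded_linear_minus bounded_linear_snd)
  from bounded_bilinear.comp[OF bounded_bilinear_inner this bounded_linear_ident]
  have "bounded_bilinear (\<lambda>X Y :: 'm minkowski. flip X \<bullet> Y)" .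
  moreover have "flip X \<bullet> Y = mink X Y" for X Y :: "'m minkowski"
    by (simp add: mink_def flip_def inner_prod_def)
  ultimately show ?thesis by simp
qed

lemma hboundary_iff:
  assumes "K \<subseteq> hyp" "closed K"
  shows "X \<in> hboundary K \<longleftrightarrow> X \<in> K \<and> \<not> (\<exists>T. open T \<and> X \<in> T \<and> T \<inter> hyp \<subseteq> K)"
proof -
  have "closedin (top_of_set hyp) K" using assms by (auto simp: closedin_closed)
  then have "(top_of_set hyp) closure_of K = K" by (simp add: closure_of_closedin)
  moreover have "X \<in> (top_of_set hyp) interior_of K \<longleftrightarrow> X \<in> hyp \<and> (\<exists>T. open T \<and> X \<in> T \<and> T \<inter> hyp \<subseteq> K)"
    unfolding interior_of_def openin_open by auto
  ultimately show ?thesis using assms(1) by (auto simp: hboundary_def frontier_of_def)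
qed

locale deffun =
  fixes K U :: "'m::finite minkowski set" and \<rho> :: "'m minkowski \<Rightarrow> real"
  assumes df: "defining_function K U \<rho>" and K: "K \<subseteq> hyp" "closed K"
begin

definition "D i x = frechet_derivative \<rho> (at x) i"
definition "DD i j x = frechet_derivative (D i) (at x) j"

lemma U: "open U" using df by (simp add: defining_function_def)

lemma sublevel: "Y \<in> hyp \<Longrightarrow> Y \<in> U \<Longrightarrow> Y \<in> K \<longleftrightarrow> \<rho> Y \<le> 0"
  using df unfolding defining_function_def by blast

lemma Ck_rho: "Ck_on k U \<rho>" using df by (simp add: defining_function_def smooth_on_def)

lemma Ck_D: "Ck_on k U (D i)"
  using Ck_rho[of "Suc k"] unfolding Ck_on.simps D_def[abs_def] by blast

lemma Ck_DD: "Ck_on k U (DD i j)"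
  using Ck_D[of "Suc k" i] unfolding Ck_on.simps DD_def[abs_def] by blast

lemma frechet_basis:
  fixes f :: "'m minkowski \<Rightarrow> real"
  assumes "(f has_derivative f') (at x)"
  shows "f' w = (\<Sum>i\<in>Basis. (w \<bullet> i) * f' i)"
proof -
  have "f' w = f' (\<Sum>i\<in>Basis. (w \<bullet> i) *\<^sub>R i)" by (simp add: euclidean_representation)
  also have "\<dots> = (\<Sum>i\<in>Basis. (w \<bullet> i) * f' i)"
    using has_derivative_linear[OF assms] by (simp add: linear_sum linear_cmul)
  finally show ?thesis .
qed

lemma rho_deriv: "x \<in> U \<Longrightarrow> (\<rho> has_derivative (\<lambda>w. D w x)) (at x)"
  using Ck_on_SucD[OF Ck_rho] by (simp add: D_def)

lemma D_deriv: "x \<in> U \<Longrightarrow> (D i has_derivative (\<lambda>w. DD i w x)) (at x)"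
  using Ck_on_SucD[OF Ck_D] by (simp add: DD_def)

lemma D_basis: "x \<in> U \<Longrightarrow> D w x = (\<Sum>i\<in>Basis. (w \<bullet> i) * D i x)"
  by (rule frechet_basis[OF rho_deriv])

lemma DD_basis: "x \<in> U \<Longrightarrow> DD i w x = (\<Sum>j\<in>Basis. (w \<bullet> j) * DD i j x)"
  by (rule frechet_basis[OF D_deriv])

lemma continuous_D: "continuous_on U (D i)" using Ck_D[of 0] by simp

lemma continuous_DD: "continuous_on U (DD i j)" using Ck_DD[of 0] by simp

lemma DD_commute:
  assumes "x \<in> U"
  shows "DD i j x = DD j i x"
proof -
  have A: "((\<lambda>y. (\<lambda>w. D w y) i) has_derivative (\<lambda>w. DD i w y)) (at y)" if "y \<in> U" for y i
    using D_deriv[OF that] by simp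
  show ?thesis
    by (rule mixed_derivatives_commute[OF U assms rho_deriv A A continuous_DD continuous_DD])
qed

text \<open>The Hessian of \<open>\<rho>\<close>. \<open>DD i w x\<close> is linear in
  \<open>w\<close> as a derivative; expanding \<open>u\<close> in the basis makes linearity in the
  other slot evident as well.\<close>

definition "H x u w = (\<Sum>i\<in>Basis. (u \<bullet> i) * DD i w x)"

lemma H_commute:
  assumes "x \<in> U"
  shows "H x u w = H x w u"
proof -
  have "H x u w = (\<Sum>i\<in>Basis. \<Sum>j\<in>Basis. (u \<bullet> i) * ((w \<bullet> j) * DD i j x))"
    unfolding H_def by (intro sum.cong refl) (subst DD_basis[OF assms], simp add: sum_distrib_left)
  also have "\<dots> = (\<Sum>j\<in>Basis. \<Sum>i\<in>Basis. (w \<bullet> j) * ((u \<bullet> i) * DD j i x))"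
  proof (subst sum.swap, intro sum.cong refl)
    fix i j
    show "(u \<bullet> i) * ((w \<bullet> j) * DD i j x) = (w \<bullet> j) * ((u \<bullet> i) * DD j i x)"
      unfolding DD_commute[OF assms, of i j] by (rule mult.left_commute)
  qed
  also have "\<dots> = H x w u"
    unfolding H_def by (intro sum.cong refl) (subst DD_basis[OF assms], simp add: sum_distrib_left)
  finally show ?thesis .
qed

text \<open>The Minkowski gradient of \<open>\<rho>\<close> and, on \<open>hyp\<close>, its tangential part.\<close>

definition "G x = (\<Sum>i\<in>Basis. D i x *\<^sub>R flip i)"
definition "th x = mink (G x) x"
definition "TG x = G x + th x *\<^sub>R x"
definition "c2 x = mink (TG x) (TG x)"

lemma mink_sum_left: "mink (\<Sum>i\<in>A. f i) y = (\<Sum>i\<in>A. mink (f i) y)"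
  using bounded_bilinear.sum_left[OF bounded_bilinear_mink] .

lemma mink_G: "x \<in> U \<Longrightarrow> mink (G x) w = D w x"
  by (simp add: G_def mink_sum_left mink_simps mink_flip D_basis[of x w] inner_commute mult.commute)

lemma G_deriv: "x \<in> U \<Longrightarrow> (G has_derivative (\<lambda>w. \<Sum>i\<in>Basis. DD i w x *\<^sub>R flip i)) (at x)"
  unfolding G_def by (intro has_derivative_sum has_derivative_scaleR_left D_deriv)

lemma mink_G_deriv: "mink (\<Sum>i\<in>Basis. DD i w x *\<^sub>R flip i) u = H x u w"
  by (simp add: H_def mink_sum_left mink_simps mink_flip inner_commute mult.commute)

lemma Ck_G: "Ck_on k U G"
  unfolding G_def[abs_def]
  by (intro Ck_on_sum[OF U] Ck_on_bilinear[OF U bounded_bilinear_scaleR] Ck_D Ck_on_const[OF U])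

lemma Ck_th: "Ck_on k U th"
  unfolding th_def[abs_def]
  by (intro Ck_on_bilinear[OF U bounded_bilinear_mink] Ck_G Ck_on_bounded_linear[OF U bounded_linear_ident])

lemma Ck_TG: "Ck_on k U TG"
  unfolding TG_def[abs_def]
  by (intro Ck_on_add[OF U] Ck_on_bilinear[OF U bounded_bilinear_scaleR] Ck_G Ck_th
      Ck_on_bounded_linear[OF U bounded_linear_ident])

lemma Ck_c2: "Ck_on k U c2"
  unfolding c2_def[abs_def] by (intro Ck_on_bilinear[OF U bounded_bilinear_mink] Ck_TG)

lemma TG_deriv:
  assumes "x \<in> U"
  shows "(TG has_derivative (\<lambda>w. (\<Sum>i\<in>Basis. DD i w x *\<^sub>R flip i) + (th x *\<^sub>R w + (D w x + H x x w) *\<^sub>R x))) (at x)"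
proof -
  have "(th has_derivative (\<lambda>w. mink (G x) w + mink (\<Sum>i\<in>Basis. DD i w x *\<^sub>R flip i) x)) (at x)"
    unfolding th_def[abs_def]
    by (rule bounded_bilinear.FDERIV[OF bounded_bilinear_mink G_deriv[OF assms] has_derivative_ident])
  then have "(th has_derivative (\<lambda>w. D w x + H x x w)) (at x)"
    by (simp only: mink_G[OF assms] mink_G_deriv)
  then have "((\<lambda>x. th x *\<^sub>R x) has_derivative (\<lambda>w. th x *\<^sub>R w + (D w x + H x x w) *\<^sub>R x)) (at x)"
    by (rule bounded_bilinear.FDERIV[OF bounded_bilinear_scaleR _ has_derivative_ident])
  then show ?thesis
    unfolding TG_def[abs_def] by (intro has_derivative_add G_deriv[OF assms])
qed

text \<open>Away from the boundary \<open>c2\<close> may fail to be positive. Where it is positive,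
  the normalisation \<open>Nf\<close> of \<open>TG\<close> is smooth, and it is the extension of the
  normal that \<open>principal_curvature\<close> asks for.\<close>

definition "Us = {x\<in>U. 0 < c2 x}"
definition "Nf x = c2 x powr (- (1/2)) *\<^sub>R TG x"

lemma open_Us: "open Us"
proof -
  have "open (c2 -` {0<..} \<inter> U)"
    using Ck_c2[of 0] continuous_on_open_vimage[OF U, of c2] by simp
  moreover have "Us = c2 -` {0<..} \<inter> U" by (auto simp: Us_def)
  ultimately show ?thesis by simp
qed

lemma Us_subset: "Us \<subseteq> U" by (auto simp: Us_def)

lemma smooth_Nf: "smooth_on Us Nf"
  unfolding smooth_on_def Nf_def[abs_def]
  by (intro allI Ck_on_bilinear[OF open_Us bounded_bilinear_scaleR] Ck_on_powr[OF open_Us]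
      Ck_on_subset[OF Ck_c2 Us_subset] Ck_on_subset[OF Ck_TG Us_subset]) (simp add: Us_def)

lemma mink_Nf: "x \<in> Us \<Longrightarrow> mink (Nf x) (Nf x) = 1"
  by (simp add: Nf_def mink_simps Us_def c2_def[symmetric] powr_minus_divide powr_half_sqrt)

lemma mink_TG_self: "x \<in> hyp \<Longrightarrow> mink x (TG x) = 0"
  using hypD(1)[of x] by (simp add: TG_def mink_simps th_def mink_commute)

lemma mink_TG: "x \<in> U \<Longrightarrow> mink x w = 0 \<Longrightarrow> mink (TG x) w = D w x"
  by (simp add: TG_def mink_simps mink_G)

lemma outward_Nf:
  assumes "x \<in> hboundary K" "x \<in> Us"
  shows "outward_unit_normal K x (Nf x)"
  unfolding outward_unit_normal_def
proof (intro conjI)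
  have xh: "x \<in> hyp" using assms K hboundary_iff by blast
  have xU: "x \<in> U" and c: "0 < c2 x" using assms by (auto simp: Us_def)
  show "mink x (Nf x) = 0" using mink_TG_self[OF xh] by (simp add: Nf_def mink_simps)
  show "mink (Nf x) (Nf x) = 1" by (rule mink_Nf[OF assms(2)])
  have "frechet_derivative \<rho> (at x) v = sqrt (c2 x) * mink (Nf x) v" if "mink x v = 0" for v
    using mink_TG[OF xU that] c by (simp add: Nf_def mink_simps D_def powr_minus_divide powr_half_sqrt)
  then show "\<exists>U \<rho>. x \<in> U \<and> defining_function K U \<rho> \<and>
     (\<exists>c>0. \<forall>v. mink x v = 0 \<longrightarrow> frechet_derivative \<rho> (at x) v = c * mink (Nf x) v)"
    using df xU c by (intro exI[of _ U] exI[of _ \<rho>] conjI exI[of _ "sqrt (c2 x)"]) auto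
qed

text \<open>Points with \<open>\<rho> < 0\<close> are interior. Where \<open>\<rho>\<close>
  vanishes, its differential is nonzero on the tangent space of \<open>hyp\<close>, so
  \<open>TG X\<close> is a nonzero tangent vector and thus spacelike.\<close>

lemma boundary_zero:
  assumes "X \<in> hboundary K" "X \<in> U"
  shows "X \<in> hyp" "\<rho> X = 0" "0 < c2 X"
proof -
  have X: "X \<in> K" "\<not> (\<exists>T. open T \<and> X \<in> T \<and> T \<inter> hyp \<subseteq> K)" using assms(1) hboundary_iff[OF K] by auto
  show Xh: "X \<in> hyp" using X K by blast
  have "\<not> \<rho> X < 0"
  proof
    assume neg: "\<rho> X < 0"
    have "open (\<rho> -` {..<0} \<inter> U)" using Ck_rho[of 0] continuous_on_open_vimage[OF U, of \<rho>] by simp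
    moreover have "X \<in> \<rho> -` {..<0} \<inter> U" using neg assms(2) by simp
    moreover have "(\<rho> -` {..<0} \<inter> U) \<inter> hyp \<subseteq> K" using sublevel by (auto intro: less_imp_le)
    ultimately show False using X(2) by blast
  qed
  then show z: "\<rho> X = 0" using sublevel[OF Xh assms(2)] X(1) by simp
  obtain v where v: "mink X v = 0" "D v X \<noteq> 0"
    using df Xh assms(2) z unfolding defining_function_def D_def by blast
  have "TG X \<noteq> 0" using mink_TG[OF assms(2) v(1)] v(2) by (auto simp: mink_simps)
  then show "0 < c2 X" unfolding c2_def using mink_pos_tangent[of X "TG X"] hypD(1)[OF Xh] mink_TG_self[OF Xh] by simp
qed

text \<open>The minimum of the Rayleigh quotient of the shape operator is a principal curvature.\<close>

theorem second_fundamental_form: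
  assumes h: "uniformly_h_convex K" and X: "X \<in> hboundary K" "X \<in> U"
    and w: "w \<noteq> 0" "mink X w = 0" "D w X = 0"
  shows "sqrt (c2 X) * mink w w < H X w w + th X * mink w w"
proof -
  note B = boundary_zero[OF X]
  have XUs: "X \<in> Us" using B X by (simp add: Us_def)
  obtain \<delta> where \<delta>: "\<delta> > 0" "\<And>\<kappa>. principal_curvature K X \<kappa> \<Longrightarrow> \<kappa> > 1 + \<delta>"
    using h X(1) unfolding uniformly_h_convex_def by blast
  define f where "f x = c2 x powr (- (1/2))" for x
  define N' where "N' = frechet_derivative Nf (at X)"
  have "Ck_on (Suc 0) Us Nf" using smooth_Nf by (simp only: smooth_on_def)
  then have N': "(Nf has_derivative N') (at X)" unfolding N'_def using XUs by (rule Ck_on_SucD)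
  have "Ck_on (Suc 0) Us f"
    unfolding f_def[abs_def] by (intro Ck_on_powr[OF open_Us] Ck_on_subset[OF Ck_c2 Us_subset]) (simp add: Us_def)
  from Ck_on_SucD[OF this XUs] obtain f' where f': "(f has_derivative f') (at X)" ..
  define TG' where "TG' = (\<lambda>w. (\<Sum>i\<in>Basis. DD i w X *\<^sub>R flip i) + (th X *\<^sub>R w + (D w X + H X X w) *\<^sub>R X))"
  have "(Nf has_derivative (\<lambda>v. f X *\<^sub>R TG' v + f' v *\<^sub>R TG X)) (at X)"
    unfolding Nf_def[abs_def] f_def[symmetric] TG'_def
    by (rule bounded_bilinear.FDERIV[OF bounded_bilinear_scaleR f' TG_deriv[OF X(2)]])
  from has_derivative_unique[OF N' this] have N'eq: "N' v = f X *\<^sub>R TG' v + f' v *\<^sub>R TG X" for v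
    by (rule fun_cong)
  have fX: "f X = 1 / sqrt (c2 X)" using B(3) by (simp add: f_def powr_minus_divide powr_half_sqrt)
  have fpos: "f X > 0" using B(3) by (simp add: f_def)
  have lin: "linear N'" using has_derivative_linear[OF N'] .
  have mTG': "mink (TG' v) u = H X u v + th X * mink v u + (D v X + H X X v) * mink X u" for u v
    unfolding TG'_def mink_simps mink_G_deriv by simp
  define V where "V = {v. mink X v = 0 \<and> mink (TG X) v = 0}"
  have V: "subspace V" unfolding V_def subspace_def by (auto simp: mink_simps)
  have VD: "D v X = 0" if "v \<in> V" for v using that mink_TG[OF X(2), of v] by (simp add: V_def)
  have form: "mink (N' v) u = f X * (H X u v + th X * mink v u)" if "u \<in> V" for u v
    using that unfolding N'eq mink_simps mTG' V_def by simp
  \<comment> \<open>Orthogonality of \<open>Nf x\<close> and \<open>x\<close> is known on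
    \<open>hyp\<close> only, so it is not differentiated; the claim is read off from the explicit
    derivative.\<close>
  have NX: "mink (N' v) X = 0" if v: "v \<in> V" for v
  proof -
    have "mink v X = 0" using v mink_commute[of v X] by (simp add: V_def)
    then show ?thesis
      unfolding N'eq mink_simps mTG' using mink_TG_self[OF B(1)] mink_commute[of X "TG X"] hypD(1)[OF B(1)] VD[OF v]
      by simp
  qed
  have NN: "mink (N' v) (TG X) = 0" for v
  proof -
    have "((\<lambda>x. mink (Nf x) (Nf x)) has_derivative (\<lambda>v. mink (Nf X) (N' v) + mink (N' v) (Nf X))) (at X)"
      by (rule bounded_bilinear.FDERIV[OF bounded_bilinear_mink N' N'])
    moreover have "((\<lambda>x. mink (Nf x) (Nf x)) has_derivative (\<lambda>v. 0)) (at X)"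
      by (rule has_derivative_transform_within_open[OF _ open_Us XUs, of "\<lambda>x. 1"]) (auto simp: mink_Nf)
    ultimately have "(\<lambda>v. mink (Nf X) (N' v) + mink (N' v) (Nf X)) = (\<lambda>v. 0)"
      by (rule has_derivative_unique)
    then have "mink (Nf X) (N' v) + mink (N' v) (Nf X) = 0" by (rule fun_cong)
    then have "mink (N' v) (Nf X) = 0" using mink_commute[of "Nf X" "N' v"] by simp
    then show ?thesis using fpos by (simp add: Nf_def f_def mink_simps)
  qed
  have AV: "N' v \<in> V" if "v \<in> V" for v
    using NX[OF that] NN[of v] mink_commute[of "N' v"] by (simp add: V_def)
  have sym: "mink (N' u) v = mink (N' v) u" if "u \<in> V" "v \<in> V" for u v
    using that by (simp add: form H_commute[OF X(2), of u v] mink_commute[of u v])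
  have pos: "0 < mink v v" if "v \<in> V" "v \<noteq> 0" for v
    using mink_pos_tangent[of X v] hypD(1)[OF B(1)] that by (simp add: V_def)
  have wV: "w \<in> V" using w mink_TG[OF X(2) w(2)] by (simp add: V_def)
  have "\<exists>v \<kappa>. v \<in> V \<and> v \<noteq> 0 \<and> N' v = \<kappa> *\<^sub>R v \<and> \<kappa> * mink w w \<le> mink (N' w) w"
    by (rule rayleigh_eigenvector[OF V lin AV bounded_bilinear_mink mink_commute pos sym wV w(1)])
  then obtain v \<kappa> where v: "v \<in> V" "v \<noteq> 0" "N' v = \<kappa> *\<^sub>R v" "\<kappa> * mink w w \<le> mink (N' w) w"
    by (elim exE conjE)
  have "mink (Nf X) v = 0" using v(1) by (simp add: V_def Nf_def mink_simps)
  moreover have "\<forall>Y\<in>hboundary K \<inter> Us. outward_unit_normal K Y (Nf Y)" using outward_Nf by blast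
  ultimately have "principal_curvature K X \<kappa>"
    unfolding principal_curvature_def
    using v(1-3) open_Us XUs smooth_Nf
    by (intro exI[of _ Us] exI[of _ Nf] conjI exI[of _ v]) (simp_all add: V_def N'_def)
  then have "1 < \<kappa>" using \<delta> by force
  then have "1 * mink w w < \<kappa> * mink w w" using pos[OF wV w(1)] by (intro mult_strict_right_mono)
  then have "mink w w < mink (N' w) w" using v(4) by simp
  also have "\<dots> = (H X w w + th X * mink w w) / sqrt (c2 X)" unfolding form[OF wV] fX by simp
  finally show ?thesis using B(3) by (simp add: less_divide_eq mult.commute)
qed

end

text \<open>\<open>f1 u v \<noteq> 0\<close> or \<open>f2 u v > 0\<close> is an open condition,
  valid at \<open>u0\<close> for all \<open>v\<close> in the compact unit sphere. The tube lemma
  spreads it to nearby \<open>u\<close>, and homogeneity extends it from unit vectors to all nonzero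
  \<open>v\<close>.\<close>

lemma (in line_derivs) pos_neighbourhood:
  assumes u0: "u0 \<in> V"
    and c1: "continuous_on (V \<times> UNIV) (\<lambda>q. f1 (fst q) (snd q))"
    and c2: "continuous_on (V \<times> UNIV) (\<lambda>q. f2 (fst q) (snd q))"
    and h1: "\<And>u v c. u \<in> V \<Longrightarrow> f1 u (c *\<^sub>R v) = c * f1 u v"
    and h2: "\<And>u v c. u \<in> V \<Longrightarrow> f2 u (c *\<^sub>R v) = c\<^sup>2 * f2 u v"
    and pos: "\<And>v. v \<noteq> 0 \<Longrightarrow> f1 u0 v = 0 \<Longrightarrow> f2 u0 v > 0"
  shows "\<exists>r>0. ball u0 r \<subseteq> V \<and> (\<forall>u\<in>ball u0 r. \<forall>v. v \<noteq> 0 \<longrightarrow> f1 u v = 0 \<longrightarrow> f2 u v > 0)"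
proof -
  define W where "W = {q \<in> V \<times> UNIV. f1 (fst q) (snd q) \<noteq> 0 \<or> 0 < f2 (fst q) (snd q)}"
  have oV: "open (V \<times> (UNIV :: 'a set))" using V by (intro open_Times open_UNIV)
  have "W = ((\<lambda>q. f1 (fst q) (snd q)) -` (- {0}) \<inter> V \<times> UNIV) \<union> ((\<lambda>q. f2 (fst q) (snd q)) -` {0<..} \<inter> V \<times> UNIV)"
    by (auto simp: W_def)
  moreover have "open ((\<lambda>q. f1 (fst q) (snd q)) -` (- {0}) \<inter> V \<times> UNIV)"
    by (rule continuous_on_open_vimage[OF oV, THEN iffD1, OF c1, rule_format]) (intro open_Compl closed_singleton)
  moreover have "open ((\<lambda>q. f2 (fst q) (snd q)) -` {0<..} \<inter> V \<times> UNIV)"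
    by (rule continuous_on_open_vimage[OF oV, THEN iffD1, OF c2, rule_format]) simp
  ultimately have oW: "open W" by (simp only: open_Un)
  have "(u0, v) \<in> W" if "v \<in> sphere 0 1" for v
    using u0 pos[of v] that by (cases "v = 0"; cases "f1 u0 v = 0") (simp_all add: W_def)
  then have "{u0} \<times> sphere 0 1 \<subseteq> W" by blast
  from Elementary_Topology.tube_lemma[OF compact_sphere oW this]
  obtain X0 where X0: "u0 \<in> X0" "open X0" "X0 \<times> sphere 0 1 \<subseteq> W" by (elim exE conjE)
  have "open (X0 \<inter> V)" "u0 \<in> X0 \<inter> V" using X0 V u0 by (auto intro: open_Int)
  then obtain r where r: "0 < r" "ball u0 r \<subseteq> X0 \<inter> V" by (rule openE)
  have "f2 u v > 0" if u: "u \<in> ball u0 r" and v: "v \<noteq> 0" "f1 u v = 0" for u v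
  proof -
    have uX: "u \<in> X0" and uV: "u \<in> V" using subsetD[OF r(2) u] by simp_all
    have "(u, sgn v) \<in> W" by (rule subsetD[OF X0(3)]) (use uX v(1) in \<open>simp add: norm_sgn\<close>)
    moreover have "f1 u (sgn v) = 0" using v(2) by (simp add: sgn_div_norm h1[OF uV])
    ultimately have "0 < f2 u (sgn v)" by (simp add: W_def)
    then show ?thesis using v(1) by (simp add: sgn_div_norm h2[OF uV] zero_less_mult_iff)
  qed
  then show ?thesis using r by (intro exI[of _ r] conjI ballI allI impI) auto
qed

section \<open>The defining function in the chart of a null direction\<close>

locale chart = deffun K U \<rho> for K U :: "'m::finite minkowski set" and \<rho> +
  fixes z :: "real ^ 'm"
  assumes z: "z \<in> sphere 0 1"
begin

text \<open>Along the line from \<open>u\<close> in direction \<open>v\<close>, the point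
  \<open>emb z\<close> moves with velocity \<open>E1 u v\<close> and acceleration
  \<open>sg u v\<close> times \<open>nullv z\<close>. \<open>f1\<close> and \<open>f2\<close> are
  the resulting first two derivatives of \<open>\<rho>\<close>, written in the basis so that
  continuity in \<open>(u, v)\<close> can be read off.\<close>

definition "tau u = (1 + u \<bullet> u) / (2 * ht z u)"
definition "t1 u v = (u \<bullet> v + tau u * (v \<bullet> z)) / ht z u"
definition "E1 u v = (v, 0) + t1 u v *\<^sub>R nullv z"
definition "sg u v = mink (E1 u v) (E1 u v) / ht z u"
definition "f1 u v = (\<Sum>i\<in>Basis. (E1 u v \<bullet> i) * D i (emb z u))"
definition "f2 u v = (\<Sum>i\<in>Basis. (E1 u v \<bullet> i) * (\<Sum>j\<in>Basis. (E1 u v \<bullet> j) * DD i j (emb z u)))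
    + sg u v * (\<Sum>i\<in>Basis. (nullv z \<bullet> i) * D i (emb z u))"
definition "V = {u. 0 < ht z u \<and> emb z u \<in> U}"

lemma emb_eq: "emb z u = (u, 0) + tau u *\<^sub>R nullv z"
  by (simp add: emb_def tau_def)

lemma ht_line: "ht z (u + s *\<^sub>R v) = ht z u - s * (v \<bullet> z)"
  by (simp add: ht_def inner_add_left)

lemma continuous_ht: "continuous_on S f \<Longrightarrow> continuous_on S (\<lambda>x. ht z (f x))"
  unfolding ht_def by (intro continuous_intros)

lemma continuous_tau:
  "continuous_on S f \<Longrightarrow> (\<And>x. x \<in> S \<Longrightarrow> 0 < ht z (f x)) \<Longrightarrow> continuous_on S (\<lambda>x. tau (f x))"
  unfolding tau_def by (intro continuous_intros continuous_ht) force+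

lemma continuous_emb:
  "continuous_on S f \<Longrightarrow> (\<And>x. x \<in> S \<Longrightarrow> 0 < ht z (f x)) \<Longrightarrow> continuous_on S (\<lambda>x. emb z (f x))"
  unfolding emb_eq by (intro continuous_intros continuous_tau) auto

lemma open_V: "open V"
proof -
  have o: "open {u. 0 < ht z u}"
    by (intro open_Collect_less continuous_on_const continuous_ht continuous_on_id)
  have "open (emb z -` U \<inter> {u. 0 < ht z u})"
    using continuous_on_open_vimage[OF o, of "emb z"] continuous_emb[OF continuous_on_id, of "{u. 0 < ht z u}"] U
    by simp
  moreover have "V = emb z -` U \<inter> {u. 0 < ht z u}" by (auto simp: V_def)
  ultimately show ?thesis by simp
qed

lemma f1_eq: "u \<in> V \<Longrightarrow> f1 u v = D (E1 u v) (emb z u)"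
  by (simp add: f1_def V_def D_basis[of _ "E1 u v"])

lemma f2_eq: "u \<in> V \<Longrightarrow> f2 u v = H (emb z u) (E1 u v) (E1 u v) + sg u v * D (nullv z) (emb z u)"
  by (simp add: f2_def V_def H_def DD_basis[of _ _ "E1 u v"] D_basis[of _ "nullv z"])

lemma tau_deriv:
  assumes "0 < ht z u"
  shows "((\<lambda>s. tau (u + s *\<^sub>R v)) has_real_derivative t1 u v) (at 0)"
proof -
  have eq: "tau (u + s *\<^sub>R v) = (1 + (u \<bullet> u + 2 * s * (u \<bullet> v) + s * s * (v \<bullet> v))) / (2 * (ht z u - s * (v \<bullet> z)))" for s
    unfolding tau_def ht_line by (simp add: inner_add_left inner_add_right inner_commute algebra_simps)
  show ?thesis
    unfolding eq using assms
    by (auto intro!: derivative_eq_intros) (simp add: t1_def tau_def field_simps)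
qed

lemma mink_E1: "mink (E1 u v) (E1 u v) = v \<bullet> v + 2 * t1 u v * (v \<bullet> z)"
  using mink_nullv_self[OF z]
  by (simp only: E1_def mink_simps mink_pair_nullv mink_pair) (simp add: ht_def)

lemma t1_deriv:
  assumes "0 < ht z u"
  shows "((\<lambda>s. t1 (u + s *\<^sub>R v) v) has_real_derivative sg u v) (at 0)"
proof -
  have eq: "t1 (u + s *\<^sub>R v) v = (u \<bullet> v + s * (v \<bullet> v) + tau (u + s *\<^sub>R v) * (v \<bullet> z)) / (ht z u - s * (v \<bullet> z))" for s
    unfolding t1_def ht_line by (simp add: inner_add_left)
  have t: "t1 u v * ht z u = u \<bullet> v + tau u * (v \<bullet> z)" using assms by (simp add: t1_def)
  have "((\<lambda>s. t1 (u + s *\<^sub>R v) v) has_real_derivative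
      ((v \<bullet> v + t1 u v * (v \<bullet> z)) * ht z u - (u \<bullet> v + tau u * (v \<bullet> z)) * (- (v \<bullet> z))) / (ht z u * ht z u)) (at 0)"
    unfolding eq using assms by (auto intro!: derivative_eq_intros tau_deriv)
  moreover have "((v \<bullet> v + t1 u v * (v \<bullet> z)) * ht z u - (u \<bullet> v + tau u * (v \<bullet> z)) * (- (v \<bullet> z))) / (ht z u * ht z u) = sg u v"
    unfolding t[symmetric] sg_def mink_E1 using assms by (simp add: field_simps)
  ultimately show ?thesis by simp
qed

lemma emb_deriv:
  assumes "0 < ht z u"
  shows "((\<lambda>s. emb z (u + s *\<^sub>R v)) has_vector_derivative E1 u v) (at 0)"
proof -
  have eq: "emb z (u + s *\<^sub>R v) = ((u, 0) + s *\<^sub>R (v, 0)) + tau (u + s *\<^sub>R v) *\<^sub>R nullv z" for s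
    by (simp add: emb_eq)
  show ?thesis unfolding eq E1_def
    using tau_deriv[OF assms, of v]
    by (auto intro!: derivative_eq_intros simp: has_real_derivative_iff_has_vector_derivative)
qed

lemma E1_deriv:
  assumes "0 < ht z u"
  shows "((\<lambda>s. E1 (u + s *\<^sub>R v) v) has_vector_derivative sg u v *\<^sub>R nullv z) (at 0)"
  unfolding E1_def using t1_deriv[OF assms, of v]
  by (auto intro!: derivative_eq_intros simp: has_real_derivative_iff_has_vector_derivative)

lemma comp_deriv:
  fixes F :: "'m minkowski \<Rightarrow> real"
  assumes "0 < ht z u" and F: "(F has_derivative F') (at (emb z u))"
  shows "((\<lambda>s. F (emb z (u + s *\<^sub>R v))) has_real_derivative F' (E1 u v)) (at 0)"
proof -
  have "((\<lambda>s. emb z (u + s *\<^sub>R v)) has_derivative (\<lambda>r. r *\<^sub>R E1 u v)) (at 0)"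
    using emb_deriv[OF assms(1)] by (simp add: has_vector_derivative_def)
  moreover have "(F has_derivative F') (at (emb z (u + 0 *\<^sub>R v)))" using F by simp
  ultimately have "((\<lambda>s. F (emb z (u + s *\<^sub>R v))) has_derivative (\<lambda>r. F' (r *\<^sub>R E1 u v))) (at 0)"
    by (rule has_derivative_compose)
  moreover have "(\<lambda>r. F' (r *\<^sub>R E1 u v)) = (\<lambda>r. F' (E1 u v) * r)"
    using linear_cmul[OF has_derivative_linear[OF F]] by (simp add: mult.commute)
  ultimately show ?thesis by (simp add: has_field_derivative_def)
qed

sublocale line_derivs "\<lambda>u. \<rho> (emb z u)" f1 f2 V
proof
  show "open V" by (rule open_V)
  fix u v assume u: "u \<in> V"
  have h: "0 < ht z u" and eU: "emb z u \<in> U" using u by (auto simp: V_def)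
  show "((\<lambda>s. \<rho> (emb z (u + s *\<^sub>R v))) has_real_derivative f1 u v) (at 0)"
    unfolding f1_eq[OF u] by (rule comp_deriv[OF h rho_deriv[OF eU]])
  have "((\<lambda>s. (E1 (u + s *\<^sub>R v) v \<bullet> i) * D i (emb z (u + s *\<^sub>R v))) has_real_derivative
      (E1 u v \<bullet> i) * DD i (E1 u v) (emb z u) + (sg u v *\<^sub>R nullv z \<bullet> i) * D i (emb z u)) (at 0)" for i
  proof -
    have "((\<lambda>s. E1 (u + s *\<^sub>R v) v \<bullet> i) has_real_derivative (sg u v *\<^sub>R nullv z) \<bullet> i) (at 0)"
      using bounded_linear.has_vector_derivative[OF bounded_linear_inner_left E1_deriv[OF h]]
      by (simp add: has_real_derivative_iff_has_vector_derivative)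
    from DERIV_mult[OF this comp_deriv[OF h D_deriv[OF eU], of i v]]
    show ?thesis by (simp add: algebra_simps)
  qed
  then have "((\<lambda>s. f1 (u + s *\<^sub>R v) v) has_real_derivative
      (\<Sum>i\<in>Basis. (E1 u v \<bullet> i) * DD i (E1 u v) (emb z u) + (sg u v *\<^sub>R nullv z \<bullet> i) * D i (emb z u))) (at 0)"
    unfolding f1_def by (rule DERIV_sum)
  moreover have "(\<Sum>i\<in>Basis. (E1 u v \<bullet> i) * DD i (E1 u v) (emb z u) + (sg u v *\<^sub>R nullv z \<bullet> i) * D i (emb z u)) = f2 u v"
    unfolding f2_def
    by (simp add: DD_basis[OF eU, of _ "E1 u v"] sum.distrib sum_distrib_left mult.assoc)
  ultimately show "((\<lambda>s. f1 (u + s *\<^sub>R v) v) has_real_derivative f2 u v) (at 0)" by simp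
qed

lemma E1_scale: "E1 u (c *\<^sub>R v) = c *\<^sub>R E1 u v"
proof -
  have "t1 u (c *\<^sub>R v) = c * t1 u v" by (simp add: t1_def algebra_simps add_divide_distrib)
  then show ?thesis by (simp add: E1_def scaleR_add_right)
qed

lemma f1_scale: "f1 u (c *\<^sub>R v) = c * f1 u v"
  unfolding f1_def E1_scale by (simp add: sum_distrib_left mult.assoc)

lemma f2_scale: "f2 u (c *\<^sub>R v) = c\<^sup>2 * f2 u v"
proof -
  have s: "sg u (c *\<^sub>R v) = c\<^sup>2 * sg u v"
    unfolding sg_def E1_scale by (simp add: mink_simps power2_eq_square)
  have "(\<Sum>i\<in>Basis. (E1 u (c *\<^sub>R v) \<bullet> i) * (\<Sum>j\<in>Basis. (E1 u (c *\<^sub>R v) \<bullet> j) * DD i j (emb z u)))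
      = c\<^sup>2 * (\<Sum>i\<in>Basis. (E1 u v \<bullet> i) * (\<Sum>j\<in>Basis. (E1 u v \<bullet> j) * DD i j (emb z u)))"
    unfolding E1_scale by (simp add: sum_distrib_left power2_eq_square mult.assoc mult.left_commute)
  then show ?thesis unfolding f2_def s by (simp add: distrib_left mult.assoc)
qed

lemma continuous_E1: "continuous_on (V \<times> UNIV) (\<lambda>q. E1 (fst q) (snd q))"
  unfolding E1_def t1_def
  by (intro continuous_intros continuous_tau continuous_ht) (auto simp: V_def)

lemma continuous_D_emb:
  "continuous_on (V \<times> UNIV) (\<lambda>q :: _ \<times> (real ^ 'm). D i (emb z (fst q)))"
  "continuous_on (V \<times> UNIV) (\<lambda>q :: _ \<times> (real ^ 'm). DD i j (emb z (fst q)))"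
  by (rule continuous_on_compose2[OF continuous_D continuous_emb[OF continuous_on_fst[OF continuous_on_id]]]
      continuous_on_compose2[OF continuous_DD continuous_emb[OF continuous_on_fst[OF continuous_on_id]]];
      auto simp: V_def)+

lemma continuous_f1: "continuous_on (V \<times> UNIV) (\<lambda>q. f1 (fst q) (snd q))"
  unfolding f1_def by (intro continuous_intros continuous_E1 continuous_D_emb)

lemma continuous_f2: "continuous_on (V \<times> UNIV) (\<lambda>q. f2 (fst q) (snd q))"
  unfolding f2_def sg_def
  by (intro continuous_intros continuous_E1 continuous_D_emb continuous_ht) (auto simp: V_def)

text \<open>Chart lines are bent: their acceleration contributes \<open>mink w w / ht z u\<close>
  times the derivative of \<open>\<rho>\<close> along \<open>nullv z\<close>. Since
  \<open>X - Nf X\<close> is null and future-directed, that derivative is at least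
  \<open>(th X - sqrt (c2 X)) * ht z u\<close>, so the loss is at most that of curvature 1, which
  \<open>second_fundamental_form\<close> exceeds.\<close>

lemma f2_pos_boundary:
  assumes h: "uniformly_h_convex K" and b: "emb z u \<in> hboundary K" and u: "u \<in> V"
    and v: "v \<noteq> 0" "f1 u v = 0"
  shows "0 < f2 u v"
proof -
  define X where "X = emb z u"
  define w where "w = E1 u v"
  have ht: "0 < ht z u" and XU: "X \<in> U" using u by (auto simp: V_def X_def)
  note B = boundary_zero[OF b[folded X_def] XU]
  have "proj z w = v" by (simp add: w_def E1_def proj_add proj_scaleR proj_nullv proj_pair)
  then have w0: "w \<noteq> 0" using v(1) by (auto simp: proj_def)
  have tan: "mink X w = 0"
    unfolding X_def emb_eq w_def E1_def mink_simps mink_pair mink_pair_nullv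
    using ht mink_nullv_self[OF z] by (simp add: t1_def ht_def[of z v])
  have Dw: "D w X = 0" using v(2) f1_eq[OF u, of v] by (simp add: w_def X_def)
  have ww: "0 < mink w w" using mink_pos_tangent[OF _ tan w0] hypD(1)[OF B(1)] by simp
  note S = second_fundamental_form[OF h b[folded X_def] XU w0 tan Dw]
  have lcX: "lc X z = ht z u" using ht_proj[OF z, of X] by (simp add: X_def proj_emb)
  have XUs: "X \<in> Us" using B XU by (simp add: Us_def)
  have XN: "mink X (Nf X) = 0" using mink_TG_self[OF B(1)] by (simp add: Nf_def mink_simps)
  have TG: "TG X = sqrt (c2 X) *\<^sub>R Nf X" using B(3) by (simp add: Nf_def powr_minus_divide powr_half_sqrt)
  have "mink (X - Nf X) (nullv z) \<le> 0"
    using minus_normal_null[OF B(1) XN mink_Nf[OF XUs]] z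
    by (intro mink_cone_nonpos) (simp_all add: nullv_def)
  then have "- ht z u \<le> mink (Nf X) (nullv z)" by (simp add: mink_simps mink_nullv(1)[of X] lcX)
  then have "sqrt (c2 X) * (- ht z u) \<le> mink (TG X) (nullv z)"
    unfolding TG mink_simps using B(3) by (intro mult_left_mono) auto
  moreover have "mink (TG X) (nullv z) = D (nullv z) X - th X * ht z u"
  proof -
    have "mink (TG X) (nullv z) = mink (G X) (nullv z) + th X * mink X (nullv z)"
      by (simp only: TG_def mink_add_left mink_scaleR_left)
    then show ?thesis by (simp only: mink_G[OF XU]) (simp add: mink_nullv(1)[of X] lcX)
  qed
  ultimately have "(th X - sqrt (c2 X)) * ht z u \<le> D (nullv z) X" by (simp add: algebra_simps)
  then have "(mink w w / ht z u) * ((th X - sqrt (c2 X)) * ht z u) \<le> (mink w w / ht z u) * D (nullv z) X"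
    using ww ht by (intro mult_left_mono) auto
  then have "mink w w * (th X - sqrt (c2 X)) \<le> (mink w w / ht z u) * D (nullv z) X"
    using ht by simp
  moreover have "f2 u v = H X w w + (mink w w / ht z u) * D (nullv z) X"
    unfolding f2_eq[OF u] sg_def w_def X_def ..
  ultimately show ?thesis using S by (simp add: algebra_simps)
qed

lemma boundary_neighbourhood:
  assumes "uniformly_h_convex K" "emb z u0 \<in> hboundary K" "u0 \<in> V"
  shows "\<exists>r>0. ball u0 r \<subseteq> V \<and> (\<forall>u\<in>ball u0 r. \<forall>v. v \<noteq> 0 \<longrightarrow> f1 u v = 0 \<longrightarrow> f2 u v > 0)"
  using pos_neighbourhood[OF assms(3) continuous_f1 continuous_f2 f1_scale f2_scale]
    f2_pos_boundary[OF assms] by blast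

lemma in_proj_iff:
  assumes "u \<in> V"
  shows "u \<in> proj z ` K \<longleftrightarrow> \<rho> (emb z u) \<le> 0"
proof -
  have h: "0 < ht z u" and eU: "emb z u \<in> U" using assms by (auto simp: V_def)
  have eh: "emb z u \<in> hyp" by (rule emb_in_hyp[OF z h])
  have "u \<in> proj z ` K \<longleftrightarrow> emb z u \<in> K"
  proof
    assume "u \<in> proj z ` K"
    then obtain X where "X \<in> K" "u = proj z X" by (elim imageE)
    then show "emb z u \<in> K" using emb_proj[OF z, of X] K(1) by auto
  next
    assume "emb z u \<in> K"
    then have "proj z (emb z u) \<in> proj z ` K" by (rule imageI)
    then show "u \<in> proj z ` K" by (simp only: proj_emb)
  qed
  then show ?thesis using sublevel[OF eh eU] by simp
qed

end

text \<open>The sign of \<open>f2\<close> at boundary points is used twice: in a neighbourhood it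
  gives local convexity of the image, and at the point itself it keeps the relative interior of a
  segment in the image off the boundary.\<close>

theorem convex_proj:
  fixes K :: "'m::finite minkowski set"
  assumes s: "smooth_bounded_domain K" and h: "uniformly_h_convex K" and z: "z \<in> sphere 0 1"
  shows "convex (proj z ` K)"
proof -
  have Kh: "K \<subseteq> hyp" and comp: "compact K" and conn: "connected K"
    and loc: "\<And>X. X \<in> hboundary K \<Longrightarrow> \<exists>U \<rho>. X \<in> U \<and> defining_function K U \<rho>"
    using s by (auto simp: smooth_bounded_domain_def)
  have Kc: "closed K" using comp by (rule compact_imp_closed)
  define S where "S = proj z ` K"
  have cont: "continuous_on K (proj z)" unfolding proj_def by (intro continuous_intros)
  have clS: "closed S" unfolding S_def by (rule compact_imp_closed[OF compact_continuous_image[OF cont comp]])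
  have conS: "connected S" unfolding S_def by (rule connected_continuous_image[OF cont conn])
  have embK: "emb z u \<in> K" "emb z u \<in> hyp" "0 < ht z u" if "u \<in> S" for u
  proof -
    obtain X where X: "X \<in> K" "u = proj z X" using \<open>u \<in> S\<close> unfolding S_def by (elim imageE)
    have Xh: "X \<in> hyp" using X(1) Kh by blast
    show "emb z u \<in> K" "emb z u \<in> hyp" unfolding X(2) emb_proj[OF z Xh] by (fact X(1) Xh)+
    show "0 < ht z u" unfolding X(2) ht_proj[OF z] using lc_pos[OF Xh] z by simp
  qed
  have inner: "u \<in> interior S" if u: "u \<in> S" "emb z u \<notin> hboundary K" for u
  proof -
    obtain T where T: "open T" "emb z u \<in> T" "T \<inter> hyp \<subseteq> K"
      using u(2) embK(1)[OF u(1)] unfolding hboundary_iff[OF Kh Kc] by blast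
    have o: "open {u. 0 < ht z u}" unfolding ht_def by (intro open_Collect_less continuous_intros)
    have "continuous_on {u. 0 < ht z u} (emb z)"
      unfolding emb_def ht_def by (intro continuous_intros) auto
    then have "open (emb z -` T \<inter> {u. 0 < ht z u})"
      using continuous_on_open_vimage[OF o, of "emb z"] T(1) by blast
    moreover have "emb z -` T \<inter> {u. 0 < ht z u} \<subseteq> S"
    proof
      fix u' assume "u' \<in> emb z -` T \<inter> {u. 0 < ht z u}"
      then have "emb z u' \<in> K" using T(3) emb_in_hyp[OF z, of u'] by blast
      then have "proj z (emb z u') \<in> S" unfolding S_def by (rule imageI)
      then show "u' \<in> S" by (simp only: proj_emb)
    qed
    moreover have "u \<in> emb z -` T \<inter> {u. 0 < ht z u}" using T(2) embK(3)[OF u(1)] by simp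
    ultimately show ?thesis by (meson interiorI)
  qed
  have "convex S"
  proof (rule locally_strictly_convex_imp_convex[OF clS conS])
    fix u assume u: "u \<in> S"
    show "\<exists>r>0. convex (S \<inter> ball u r)"
    proof (cases "emb z u \<in> hboundary K")
      case False
      from inner[OF u False] obtain r where r: "r > 0" "ball u r \<subseteq> S" by (auto simp: mem_interior)
      then have "S \<inter> ball u r = ball u r" by blast
      then show ?thesis using r(1) convex_ball by metis
    next
      case True
      obtain U \<rho> where UR: "emb z u \<in> U" "defining_function K U \<rho>" using loc[OF True] by blast
      interpret chart K U \<rho> z by unfold_locales (fact UR(2) Kh Kc z)+
      have uV: "u \<in> V" using embK[OF u] UR(1) by (simp add: V_def)
      obtain r where r: "r > 0" "ball u r \<subseteq> V"
        "\<And>u' v. u' \<in> ball u r \<Longrightarrow> v \<noteq> 0 \<Longrightarrow> f1 u' v = 0 \<Longrightarrow> f2 u' v > 0"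
        using boundary_neighbourhood[OF h True uV] by blast
      have "S \<inter> ball u r = {u'\<in>ball u r. \<rho> (emb z u') \<le> 0}"
        using in_proj_iff r(2) unfolding S_def by blast
      then show ?thesis using sublevel_convex[OF convex_ball r(2,3)] r(1) by metis
    qed
  next
    fix x y assume xy: "x \<in> S" "y \<in> S" "x \<noteq> y" "closed_segment x y \<subseteq> S"
    show "open_segment x y \<subseteq> interior S"
    proof
      fix u assume u: "u \<in> open_segment x y"
      obtain s0 where s0: "0 < s0" "s0 < 1" "u = (1 - s0) *\<^sub>R x + s0 *\<^sub>R y"
        using u unfolding in_segment by blast
      define v where "v = y - x"
      have line: "x + s *\<^sub>R v = (1 - s) *\<^sub>R x + s *\<^sub>R y" for s by (simp add: v_def algebra_simps)
      have seg: "x + s *\<^sub>R v \<in> S" if "0 \<le> s" "s \<le> 1" for s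
        using xy(4) that unfolding line by (auto simp: closed_segment_def)
      have us: "u = x + s0 *\<^sub>R v" unfolding line by (rule s0(3))
      have uS: "u \<in> S" unfolding us by (rule seg) (use s0 in auto)
      show "u \<in> interior S"
      proof (rule ccontr)
        assume "u \<notin> interior S"
        then have b: "emb z u \<in> hboundary K" using inner[OF uS] by blast
        obtain U \<rho> where UR: "emb z u \<in> U" "defining_function K U \<rho>" using loc[OF b] by blast
        interpret chart K U \<rho> z by unfold_locales (fact UR(2) Kh Kc z)+
        have uV: "u \<in> V" using embK[OF uS] UR(1) by (simp add: V_def)
        have "open ((\<lambda>s. x + s *\<^sub>R v) -` V)" by (intro open_vimage open_V continuous_intros)
        moreover have "s0 \<in> (\<lambda>s. x + s *\<^sub>R v) -` V" using uV us by simp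
        ultimately obtain d where d: "d > 0" "ball s0 d \<subseteq> (\<lambda>s. x + s *\<^sub>R v) -` V"
          unfolding open_contains_ball by blast
        have "v \<noteq> 0" using xy(3) by (simp add: v_def)
        \<comment> \<open>\<open>\<rho>\<close> vanishes at \<open>emb z u\<close> and is
          nonpositive along the nearby part of the segment, so \<open>u\<close> would be a local
          maximum along the line.\<close>
        show False
        proof (rule not_local_max)
          show "x + s0 *\<^sub>R v \<in> V" using uV us by simp
          show "f2 (x + s0 *\<^sub>R v) v > 0" if "f1 (x + s0 *\<^sub>R v) v = 0"
            using f2_pos_boundary[OF h b uV \<open>v \<noteq> 0\<close>] that us by simp
          show "0 < min d (min s0 (1 - s0))" using d(1) s0 by simp
          fix s assume "\<bar>s - s0\<bar> < min d (min s0 (1 - s0))"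
          then have s: "\<bar>s - s0\<bar> < d" "0 \<le> s" "s \<le> 1" by auto
          then have "s \<in> ball s0 d" by (simp add: dist_real_def abs_minus_commute)
          then have "x + s *\<^sub>R v \<in> V" using d(2) by blast
          then have "\<rho> (emb z (x + s *\<^sub>R v)) \<le> 0"
            using in_proj_iff[of "x + s *\<^sub>R v"] seg[OF s(2,3)] by (simp add: S_def)
          moreover have "\<rho> (emb z u) = 0" using boundary_zero(2)[OF b UR(1)] .
          ultimately show "\<rho> (emb z (x + s *\<^sub>R v)) \<le> \<rho> (emb z (x + s0 *\<^sub>R v))" using us by simp
        qed
      qed
    qed
  qed
  then show ?thesis by (simp add: S_def)
qed

theorem smooth_uniformly_h_convex_imp_hconv:
  assumes s: "smooth_bounded_domain K" and h: "uniformly_h_convex K"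
  shows "hconv K"
proof (rule hconv_of_horopt_closed)
  have i: "(top_of_set hyp) interior_of K \<noteq> {}" and K: "compact K" "K \<subseteq> hyp"
    using s by (auto simp: smooth_bounded_domain_def)
  show "K \<noteq> {}" using i interior_of_subset[of "top_of_set hyp" K] by blast
  show "compact K" "K \<subseteq> hyp" by (fact K)+
  show "horopt z X Y e \<in> K" if "z \<in> sphere 0 1" "X \<in> K" "Y \<in> K" "0 \<le> e" "e \<le> 1" for z X Y e
    using horopt_in_of_convex_proj[OF K(2) that(1) convex_proj[OF s h that(1)] that(2-5)] .
qed

theorem theorem4p4:
  fixes n :: nat and p a b :: real and K L :: "'m::finite minkowski set"
  assumes "n \<ge> 1" and "CARD('m) = n + 1"
    and "1 / 2 \<le> p" and "p \<le> 2" and "a \<ge> 0" and "b \<ge> 0" and "a + b \<ge> 1"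
    and "smooth_bounded_domain K" and "uniformly_h_convex K"
    and "smooth_bounded_domain L" and "uniformly_h_convex L"
  shows "light_cone_sum p a K b L = h_p_sum p a K b L \<and>
         ball_wise_sum p a K b L = h_p_sum p a K b L"
proof -
  interpret psum p a b by unfold_locales (fact assms)+
  have K: "hconv K" and L: "hconv L"
    using assms smooth_uniformly_h_convex_imp_hconv by blast+
  then have "light_cone_sum p a K b L = h_p_sum p a K b L"
    using light_cone_sum_eq[OF K L] h_p_sum_eq[of K L] unfolding hconv_def by simp
  moreover have "ball_wise_sum p a K b L = light_cone_sum p a K b L"
    using K L assms(5,6) unfolding hconv_def by (intro ball_wise_sum_eq) blast+
  ultimately show ?thesis by simp
qed

end
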